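(* Let $K\ge 2$ and consider the $K$ user complex compound interference channel with a finite number $J_j\ge 1$ of possible states at each user $j=1,\dots,K$. Then, almost surely (with respect to the draw of the channel states), the total number of degrees of freedom is $d=\frac{K}{2}$.
   Context: Complex compound $K$ user interference channel. There are $K$ single-antenna transmitter–receiver pairs. Transmitter $j$ sends an independent message $W^{[j]}$ of rate $R^{[j]}$ to receiver $j$, $j=1,\dots,K$; each transmitter encodes only its own message. For each receiver $j$ there is a finite set of $J_j$ possible channel vectors (states) $(h^{[j1]}_{k_j},\dots,h^{[jK]}_{k_j})\in\mathbb{C}^K$, $k_j=1,\dots,J_j$. If receiver $j$ is in state $k_j$, its received signal (at each time) is $$y^{[j]}_{k_j}=\sum_{i=1}^{K}h^{[ji]}_{k_j}x^{[i]}+z^{[j]}_{k_j},$$ where $x^{[i]}\in\mathbb{C}$ is the signal of transmitter $i$, subject to the average power constraint $E(|x^{[i]}|^2)\le P$ (averaged over the codeword), and $z^{[j]}_{k_j}$ is i.i.d. (over time) zero-mean unit-variance circularly symmetric complex Gaussian noise. The states are fixed throughout the duration of communication. The sets of possible states are known to all nodes and do not depend on $P$; the transmitters do not know which states are realized, while the receivers have perfect channel knowledge. Almost surely. All the coefficients of all possible states are drawn from a continuous distribution (absolutely continuous with respect to Lebesgue measure on the real and imaginary parts); "almost surely" refers to this draw. Achievable rates. A rate tuple $(R^{[1]},\dots,R^{[K]})$ is achievable at power $P$ if there are codes (encoders not depending on the realized states) of growing block length such that every receiver $j$ decodes $W^{[j]}$ with arbitrarily small error probability, regardless of which state is realized.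 Degrees of freedom. The total number of degrees of freedom is $$d=\lim_{P\to\infty}\frac{C_\Sigma(P)}{\log P},$$ where $C_\Sigma(P)$ is the supremum of $R^{[1]}+\cdots+R^{[K]}$ over all rate tuples achievable at power $P$. *)

theory Defs
  imports "HOL-Probability.Probability"
begin

(* Users are numbered 0, ..., K - 1 and the states of receiver j are numbered 0, ..., J j - 1.
   The coefficient from transmitter i to receiver j, when the latter is in state k, is h (j, k, i). *)

type_synonym channel = "nat \<times> nat \<times> nat \<Rightarrow> complex"

definition coeff_index :: "nat \<Rightarrow> (nat \<Rightarrow> nat) \<Rightarrow> (nat \<times> nat \<times> nat) set" where
  "coeff_index K J = {(j, k, i). j < K \<and> k < J j \<and> i < K}"

(* The law of all coefficients of all states is jointly absolutely continuous.  The measure lborel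
   on the complex numbers is Lebesgue measure on the real and imaginary parts. *)
definition continuous_channel_law :: "nat \<Rightarrow> (nat \<Rightarrow> nat) \<Rightarrow> channel measure \<Rightarrow> bool" where
  "continuous_channel_law K J D \<longleftrightarrow>
     prob_space D \<and>
     sets D = sets (\<Pi>\<^sub>M q\<in>coeff_index K J. (borel :: complex measure)) \<and>
     absolutely_continuous (\<Pi>\<^sub>M q\<in>coeff_index K J. (lborel :: complex measure)) D"

(* Circular symmetry and unit variance: the real and imaginary parts are independent
   centred Gaussians of variance 1/2. *)
definition complex_noise :: "complex measure" where
  "complex_noise =
     density lborel
       (\<lambda>z. ennreal (normal_density 0 (sqrt (1/2)) (Re z) * normal_density 0 (sqrt (1/2)) (Im z)))"

definition block_noise :: "nat \<Rightarrow> (nat \<Rightarrow> complex) measure" where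
  "block_noise n = (\<Pi>\<^sub>M t\<in>{..<n}. complex_noise)"

(* msgs i: size of the message set {..<msgs i} of transmitter i;
   enc i w t: symbol sent by transmitter i at time t for message w (independent of the states);
   dec j k y: decision of receiver j in state k upon receiving the block y. *)
record code =
  msgs :: "nat \<Rightarrow> nat"
  enc :: "nat \<Rightarrow> nat \<Rightarrow> nat \<Rightarrow> complex"
  dec :: "nat \<Rightarrow> nat \<Rightarrow> (nat \<Rightarrow> complex) \<Rightarrow> nat"

definition received ::
  "nat \<Rightarrow> channel \<Rightarrow> nat \<Rightarrow> code \<Rightarrow> nat \<Rightarrow> nat \<Rightarrow> (nat \<Rightarrow> nat) \<Rightarrow> (nat \<Rightarrow> complex) \<Rightarrow> nat \<Rightarrow> complex"
where
  "received K h n c j k w z = (\<lambda>t\<in>{..<n}. (\<Sum>i<K. h (j, k, i) * enc c i (w i) t) + z t)"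

(* The expectation of the squared modulus is over the uniformly distributed message,
   averaged over the n symbols of the codeword. *)
definition avg_power :: "nat \<Rightarrow> code \<Rightarrow> nat \<Rightarrow> real" where
  "avg_power n c i =
     (\<Sum>w<msgs c i. (\<Sum>t<n. (cmod (enc c i w t))\<^sup>2) / real n) / real (msgs c i)"

(* The messages are independent and uniform, so the tuple of messages is uniform
   on the product set. *)
definition message_tuples :: "nat \<Rightarrow> code \<Rightarrow> (nat \<Rightarrow> nat) set" where
  "message_tuples K c = (\<Pi>\<^sub>E i\<in>{..<K}. {..<msgs c i})"

definition error_prob :: "nat \<Rightarrow> channel \<Rightarrow> nat \<Rightarrow> code \<Rightarrow> nat \<Rightarrow> nat \<Rightarrow> real" where
  "error_prob K h n c j k =
     (\<Sum>w\<in>message_tuples K c.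
        measure (block_noise n)
          {z \<in> space (block_noise n). dec c j k (received K h n c j k w z) \<noteq> w j})
     / real (card (message_tuples K c))"

definition valid_code ::
  "nat \<Rightarrow> (nat \<Rightarrow> nat) \<Rightarrow> real \<Rightarrow> nat \<Rightarrow> (nat \<Rightarrow> real) \<Rightarrow> code \<Rightarrow> bool"
where
  "valid_code K J P n R c \<longleftrightarrow>
     (\<forall>i<K. 2 powr (real n * R i) \<le> real (msgs c i)) \<and>
     (\<forall>i<K. avg_power n c i \<le> P) \<and>
     (\<forall>j<K. \<forall>k<J j. dec c j k \<in> measurable (\<Pi>\<^sub>M t\<in>{..<n}. borel) (count_space UNIV))"

(* Rates are in bits per channel use. *)
definition achievable ::
  "nat \<Rightarrow> (nat \<Rightarrow> nat) \<Rightarrow> channel \<Rightarrow> real \<Rightarrow> (nat \<Rightarrow> real) \<Rightarrow> bool"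
where
  "achievable K J h P R \<longleftrightarrow>
     (\<forall>i<K. 0 \<le> R i) \<and>
     (\<forall>\<epsilon>>0. \<forall>\<^sub>F n in sequentially.
        \<exists>c. valid_code K J P n R c \<and> (\<forall>j<K. \<forall>k<J j. error_prob K h n c j k \<le> \<epsilon>))"

definition sum_capacity :: "nat \<Rightarrow> (nat \<Rightarrow> nat) \<Rightarrow> channel \<Rightarrow> real \<Rightarrow> ereal" where
  "sum_capacity K J h P = (SUP R \<in> {R. achievable K J h P R}. ereal (\<Sum>i<K. R i))"

(* The limit exists and equals d. *)
definition has_degrees_of_freedom :: "nat \<Rightarrow> (nat \<Rightarrow> nat) \<Rightarrow> channel \<Rightarrow> real \<Rightarrow> bool" where
  "has_degrees_of_freedom K J h d \<longleftrightarrow>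
     ((\<lambda>P. sum_capacity K J h P / ereal (log 2 P)) \<longlongrightarrow> ereal d) at_top"

end

(*
  Converse: for each pair of users a single receiver with slightly less noise can decode both messages, so that the two
  rates together are at most log P + O(1).  Adding these bounds around a cycle of users gives K/2.

  Achievability: integer-valued symbols are sent along monomials in the cross coefficients, and multiplication by a
  channel coefficient almost preserves this set of monomials.  Interference thus occupies asymptotically half of
  the rational dimensions at every receiver in every state.  That the received constellation has nearly optimal
  minimum distance does not require a Khintchine-Groshev theorem on manifolds: each monomial is used along L further
  directions v_1, ..., v_L, and a counting argument produces directions for which the loss in the Diophantine exponent is
  a constant independent of L.  An exponent for the monomials themselves, however bad, follows from Borel-Cantelli by
  induction on the number of channel coefficients.  Since at fixed power the symbol errors have small but positive
  probability, a Gilbert-Varshamov code over the alphabet of symbols corrects them.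
*)

theory Submission
  imports Defs
    "HOL-Computational_Algebra.Fundamental_Theorem_Algebra"
    "HOL-Real_Asymp.Real_Asymp"
begin

section \<open>Outer codes\<close>

text \<open>The exponents behind K/2: with Gaussian integer symbols of size Q, L directions and M =
  n^\<Gamma> monomials, a user sends 2 L M log Q bits per symbol. A receiver sees at most m =
  n^\<Gamma> + (n+1)^\<Gamma> monomials per direction, so about Q^(2 m L) difference forms must stay
  away from 0. A grid of g^2 directions with g of order Q^(m L) has room for this and gives a
  distance of order Q^(-\<kappa> - m L); normalising the power costs one more factor Q. Equating
  Q^(\<kappa> + m L + 1) with sqrt P yields the rate L M / (\<kappa> + m L + 1) times log P, and M /
  m tends to 1/2. The directions depend on P and on all possible states, which is legitimate because
  the sets of states are known to the transmitters. One choice has to serve every receiver in every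
  state, which a finite count can provide. The converse involves no entropy: error probability 1/8
  in a single block already yields a packing bound, because the likelihood ratio of an output to one
  fixed law is at most (constant * P)^n unless the output has unusually large energy.\<close>

lemma hamming_ball_card:
  fixes A :: "'a set"
  assumes "finite A" "A \<noteq> {}" "x \<in> {..<n} \<rightarrow>\<^sub>E A"
  shows "card {y \<in> {..<n} \<rightarrow>\<^sub>E A. card {t. t < n \<and> y t \<noteq> x t} < d} \<le> 2 ^ n * card A ^ d"
proof -
  let ?q = "card A"
  have q: "?q \<ge> 1" using assms by (simp add: Suc_leI card_gt_0_iff)
  \<comment> \<open>\<open>F S\<close> consists of the words that agree with \<open>x\<close>
    outside \<open>S\<close>. Counting the sets \<open>S\<close> crudely by 2^n is the source of the
    one bit per symbol lost by the outer code.\<close>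
  define F where "F S = (\<Pi>\<^sub>E t\<in>{..<n}. if t \<in> S then A else {x t})" for S
  let ?T = "{S. S \<subseteq> {..<n} \<and> card S < d}"
  have fT: "finite ?T" by simp
  have cF: "card (F S) \<le> ?q ^ d" if "S \<in> ?T" for S
  proof -
    have "card (F S) = (\<Prod>t<n. if t \<in> S then ?q else 1)"
      unfolding F_def by (subst card_PiE) (auto intro!: prod.cong)
    also have "\<dots> = ?q ^ card ({..<n} \<inter> S)"
      by (subst prod.If_cases) (auto simp: Int_def)
    also have "{..<n} \<inter> S = S" using that by auto
    also have "?q ^ card S \<le> ?q ^ d" using that q by (intro power_increasing) auto
    finally show ?thesis .
  qed
  have fF: "finite (F S)" for S unfolding F_def using assms by (intro finite_PiE) auto
  have "{y \<in> {..<n} \<rightarrow>\<^sub>E A. card {t. t < n \<and> y t \<noteq> x t} < d} \<subseteq> (\<Union>S\<in>?T. F S)"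
  proof
    fix y assume y: "y \<in> {y \<in> {..<n} \<rightarrow>\<^sub>E A. card {t. t < n \<and> y t \<noteq> x t} < d}"
    have "y \<in> F {t. t < n \<and> y t \<noteq> x t}" using y unfolding F_def by (auto simp: PiE_iff)
    moreover have "{t. t < n \<and> y t \<noteq> x t} \<in> ?T" using y by auto
    ultimately show "y \<in> (\<Union>S\<in>?T. F S)" by (rule UN_I[rotated])
  qed
  then have "card {y \<in> {..<n} \<rightarrow>\<^sub>E A. card {t. t < n \<and> y t \<noteq> x t} < d} \<le> card (\<Union>S\<in>?T. F S)"
    by (intro card_mono) (auto simp: fT fF)
  also have "\<dots> \<le> (\<Sum>S\<in>?T. card (F S))" by (rule card_UN_le[OF fT])
  also have "\<dots> \<le> card ?T * ?q ^ d" using sum_bounded_above[of ?T "\<lambda>S. card (F S)"] cF by simp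
  also have "card ?T \<le> card (Pow {..<n})" by (intro card_mono) auto
  finally show ?thesis by (simp add: card_Pow)
qed

text \<open>A code of maximal cardinality is also covering: a word at distance at least
  \<open>d\<close> from all codewords could be added to it. Hence the balls of
  \<open>hamming_ball_card\<close> around the codewords exhaust all words.\<close>

lemma gilbert_varshamov:
  fixes A :: "'a set"
  assumes "finite A" "A \<noteq> {}"
  obtains M :: nat and C :: "nat \<Rightarrow> nat \<Rightarrow> 'a" where
    "\<And>w. w < M \<Longrightarrow> C w \<in> {..<n} \<rightarrow>\<^sub>E A"
    "\<And>w w'. w < M \<Longrightarrow> w' < M \<Longrightarrow> w \<noteq> w' \<Longrightarrow> d \<le> card {t. t < n \<and> C w t \<noteq> C w' t}"
    "card A ^ n \<le> M * (2 ^ n * card A ^ d)"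
proof -
  let ?X = "{..<n} \<rightarrow>\<^sub>E A"
  let ?H = "\<lambda>x y. card {t. t < n \<and> y t \<noteq> x t}"
  have fX: "finite ?X" using assms by (intro finite_PiE) auto
  define ok where "ok S \<longleftrightarrow> S \<subseteq> ?X \<and> (\<forall>x\<in>S. \<forall>y\<in>S. x \<noteq> y \<longrightarrow> d \<le> ?H x y)" for S
  have "\<forall>S. ok S \<longrightarrow> card S < Suc (card ?X)"
    unfolding ok_def using fX by (auto intro: card_mono simp: less_Suc_eq_le)
  moreover have "ok {}" unfolding ok_def by simp
  ultimately obtain S where S: "ok S" and mx: "\<And>S'. ok S' \<Longrightarrow> card S' \<le> card S"
    using ex_has_greatest_nat[of ok "{}" card "Suc (card ?X)"] by blast
  have okD: "d \<le> ?H x y" if "x \<in> S" "y \<in> S" "x \<noteq> y" for x y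
    using S that by (simp add: ok_def)
  have fS: "finite S" using S fX unfolding ok_def by (auto intro: finite_subset)
  have cover: "?X \<subseteq> (\<Union>x\<in>S. {y \<in> ?X. ?H x y < d}) \<union> S"
  proof
    fix y assume y: "y \<in> ?X"
    show "y \<in> (\<Union>x\<in>S. {y \<in> ?X. ?H x y < d}) \<union> S"
    proof (rule ccontr)
      assume n: "y \<notin> (\<Union>x\<in>S. {y \<in> ?X. ?H x y < d}) \<union> S"
      have sy: "?H x z = ?H z x" for x z
      proof -
        have "{t. t < n \<and> z t \<noteq> x t} = {t. t < n \<and> x t \<noteq> z t}" by auto
        then show ?thesis by simp
      qed
      have "ok (insert y S)" unfolding ok_def
      proof (intro conjI ballI impI)
        show "insert y S \<subseteq> ?X" using y S unfolding ok_def by auto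
      next
        fix a b assume ab: "a \<in> insert y S" "b \<in> insert y S" "a \<noteq> b"
        have *: "d \<le> ?H x y" if "x \<in> S" for x using n y that by (auto simp: not_less)
        consider "a = y" "b \<in> S" | "b = y" "a \<in> S" | "a \<in> S" "b \<in> S" using ab by blast
        then show "d \<le> ?H a b"
        proof cases
          case 1 then show ?thesis using *[of b] sy[of a b] by simp
        next
          case 2 then show ?thesis using *[of a] by simp
        next
          case 3 then show ?thesis using okD ab(3) by simp
        qed
      qed
      then have "card (insert y S) \<le> card S" by (rule mx)
      then show False using n fS by auto
    qed
  qed
  have q: "card A \<ge> 1" using assms by (simp add: Suc_leI card_gt_0_iff)
  have "card ?X \<le> card S * (2 ^ n * card A ^ d)"
  proof (cases "d = 0")
    \<comment> \<open>The balls are empty for \<open>d = 0\<close>, but then the set of all words is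
      itself a code.\<close>
    case True
    have "ok ?X" unfolding ok_def using True by auto
    then have "card ?X \<le> card S" by (rule mx)
    also have "\<dots> \<le> card S * (2 ^ n * card A ^ d)" using q by auto
    finally show ?thesis .
  next
    case False
    have "S \<subseteq> (\<Union>x\<in>S. {y \<in> ?X. ?H x y < d})"
    proof
      fix x assume "x \<in> S"
      moreover from this have "x \<in> {y \<in> ?X. ?H x y < d}" using S False unfolding ok_def by auto
      ultimately show "x \<in> (\<Union>x\<in>S. {y \<in> ?X. ?H x y < d})" by (intro UN_I[of x])
    qed
    then have cover': "?X \<subseteq> (\<Union>x\<in>S. {y \<in> ?X. ?H x y < d})" using cover by blast
    have "card ?X \<le> card (\<Union>x\<in>S. {y \<in> ?X. ?H x y < d})"
      using fS fX cover' by (intro card_mono) auto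
    also have "\<dots> \<le> (\<Sum>x\<in>S. card {y \<in> ?X. ?H x y < d})" by (rule card_UN_le[OF fS])
    also have "\<dots> \<le> (\<Sum>x\<in>S. 2 ^ n * card A ^ d)"
      using S unfolding ok_def by (intro sum_mono hamming_ball_card assms) auto
    finally show ?thesis by simp
  qed
  then have cnt: "card A ^ n \<le> card S * (2 ^ n * card A ^ d)" by (simp add: card_PiE)
  obtain C where C: "bij_betw C {0..<card S} S" using ex_bij_betw_nat_finite[OF fS] by blast
  show ?thesis
  proof (rule that[of "card S" C])
    show "C w \<in> ?X" if "w < card S" for w
    proof -
      have "C w \<in> S" using bij_betwE[OF C] that by auto
      then show ?thesis using S unfolding ok_def by blast
    qed
    show "d \<le> card {t. t < n \<and> C w t \<noteq> C w' t}" if "w < card S" "w' < card S" "w \<noteq> w'" for w w'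
    proof -
      have "C w \<in> S" "C w' \<in> S" "C w \<noteq> C w'"
        using bij_betwE[OF C] inj_onD[OF bij_betw_imp_inj_on[OF C], of w w'] that by auto
      then show ?thesis using okD[of "C w'" "C w"] by simp
    qed
  qed (rule cnt)
qed

section \<open>Complex Gaussian noise\<close>

text \<open>The factor is the Jacobian of a scaling by the real number \<open>a\<close> in two real
  dimensions.\<close>

lemma nn_integral_complex_affine:
  fixes f :: "complex \<Rightarrow> ennreal"
  assumes [measurable]: "f \<in> borel_measurable borel" and a: "a \<noteq> 0"
  shows "(\<integral>\<^sup>+x. f x \<partial>lborel) = ennreal (a\<^sup>2) * (\<integral>\<^sup>+x. f (t + a *\<^sub>R x) \<partial>lborel)"
  by (subst lborel_affine[OF a, of t])
     (simp add: nn_integral_density nn_integral_distr nn_integral_cmult DIM_complex)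

text \<open>Circularly symmetric Gaussian law with mean \<open>c\<close> and total variance
  \<open>s\<close>, that is s/2 in each real coordinate.\<close>

definition gauss :: "complex \<Rightarrow> real \<Rightarrow> complex measure" where
  "gauss c s = density lborel (\<lambda>y. ennreal (exp (- (cmod (y - c))\<^sup>2 / s) / (pi * s)))"

lemma sets_gauss [measurable_cong, simp]: "sets (gauss c s) = sets borel"
  and space_gauss [simp]: "space (gauss c s) = UNIV"
  by (simp_all add: gauss_def)

lemma complex_noise_eq_gauss: "complex_noise = gauss 0 1"
proof -
  have "normal_density 0 (sqrt (1/2)) (Re z) * normal_density 0 (sqrt (1/2)) (Im z)
      = exp (- (cmod (z - 0))\<^sup>2 / 1) / (pi * 1)" for z
  proof -
    have "exp (- (Re z)\<^sup>2) * exp (- (Im z)\<^sup>2) = exp (- (cmod z)\<^sup>2)"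
      by (simp add: cmod_power2 flip: exp_add)
    then show ?thesis by (simp add: normal_density_def)
  qed
  then show ?thesis unfolding complex_noise_def gauss_def by presburger
qed

lemma prob_space_gauss_0_1: "prob_space (gauss 0 1)"
proof
  let ?d = "normal_density 0 (sqrt (1/2))"
  interpret prob_space "density lborel ?d" by (rule prob_space_normal_density) simp
  have one: "(\<integral>\<^sup>+x. ?d x \<partial>lborel) = 1"
    using emeasure_space_1 by (simp add: emeasure_density)
  have "emeasure complex_noise (space complex_noise) =
    (\<integral>\<^sup>+z. (\<Prod>b\<in>Basis. ennreal (?d (z \<bullet> b))) \<partial>(lborel :: complex measure))"
    unfolding complex_noise_def
    by (simp add: emeasure_density Basis_complex_def ennreal_mult inner_complex_def)
  also have "\<dots> = (\<Prod>b\<in>(Basis :: complex set). (\<integral>\<^sup>+x. ?d x \<partial>lborel))"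
    by (rule nn_integral_lborel_prod) auto
  finally show "emeasure (gauss 0 1) (space (gauss 0 1)) = 1"
    by (simp add: one complex_noise_eq_gauss)
qed

lemma nn_integral_gauss_density:
  assumes s: "s > 0"
  shows "(\<integral>\<^sup>+y. ennreal (exp (- (cmod (y - c))\<^sup>2 / s) / (pi * s)) \<partial>lborel) = 1"
proof -
  interpret prob_space "gauss 0 1" by (rule prob_space_gauss_0_1)
  have one: "(\<integral>\<^sup>+x. ennreal (exp (- (cmod x)\<^sup>2) / pi) \<partial>lborel) = 1"
    using emeasure_space_1 by (simp add: emeasure_density gauss_def)
  have "(\<integral>\<^sup>+y. ennreal (exp (- (cmod (y - c))\<^sup>2 / s) / (pi * s)) \<partial>lborel)
      = ennreal ((sqrt s)\<^sup>2) * (\<integral>\<^sup>+y. ennreal (exp (- (cmod (c + sqrt s *\<^sub>R y - c))\<^sup>2 / s) / (pi * s)) \<partial>lborel)"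
    using s by (intro nn_integral_complex_affine) auto
  also have "\<dots> = (\<integral>\<^sup>+y. ennreal s * ennreal (exp (- (cmod (c + sqrt s *\<^sub>R y - c))\<^sup>2 / s) / (pi * s)) \<partial>lborel)"
    using s by (subst nn_integral_cmult) auto
  also have "\<dots> = (\<integral>\<^sup>+x. ennreal (exp (- (cmod x)\<^sup>2) / pi) \<partial>lborel)"
    using s by (intro nn_integral_cong) (simp add: ennreal_mult[symmetric] power_mult_distrib)
  finally show ?thesis using one by simp
qed

lemma prob_space_gauss: "s > 0 \<Longrightarrow> prob_space (gauss c s)"
  using nn_integral_gauss_density[of s c] by (intro prob_spaceI) (simp add: gauss_def emeasure_density)

lemma prob_space_complex_noise: "prob_space complex_noise"
  by (simp add: complex_noise_eq_gauss prob_space_gauss)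

lemma sets_complex_noise [measurable_cong, simp]: "sets complex_noise = sets borel"
  and space_complex_noise [simp]: "space complex_noise = UNIV"
  by (simp_all add: complex_noise_eq_gauss)

lemma distr_complex_noise_affine:
  assumes a: "a > 0"
  shows "distr complex_noise borel (\<lambda>z. c + a *\<^sub>R z) = gauss c (a\<^sup>2)"
proof (rule measure_eqI)
  fix A assume "A \<in> sets (distr complex_noise borel (\<lambda>z. c + a *\<^sub>R z))"
  then have [measurable]: "A \<in> sets borel" by simp
  have "emeasure (gauss c (a\<^sup>2)) A = (\<integral>\<^sup>+y. ennreal (exp (- (cmod (y - c))\<^sup>2 / a\<^sup>2) / (pi * a\<^sup>2)) * indicator A y \<partial>lborel)"
    by (simp add: gauss_def emeasure_density)
  also have "\<dots> = ennreal (a\<^sup>2) * (\<integral>\<^sup>+y. ennreal (exp (- (cmod (c + a *\<^sub>R y - c))\<^sup>2 / a\<^sup>2) / (pi * a\<^sup>2)) * indicator A (c + a *\<^sub>R y) \<partial>lborel)"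
    using a by (intro nn_integral_complex_affine) auto
  also have "\<dots> = (\<integral>\<^sup>+y. ennreal (a\<^sup>2) * (ennreal (exp (- (cmod (c + a *\<^sub>R y - c))\<^sup>2 / a\<^sup>2) / (pi * a\<^sup>2)) * indicator A (c + a *\<^sub>R y)) \<partial>lborel)"
    by (subst nn_integral_cmult) auto
  also have "\<dots> = (\<integral>\<^sup>+y. ennreal (exp (- (cmod y)\<^sup>2) / pi) * indicator A (c + a *\<^sub>R y) \<partial>lborel)"
    using a by (intro nn_integral_cong) (simp add: mult.assoc[symmetric] ennreal_mult[symmetric] power_mult_distrib)
  also have "\<dots> = (\<integral>\<^sup>+y. indicator A (c + a *\<^sub>R y) \<partial>complex_noise)"
    unfolding complex_noise_eq_gauss gauss_def by (subst nn_integral_density) auto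
  also have "\<dots> = (\<integral>\<^sup>+y. indicator A y \<partial>distr complex_noise borel (\<lambda>z. c + a *\<^sub>R z))"
    by (subst nn_integral_distr) auto
  also have "\<dots> = emeasure (distr complex_noise borel (\<lambda>z. c + a *\<^sub>R z)) A"
    by (rule nn_integral_indicator) simp
  finally show "emeasure (distr complex_noise borel (\<lambda>z. c + a *\<^sub>R z)) A = emeasure (gauss c (a\<^sup>2)) A" ..
qed simp

text \<open>In the converse an observation with little noise is degraded to unit noise by adding an
  independent sample; this is the law of the result. Given x, the sum has law
  \<open>gauss (a * x) (b\<^sup>2)\<close>; after Fubini the density is a Gaussian in x of mass 1
  times the density of the noise.\<close>

lemma complex_noise_combine:
  assumes ab: "(cmod a)\<^sup>2 + b\<^sup>2 = 1" and b: "b > 0"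
  shows "distr (complex_noise \<Otimes>\<^sub>M complex_noise) borel (\<lambda>(x, y). a * x + b *\<^sub>R y) = complex_noise"
proof (rule measure_eqI)
  interpret N: prob_space complex_noise by (rule prob_space_complex_noise)
  interpret NN: pair_prob_space complex_noise complex_noise ..
  fix A assume "A \<in> sets (distr (complex_noise \<Otimes>\<^sub>M complex_noise) borel (\<lambda>(x, y). a * x + b *\<^sub>R y))"
  then have [measurable]: "A \<in> sets borel" by simp
  \<comment> \<open>Completing the square; this is why no rotation invariance of Lebesgue measure is needed.\<close>
  have square: "(cmod (y - a * x))\<^sup>2 / b\<^sup>2 + (cmod x)\<^sup>2 = (cmod (x - cnj a * y))\<^sup>2 / b\<^sup>2 + (cmod y)\<^sup>2" for x y
  proof -
    have "(cmod (y - a * x))\<^sup>2 + b\<^sup>2 * (cmod x)\<^sup>2 = (cmod (x - cnj a * y))\<^sup>2 + b\<^sup>2 * (cmod y)\<^sup>2"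
      using ab unfolding cmod_power2 by (simp add: algebra_simps power2_eq_square) algebra
    then show ?thesis using b by (simp add: field_simps)
  qed
  let ?D = "distr (complex_noise \<Otimes>\<^sub>M complex_noise) borel (\<lambda>(x, y). a * x + b *\<^sub>R y)"
  have "emeasure ?D A = (\<integral>\<^sup>+y. indicator A y \<partial>?D)"
    by (rule nn_integral_indicator[symmetric]) simp
  also have "\<dots> = (\<integral>\<^sup>+p. indicator A (a * fst p + b *\<^sub>R snd p) \<partial>(complex_noise \<Otimes>\<^sub>M complex_noise))"
    by (subst nn_integral_distr) (auto simp: split_beta')
  also have "\<dots> = (\<integral>\<^sup>+x. (\<integral>\<^sup>+y. indicator A (a * x + b *\<^sub>R y) \<partial>complex_noise) \<partial>complex_noise)"
    by (subst N.nn_integral_fst[symmetric]) auto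
  also have "\<dots> = (\<integral>\<^sup>+x. emeasure (distr complex_noise borel (\<lambda>y. a * x + b *\<^sub>R y)) A \<partial>complex_noise)"
    by (intro nn_integral_cong, subst nn_integral_indicator[symmetric], simp, subst nn_integral_distr) auto
  also have "\<dots> = (\<integral>\<^sup>+x. emeasure (gauss (a * x) (b\<^sup>2)) A \<partial>complex_noise)"
    by (simp add: distr_complex_noise_affine b)
  also have "\<dots> = (\<integral>\<^sup>+x. (\<integral>\<^sup>+y. ennreal (exp (- (cmod x)\<^sup>2) / pi) * (ennreal (exp (- (cmod (y - a * x))\<^sup>2 / b\<^sup>2) / (pi * b\<^sup>2)) * indicator A y) \<partial>lborel) \<partial>lborel)"
    unfolding complex_noise_eq_gauss gauss_def
    by (subst nn_integral_density) (simp_all add: emeasure_density nn_integral_cmult)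
  also have "\<dots> = (\<integral>\<^sup>+y. (\<integral>\<^sup>+x. ennreal (exp (- (cmod x)\<^sup>2) / pi) * (ennreal (exp (- (cmod (y - a * x))\<^sup>2 / b\<^sup>2) / (pi * b\<^sup>2)) * indicator A y) \<partial>lborel) \<partial>lborel)"
    by (rule lborel_pair.Fubini') measurable
  also have "\<dots> = (\<integral>\<^sup>+y. (\<integral>\<^sup>+x. ennreal (exp (- (cmod y)\<^sup>2) / pi) * indicator A y * ennreal (exp (- (cmod (x - cnj a * y))\<^sup>2 / b\<^sup>2) / (pi * b\<^sup>2)) \<partial>lborel) \<partial>lborel)"
  proof (intro nn_integral_cong)
    fix x y
    have "exp (- (cmod x)\<^sup>2) * exp (- (cmod (y - a * x))\<^sup>2 / b\<^sup>2) = exp (- (cmod y)\<^sup>2) * exp (- (cmod (x - cnj a * y))\<^sup>2 / b\<^sup>2)"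
      unfolding exp_add[symmetric] using square[of y x] by (auto simp: algebra_simps)
    then have "ennreal (exp (- (cmod x)\<^sup>2) / pi) * ennreal (exp (- (cmod (y - a * x))\<^sup>2 / b\<^sup>2) / (pi * b\<^sup>2))
       = ennreal (exp (- (cmod y)\<^sup>2) / pi) * ennreal (exp (- (cmod (x - cnj a * y))\<^sup>2 / b\<^sup>2) / (pi * b\<^sup>2))"
      by (simp add: ennreal_mult[symmetric])
    from arg_cong[OF this, of "\<lambda>u. u * indicator A y"]
    show "ennreal (exp (- (cmod x)\<^sup>2) / pi) * (ennreal (exp (- (cmod (y - a * x))\<^sup>2 / b\<^sup>2) / (pi * b\<^sup>2)) * indicator A y)
       = ennreal (exp (- (cmod y)\<^sup>2) / pi) * indicator A y * ennreal (exp (- (cmod (x - cnj a * y))\<^sup>2 / b\<^sup>2) / (pi * b\<^sup>2))"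
      by (simp only: ac_simps)
  qed
  also have "\<dots> = (\<integral>\<^sup>+y. ennreal (exp (- (cmod y)\<^sup>2) / pi) * indicator A y * 1 \<partial>lborel)"
  proof (intro nn_integral_cong)
    fix y
    show "(\<integral>\<^sup>+x. ennreal (exp (- (cmod y)\<^sup>2) / pi) * indicator A y * ennreal (exp (- (cmod (x - cnj a * y))\<^sup>2 / b\<^sup>2) / (pi * b\<^sup>2)) \<partial>lborel)
      = ennreal (exp (- (cmod y)\<^sup>2) / pi) * indicator A y * 1"
      by (subst nn_integral_cmult, measurable, subst nn_integral_gauss_density) (use b in auto)
  qed
  also have "\<dots> = emeasure complex_noise A"
    by (simp add: complex_noise_eq_gauss gauss_def emeasure_density)
  finally show "emeasure (distr (complex_noise \<Otimes>\<^sub>M complex_noise) borel (\<lambda>(x, y). a * x + b *\<^sub>R y)) A = emeasure complex_noise A" .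
qed simp

text \<open>The moment is 1. A comparison with the density of variance 2, through x \<le> 2 * exp (x
  / 2), is off by a factor 4, which affects only additive constants in the rates.\<close>

lemma complex_noise_second_moment: "(\<integral>\<^sup>+z. ennreal ((cmod z)\<^sup>2) \<partial>complex_noise) \<le> 4"
proof -
  have "(\<integral>\<^sup>+z. ennreal ((cmod z)\<^sup>2) \<partial>complex_noise) = (\<integral>\<^sup>+z. ennreal (exp (- (cmod z)\<^sup>2) / pi) * ennreal ((cmod z)\<^sup>2) \<partial>lborel)"
    unfolding complex_noise_eq_gauss gauss_def by (subst nn_integral_density) auto
  also have "\<dots> \<le> (\<integral>\<^sup>+z. 4 * ennreal (exp (- (cmod (z - 0))\<^sup>2 / 2) / (pi * 2)) \<partial>lborel)"
  proof (intro nn_integral_mono)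
    fix z :: complex
    let ?x = "(cmod z)\<^sup>2"
    have "?x \<le> 2 * exp (?x / 2)" using exp_ge_add_one_self[of "?x / 2"] by linarith
    then have "exp (- ?x) / pi * ?x \<le> exp (- ?x) / pi * (2 * exp (?x / 2))" by (intro mult_left_mono) auto
    also have "\<dots> = 4 * (exp (- ?x / 2) / (pi * 2))" by (simp add: field_simps flip: exp_add)
    finally have "ennreal (exp (- ?x) / pi * ?x) \<le> ennreal (4 * (exp (- ?x / 2) / (pi * 2)))" by (rule ennreal_leI)
    also have "\<dots> = 4 * ennreal (exp (- ?x / 2) / (pi * 2))" by (subst ennreal_mult) auto
    finally show "ennreal (exp (- ?x) / pi) * ennreal ?x \<le> 4 * ennreal (exp (- (cmod (z - 0))\<^sup>2 / 2) / (pi * 2))"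
      by (subst ennreal_mult[symmetric]) auto
  qed
  also have "\<dots> = 4" by (subst nn_integral_cmult) (simp_all only: nn_integral_gauss_density, auto)
  finally show ?thesis .
qed

lemma complex_noise_tail:
  assumes D: "D > 0"
  shows "emeasure complex_noise {z. D \<le> cmod z} \<le> ennreal (4 / D\<^sup>2)"
proof -
  have "emeasure complex_noise {z. D \<le> cmod z} = (\<integral>\<^sup>+z. indicator {z. D \<le> cmod z} z \<partial>complex_noise)"
    by (subst nn_integral_indicator) auto
  also have "\<dots> \<le> (\<integral>\<^sup>+z. ennreal (1 / D\<^sup>2) * ennreal ((cmod z)\<^sup>2) \<partial>complex_noise)"
  proof (intro nn_integral_mono)
    fix z
    show "indicator {z. D \<le> cmod z} z \<le> ennreal (1 / D\<^sup>2) * ennreal ((cmod z)\<^sup>2)"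
    proof (cases "D \<le> cmod z")
      case True
      then have "1 \<le> 1 / D\<^sup>2 * (cmod z)\<^sup>2" using D by (simp add: field_simps)
      then have "ennreal 1 \<le> ennreal (1 / D\<^sup>2) * ennreal ((cmod z)\<^sup>2)"
        by (subst ennreal_mult[symmetric]) (auto intro!: ennreal_leI simp del: ennreal_1)
      then show ?thesis using True by simp
    qed simp
  qed
  also have "\<dots> = ennreal (1 / D\<^sup>2) * (\<integral>\<^sup>+z. ennreal ((cmod z)\<^sup>2) \<partial>complex_noise)"
    by (subst nn_integral_cmult) auto
  also have "\<dots> \<le> ennreal (1 / D\<^sup>2) * ennreal 4"
    using complex_noise_second_moment by (intro mult_left_mono) auto
  also have "\<dots> = ennreal (4 / D\<^sup>2)" by (simp add: ennreal_mult[symmetric] del: ennreal_numeral)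
  finally show ?thesis .
qed

lemma prob_space_block_noise: "prob_space (block_noise n)"
  unfolding block_noise_def by (intro prob_space_PiM prob_space_complex_noise)

lemma sets_block_noise [measurable_cong, simp]: "sets (block_noise n) = sets (\<Pi>\<^sub>M t\<in>{..<n}. borel)"
  unfolding block_noise_def by (intro sets_PiM_cong) auto

lemma sets_block_noise_many_large:
  "{z \<in> space (block_noise n). k \<le> card {t. t < n \<and> D \<le> cmod (z t)}} \<in> sets (block_noise n)"
proof -
  have "{z \<in> space (block_noise n). k \<le> card {t\<in>{..<n}. D \<le> cmod (z t)}} \<in> sets (block_noise n)"
    by measurable
  then show ?thesis by (simp only: lessThan_iff)
qed

text \<open>Compare the union bound over the at most 2^n sets of positions, each sample being large
  with probability at most 4 / D^2. The condition 4 \<le> D^2 makes the weights at least 1, so that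
  more than \<open>k\<close> large samples do no harm.\<close>

lemma block_noise_many_large:
  assumes D: "D > 0" "D\<^sup>2 \<ge> 4" 
  shows "measure (block_noise n) {z \<in> space (block_noise n). k \<le> card {t. t < n \<and> D \<le> cmod (z t)}}
     \<le> 2 ^ n * (4 / D\<^sup>2) ^ k"
proof -
  let ?N = "block_noise n" and ?p = "4 / D\<^sup>2"
  interpret N: prob_space complex_noise by (rule prob_space_complex_noise)
  interpret product_sigma_finite "\<lambda>_. complex_noise" ..
  interpret B: prob_space "block_noise n" by (rule prob_space_block_noise)
  have p: "0 < ?p" "?p \<le> 1" using D by (auto simp: field_simps)
  \<comment> \<open>Markov's inequality for a product of weights, each of expectation at most 2.\<close>
  define f where "f z = (if D \<le> cmod z then ennreal (1 / ?p) else 1)" for z :: complex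
  have [measurable]: "f \<in> borel_measurable borel" unfolding f_def by measurable
  have "(\<integral>\<^sup>+z. f z \<partial>complex_noise) \<le> (\<integral>\<^sup>+z. ennreal (1 / ?p) * indicator {z. D \<le> cmod z} z + 1 \<partial>complex_noise)"
    by (intro nn_integral_mono) (auto simp: f_def indicator_def)
  also have "\<dots> = ennreal (1 / ?p) * emeasure complex_noise {z. D \<le> cmod z} + 1"
    by (subst nn_integral_add) (simp_all add: nn_integral_cmult N.emeasure_space_1[simplified])
  also have "\<dots> \<le> ennreal (1 / ?p) * ennreal ?p + 1"
    using complex_noise_tail[OF D(1)] by (intro add_mono mult_left_mono) auto
  also have "\<dots> = 2" using p by (subst ennreal_mult[symmetric]) auto
  finally have f2: "(\<integral>\<^sup>+z. f z \<partial>complex_noise) \<le> 2" .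
  let ?S = "{z \<in> space ?N. k \<le> card {t. t < n \<and> D \<le> cmod (z t)}}"
  have S: "?S \<in> sets ?N" by (rule sets_block_noise_many_large)
  have "emeasure ?N ?S * ennreal ((1 / ?p) ^ k) = (\<integral>\<^sup>+z. indicator ?S z * ennreal ((1 / ?p) ^ k) \<partial>?N)"
    using S by (subst nn_integral_multc) (simp_all only: nn_integral_indicator borel_measurable_indicator)
  also have "\<dots> \<le> (\<integral>\<^sup>+z. (\<Prod>t<n. f (z t)) \<partial>?N)"
  proof (intro nn_integral_mono)
    fix z
    show "indicator ?S z * ennreal ((1 / ?p) ^ k) \<le> (\<Prod>t<n. f (z t))"
    proof (cases "z \<in> ?S")
      case True
      let ?c = "card {t. t < n \<and> D \<le> cmod (z t)}"
      have "(\<Prod>t<n. f (z t)) = (\<Prod>t<n. ennreal (if D \<le> cmod (z t) then 1 / ?p else 1))"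
        unfolding f_def by (intro prod.cong) auto
      also have "\<dots> = ennreal (\<Prod>t<n. (if D \<le> cmod (z t) then 1 / ?p else 1))"
        using p by (intro prod_ennreal) auto
      also have "(\<Prod>t<n. (if D \<le> cmod (z t) then 1 / ?p else 1)) = (1 / ?p) ^ ?c"
        by (subst prod.If_cases) (auto simp: Int_def)
      finally have "(\<Prod>t<n. f (z t)) = ennreal ((1 / ?p) ^ ?c)" .
      moreover have "(1 / ?p) ^ k \<le> (1 / ?p) ^ ?c" using True p by (intro power_increasing) auto
      ultimately show ?thesis using True by (simp add: ennreal_leI)
    qed auto
  qed
  also have "\<dots> = (\<Prod>t<n. (\<integral>\<^sup>+z. f z \<partial>complex_noise))"
    unfolding block_noise_def by (rule product_nn_integral_prod) auto
  also have "\<dots> \<le> (\<Prod>t<n. 2)" using f2 by (intro prod_mono_ennreal) auto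
  finally have le: "emeasure ?N ?S * ennreal ((1 / ?p) ^ k) \<le> ennreal (2 ^ n)"
    by (simp add: ennreal_power[symmetric])
  have "ennreal (measure ?N ?S * (1 / ?p) ^ k) \<le> ennreal (2 ^ n)"
    using le p by (simp only: B.emeasure_eq_measure ennreal_mult' zero_le_power) (simp add: ennreal_mult)
  then have "measure ?N ?S * (1 / ?p) ^ k \<le> 2 ^ n" by (subst (asm) ennreal_le_iff) auto
  then show ?thesis using p by (simp add: field_simps)
qed

section \<open>From separated constellations to achievable rates\<close>

text \<open>
  Noise of modulus below \<open>D\<close> never confuses two symbols, so that symbol errors occur only where the noise is large.
  A Gilbert-Varshamov code over the alphabet \<open>A\<close> corrects them; it costs one bit per channel use and the
  fraction \<open>3 \<delta>\<close> of the rate.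
\<close>

lemma achievable_of_modulation:
  fixes x :: "'a \<Rightarrow> complex"
  assumes A: "finite A" "A \<noteq> {}"
    and \<delta>: "\<delta> > 0" and D: "D > 0" "4 \<le> D\<^sup>2" "2 * (4 / D\<^sup>2) powr \<delta> \<le> 1 / 2"
    and power: "\<And>a. a \<in> A \<Longrightarrow> (cmod (x a))\<^sup>2 \<le> P"
    and sep: "\<And>j k a b. \<lbrakk>j < K; k < J j; \<And>i. i < K \<Longrightarrow> a i \<in> A; \<And>i. i < K \<Longrightarrow> b i \<in> A; a j \<noteq> b j\<rbrakk>
       \<Longrightarrow> 2 * D \<le> cmod ((\<Sum>i<K. h (j, k, i) * x (a i)) - (\<Sum>i<K. h (j, k, i) * x (b i)))"
    and R: "0 \<le> R" "R \<le> (1 - 3 * \<delta>) * log 2 (card A) - 1"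
  shows "achievable K J h P (\<lambda>_. R)"
proof -
  let ?q = "real (card A)"
  have q1: "?q \<ge> 1" using A by (simp add: Suc_leI card_gt_0_iff)
  have P0: "0 \<le> P" using A power by (meson ex_in_conv order_trans zero_le_power2)
  have "\<forall>\<^sub>F n in sequentially. \<exists>c. valid_code K J P n (\<lambda>_. R) c \<and> (\<forall>j<K. \<forall>k<J j. error_prob K h n c j k \<le> \<epsilon>)"
    if eps: "\<epsilon> > 0" for \<epsilon> :: real
  proof -
    have "(\<lambda>n. (1/2::real) ^ n) \<longlonglongrightarrow> 0" by (rule LIMSEQ_realpow_zero) auto
    then have "\<forall>\<^sub>F n in sequentially. (1/2::real) ^ n < \<epsilon>" using eps by (simp add: order_tendsto_iff)
    moreover have "\<forall>\<^sub>F n in sequentially. 2 / \<delta> \<le> real n"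
      using filterlim_real_sequentially by (simp add: filterlim_at_top)
    ultimately show ?thesis
    proof eventually_elim
      case (elim n)
      \<comment> \<open>The outer code has distance 2 * k, so fewer than \<open>k\<close> symbol
        errors, about a fraction \<delta> of the block, are corrected.\<close>
      define k where "k = nat \<lceil>\<delta> * n\<rceil>"
      have k: "\<delta> * n \<le> k" "k \<le> \<delta> * n + 1" using \<delta> unfolding k_def by (auto simp: of_nat_nat)
      \<comment> \<open>A long block absorbs the rounding in \<open>k\<close>: 2 * k \<le> 2 *
        \<delta> * n + 2 \<le> 3 * \<delta> * n. This is where 3 * \<delta> in the rate comes
        from.\<close>
      have n2: "2 \<le> \<delta> * n" using elim(2) \<delta> by (simp add: field_simps)
      obtain M C where C: "\<And>w. w < M \<Longrightarrow> C w \<in> {..<n} \<rightarrow>\<^sub>E A"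
        and dist: "\<And>w w'. w < M \<Longrightarrow> w' < M \<Longrightarrow> w \<noteq> w' \<Longrightarrow> 2 * k \<le> card {t. t < n \<and> C w t \<noteq> C w' t}"
        and cnt: "card A ^ n \<le> M * (2 ^ n * card A ^ (2 * k))"
        by (rule gilbert_varshamov[OF A, of n "2 * k"]) (rule that)
      have CA: "C w t \<in> A" if "w < M" "t < n" for w t using C[OF that(1)] that(2) by auto
      have M0: "M > 0" using cnt q1 by (cases M) auto
      \<comment> \<open>Outputs closer than \<open>D\<close> to some received point with desired
        symbol \<open>a\<close>, whatever the interfering symbols are. By \<open>sep\<close> these
        sets are disjoint for different \<open>a\<close>, so the desired symbol is decided without
        resolving the interference.\<close>
      define U where "U j s a = (\<Union>b\<in>{b \<in> {..<K} \<rightarrow>\<^sub>E A. b j = a}. ball (\<Sum>i<K. h (j, s, i) * x (b i)) D)" for j s a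
      define bad where "bad j s w y = card {t \<in> {..<n}. y t \<notin> U j s (C w t)}" for j s w and y :: "nat \<Rightarrow> complex"
      \<comment> \<open>All users share one codebook. \<open>LEAST\<close> merely makes the decision
        a function: with fewer than \<open>k\<close> large noise samples exactly one message
        qualifies.\<close>
      define c where "c = \<lparr>msgs = (\<lambda>_. M), enc = (\<lambda>i w t. x (C w t)), dec = (\<lambda>j s y. LEAST w. w < M \<and> bad j s w y < k)\<rparr>"
      have Uborel [measurable]: "U j s a \<in> sets borel" for j s a
        unfolding U_def by (intro borel_open open_UN) auto
      have dec_meas: "dec c j s \<in> measurable (\<Pi>\<^sub>M t\<in>{..<n}. borel) (count_space UNIV)" for j s
        unfolding c_def bad_def by simp measurable
      have rate: "2 powr (n * R) \<le> M"
      proof -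
        have "n * R \<le> n * ((1 - 3 * \<delta>) * log 2 ?q - 1)" using R by (intro mult_left_mono) auto
        also have "\<dots> = n * log 2 ?q - n - 3 * (\<delta> * n) * log 2 ?q" by (simp add: algebra_simps)
        also have "\<dots> \<le> n * log 2 ?q - n - 2 * k * log 2 ?q"
          using k n2 q1 by (intro diff_left_mono mult_right_mono) auto
        finally have "n * R + n + 2 * k * log 2 ?q \<le> n * log 2 ?q" by simp
        then have "2 powr (n * R + n + 2 * k * log 2 ?q) \<le> 2 powr (n * log 2 ?q)" by simp
        also have "2 powr (n * log 2 ?q) = ?q ^ n"
        proof -
          have "2 powr (n * log 2 ?q) = (2 powr (log 2 ?q)) powr n" by (simp add: powr_powr mult.commute)
          also have "\<dots> = ?q ^ n" using q1 by (simp add: powr_realpow)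
          finally show ?thesis .
        qed
        also have "2 powr (n * R + n + 2 * k * log 2 ?q) = 2 powr (n * R) * (2 ^ n * ?q ^ (2 * k))"
        proof -
          have "2 powr (2 * k * log 2 ?q) = (2 powr (log 2 ?q)) powr (real (2 * k))"
            by (simp add: powr_powr mult.commute)
          also have "\<dots> = ?q ^ (2 * k)" using q1 by (subst powr_realpow) auto
          finally show ?thesis by (simp add: powr_add powr_realpow)
        qed
        also have "?q ^ n \<le> M * (2 ^ n * ?q ^ (2 * k))"
          using cnt by (metis (mono_tags) of_nat_le_iff of_nat_mult of_nat_power of_nat_numeral)
        finally show ?thesis using q1 by (subst (asm) mult_le_cancel_right) auto
      qed
      have avg: "avg_power n c i \<le> P" for i
      proof -
        have "(\<Sum>t<n. (cmod (x (C w t)))\<^sup>2) / n \<le> P" if "w < M" for w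
        proof -
          have "(\<Sum>t<n. (cmod (x (C w t)))\<^sup>2) \<le> (\<Sum>t<n. P)" using CA that power by (intro sum_mono) auto
          then show ?thesis using P0 by (cases "n = 0") (auto simp: field_simps)
        qed
        then have "(\<Sum>w<M. (\<Sum>t<n. (cmod (x (C w t)))\<^sup>2) / n) \<le> (\<Sum>w<M. P)" by (intro sum_mono) auto
        then show ?thesis using M0 by (simp add: avg_power_def c_def field_simps)
      qed
      have correct: "dec c j s (received K h n c j s w z) = w j"
        if js: "j < K" "s < J j" and w: "w \<in> message_tuples K c"
          and z: "card {t. t < n \<and> D \<le> cmod (z t)} < k" for j s w z
      proof -
        let ?y = "received K h n c j s w z"
        have wM: "w i < M" if "i < K" for i using w that by (auto simp: message_tuples_def c_def)
        have inU: "?y t \<in> U j s (C (w j) t)" if t: "t < n" "cmod (z t) < D" for t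
        proof -
          let ?b = "\<lambda>i\<in>{..<K}. C (w i) t"
          have "?b \<in> {b \<in> {..<K} \<rightarrow>\<^sub>E A. b j = C (w j) t}" using js t wM CA by auto
          moreover have "?y t = (\<Sum>i<K. h (j, s, i) * x (?b i)) + z t" using t by (simp add: received_def c_def)
          then have "?y t \<in> ball (\<Sum>i<K. h (j, s, i) * x (?b i)) D" using t by (simp add: dist_norm)
          ultimately show ?thesis unfolding U_def by (intro UN_I[where a = ?b])
        qed
        have "bad j s (w j) ?y \<le> card {t. t < n \<and> D \<le> cmod (z t)}"
          unfolding bad_def
        proof (rule card_mono)
          show "{t \<in> {..<n}. ?y t \<notin> U j s (C (w j) t)} \<subseteq> {t. t < n \<and> D \<le> cmod (z t)}"
            using inU by (auto intro!: leI)
        qed simp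
        then have good: "bad j s (w j) ?y < k" using z by simp
        show ?thesis unfolding c_def code.simps
        proof (intro Least_equality)
          show "w j < M \<and> bad j s (w j) (received K h n \<lparr>msgs = (\<lambda>_. M), enc = (\<lambda>i w t. x (C w t)), dec = (\<lambda>j s y. LEAST w. w < M \<and> bad j s w y < k)\<rparr> j s w z) < k"
            using good wM[OF js(1)] by (simp add: c_def)
          fix v assume "v < M \<and> bad j s v (received K h n \<lparr>msgs = (\<lambda>_. M), enc = (\<lambda>i w t. x (C w t)), dec = (\<lambda>j s y. LEAST w. w < M \<and> bad j s w y < k)\<rparr> j s w z) < k"
          then have v: "v < M" "bad j s v ?y < k" by (simp_all add: c_def)
          have "v = w j"
          proof (rule ccontr)
            assume ne: "v \<noteq> w j"
            have "{t. t < n \<and> C v t \<noteq> C (w j) t} \<subseteq> {t \<in> {..<n}. ?y t \<notin> U j s (C v t)} \<union> {t \<in> {..<n}. ?y t \<notin> U j s (C (w j) t)}"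
            proof (intro subsetI, rule ccontr)
              fix t assume t: "t \<in> {t. t < n \<and> C v t \<noteq> C (w j) t}"
                "t \<notin> {t \<in> {..<n}. ?y t \<notin> U j s (C v t)} \<union> {t \<in> {..<n}. ?y t \<notin> U j s (C (w j) t)}"
              then have "?y t \<in> U j s (C v t)" "?y t \<in> U j s (C (w j) t)" by auto
              then obtain a b where a: "a \<in> {..<K} \<rightarrow>\<^sub>E A" "a j = C v t" "?y t \<in> ball (\<Sum>i<K. h (j, s, i) * x (a i)) D"
                and b: "b \<in> {..<K} \<rightarrow>\<^sub>E A" "b j = C (w j) t" "?y t \<in> ball (\<Sum>i<K. h (j, s, i) * x (b i)) D"
                unfolding U_def by blast
              have "dist (\<Sum>i<K. h (j, s, i) * x (a i)) (\<Sum>i<K. h (j, s, i) * x (b i)) < D + D"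
                using a(3) b(3) by (intro dist_triangle_less_add[of _ "?y t"]) (auto simp: dist_commute)
              moreover have "2 * D \<le> cmod ((\<Sum>i<K. h (j, s, i) * x (a i)) - (\<Sum>i<K. h (j, s, i) * x (b i)))"
                using a b t by (intro sep js) auto
              ultimately show False by (simp add: dist_norm)
            qed
            then have "card {t. t < n \<and> C v t \<noteq> C (w j) t} \<le> card ({t \<in> {..<n}. ?y t \<notin> U j s (C v t)} \<union> {t \<in> {..<n}. ?y t \<notin> U j s (C (w j) t)})"
              by (intro card_mono) auto
            also have "\<dots> \<le> bad j s v ?y + bad j s (w j) ?y" unfolding bad_def by (rule card_Un_le)
            also have "\<dots> < 2 * k" using v good by simp
            finally show False using dist[OF v(1) wM[OF js(1)] ne] by simp
          qed
          then show "w j \<le> v" by simp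
        qed
      qed
      have err: "error_prob K h n c j s \<le> \<epsilon>" if js: "j < K" "s < J j" for j s
      proof -
        interpret B: prob_space "block_noise n" by (rule prob_space_block_noise)
        let ?T = "message_tuples K c"
        have T: "finite ?T" "?T \<noteq> {}" using M0
          by (auto simp: message_tuples_def c_def PiE_eq_empty_iff intro!: finite_PiE)
        have "measure (block_noise n) {z \<in> space (block_noise n). dec c j s (received K h n c j s w z) \<noteq> w j} \<le> \<epsilon>"
          if w: "w \<in> ?T" for w
        proof -
          have "measure (block_noise n) {z \<in> space (block_noise n). dec c j s (received K h n c j s w z) \<noteq> w j}
             \<le> measure (block_noise n) {z \<in> space (block_noise n). k \<le> card {t. t < n \<and> D \<le> cmod (z t)}}"
            using correct[OF js w] by (intro B.finite_measure_mono sets_block_noise_many_large) (auto intro!: leI)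
          also have "\<dots> \<le> 2 ^ n * (4 / D\<^sup>2) ^ k" by (rule block_noise_many_large[OF D(1,2)])
          also have "\<dots> = 2 ^ n * (4 / D\<^sup>2) powr k" using D by (subst powr_realpow) auto
          also have "\<dots> \<le> 2 ^ n * (4 / D\<^sup>2) powr (\<delta> * n)"
            using D k by (intro mult_left_mono powr_mono') auto
          \<comment> \<open>The factor 2^n for the positions of the errors is beaten by the choice
            of \<open>D\<close>, which leaves an error of at most 2^-n.\<close>
          also have "\<dots> = (2 * (4 / D\<^sup>2) powr \<delta>) ^ n"
            using D by (simp add: power_mult_distrib powr_powr[symmetric] powr_realpow)
          also have "\<dots> \<le> (1 / 2) ^ n" using D(3) by (intro power_mono) auto
          finally show ?thesis using elim(1) by simp
        qed
        then have "(\<Sum>w\<in>?T. measure (block_noise n) {z \<in> space (block_noise n). dec c j s (received K h n c j s w z) \<noteq> w j}) \<le> (\<Sum>w\<in>?T. \<epsilon>)"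
          by (rule sum_mono)
        then show ?thesis using T unfolding error_prob_def by (simp add: field_simps card_gt_0_iff)
      qed
      have "msgs c i = M" for i by (simp add: c_def)
      then have "valid_code K J P n (\<lambda>_. R) c" using rate avg dec_meas by (simp add: valid_code_def)
      then show ?case using err by blast
    qed
  qed
  then show ?thesis unfolding achievable_def using R by blast
qed

section \<open>Diophantine approximation by monomials\<close>

text \<open>Gaussian integers of bounded size: the differences of two transmitted symbols, and sums
  of such differences.\<close>

definition gbox :: "nat \<Rightarrow> complex set" where
  "gbox Q = (\<lambda>(a, b). Complex (of_int a) (of_int b)) ` ({- int Q..int Q} \<times> {- int Q..int Q})"

lemma finite_gbox [simp, intro]: "finite (gbox Q)"
  by (simp add: gbox_def)

lemma mem_gbox: "z \<in> gbox Q \<longleftrightarrow> Re z \<in> \<int> \<and> Im z \<in> \<int> \<and> \<bar>Re z\<bar> \<le> Q \<and> \<bar>Im z\<bar> \<le> Q"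
proof
  assume "z \<in> gbox Q"
  then show "Re z \<in> \<int> \<and> Im z \<in> \<int> \<and> \<bar>Re z\<bar> \<le> Q \<and> \<bar>Im z\<bar> \<le> Q"
    unfolding gbox_def by (auto simp: abs_le_iff)
next
  assume z: "Re z \<in> \<int> \<and> Im z \<in> \<int> \<and> \<bar>Re z\<bar> \<le> Q \<and> \<bar>Im z\<bar> \<le> Q"
  then obtain a b where ab: "Re z = of_int a" "Im z = of_int b" by (auto elim!: Ints_cases)
  then have "z = Complex (of_int a) (of_int b)" by (simp add: complex_eq_iff)
  moreover have "\<bar>a\<bar> \<le> int Q" "\<bar>b\<bar> \<le> int Q" using z ab by linarith+
  ultimately show "z \<in> gbox Q" unfolding gbox_def by (force simp: abs_le_iff)
qed

lemma card_gbox_le: "card (gbox Q) \<le> (2 * Q + 1) ^ 2"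
proof -
  have "card (gbox Q) \<le> card ({- int Q..int Q} \<times> {- int Q..int Q})"
    unfolding gbox_def by (rule card_image_le) simp
  also have "\<dots> = (2 * Q + 1) ^ 2"
  proof -
    have "nat (int Q - - int Q + 1) = 2 * Q + 1" by arith
    then show ?thesis by (simp only: card_cartesian_product card_atLeastAtMost_int power2_eq_square)
  qed
  finally show ?thesis .
qed

lemma zero_in_gbox [simp, intro]: "0 \<in> gbox Q"
  by (simp add: mem_gbox)

lemma gbox_mono: "z \<in> gbox Q \<Longrightarrow> Q \<le> Q' \<Longrightarrow> z \<in> gbox Q'"
  by (auto simp: mem_gbox)

lemma gbox_add: "z \<in> gbox Q \<Longrightarrow> w \<in> gbox Q' \<Longrightarrow> z + w \<in> gbox (Q + Q')"
  by (auto simp: mem_gbox)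

lemma gbox_sum:
  assumes "finite S" "\<And>x. x \<in> S \<Longrightarrow> f x \<in> gbox Q"
  shows "sum f S \<in> gbox (card S * Q)"
  using assms by (induction S rule: finite_induct) (auto intro: gbox_add)

lemma gbox_norm_ge:
  assumes "z \<in> gbox Q" "z \<noteq> 0"
  shows "1 \<le> cmod z"
proof -
  have "1 \<le> \<bar>Re z\<bar> \<or> 1 \<le> \<bar>Im z\<bar>"
    using assms Ints_nonzero_abs_ge1 by (auto simp: mem_gbox complex_eq_iff)
  then show ?thesis using abs_Re_le_cmod[of z] abs_Im_le_cmod[of z] by linarith
qed

lemma gbox_norm_le:
  assumes "z \<in> gbox Q"
  shows "cmod z \<le> 2 * Q"
  using assms cmod_le[of z] by (auto simp: mem_gbox)

text \<open>
  Any polynomial lower bound on the linear forms suffices: the exponent \<open>\<kappa>\<close> is made negligible later by using many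
  independent copies of the family.
\<close>

definition diophantine :: "'a set \<Rightarrow> ('a \<Rightarrow> complex) \<Rightarrow> bool" where
  "diophantine A f \<longleftrightarrow> (\<exists>\<kappa>::nat. \<forall>Q\<ge>2. \<forall>q\<in>A \<rightarrow>\<^sub>E gbox Q.
     (\<exists>a\<in>A. q a \<noteq> 0) \<longrightarrow> 1 \<le> real Q ^ \<kappa> * cmod (\<Sum>a\<in>A. q a * f a))"

lemma diophantine_reindex:
  assumes g: "bij_betw g B A" and f: "diophantine A f" and eq: "\<And>b. b \<in> B \<Longrightarrow> f' b = f (g b)"
  shows "diophantine B f'"
proof -
  obtain \<kappa> :: nat where \<kappa>: "\<And>Q q. \<lbrakk>Q \<ge> 2; q \<in> A \<rightarrow>\<^sub>E gbox Q; \<exists>a\<in>A. q a \<noteq> 0\<rbrakk> \<Longrightarrow> 1 \<le> real Q ^ \<kappa> * cmod (\<Sum>a\<in>A. q a * f a)"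
    using f unfolding diophantine_def by blast
  show ?thesis unfolding diophantine_def
  proof (intro exI[of _ \<kappa>] allI impI ballI)
    fix Q :: nat and q assume Q: "2 \<le> Q" and q: "q \<in> B \<rightarrow>\<^sub>E gbox Q" and nz: "\<exists>b\<in>B. q b \<noteq> 0"
    define r where "r = (\<lambda>a\<in>A. q (inv_into B g a))"
    have rg: "r (g b) = q b" if "b \<in> B" for b
      using g that by (auto simp: r_def bij_betw_def)
    have "r \<in> A \<rightarrow>\<^sub>E gbox Q"
      using q inv_into_into[of _ g B] g by (auto simp: r_def bij_betw_def)
    moreover have "\<exists>a\<in>A. r a \<noteq> 0" using nz rg bij_betwE[OF g] by metis
    ultimately have "1 \<le> real Q ^ \<kappa> * cmod (\<Sum>a\<in>A. r a * f a)" using \<kappa> Q by blast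
    also have "(\<Sum>a\<in>A. r a * f a) = (\<Sum>b\<in>B. r (g b) * f (g b))"
      by (rule sum.reindex_bij_betw[OF g, symmetric])
    also have "\<dots> = (\<Sum>b\<in>B. q b * f' b)" using rg eq by (intro sum.cong) auto
    finally show "1 \<le> real Q ^ \<kappa> * cmod (\<Sum>b\<in>B. q b * f' b)" .
  qed
qed

text \<open>Over the complex numbers the value is the leading coefficient times the factors s - r,
  each of modulus at least \<rho>. The set \<open>R\<close> forgets multiplicities, whereas the
  exponent counts them.\<close>

lemma poly_lower_bound_away_from_roots:
  fixes p :: "complex poly"
  shows "\<exists>R. finite R \<and> card R \<le> degree p \<and>
    (\<forall>s \<rho>. 0 \<le> \<rho> \<longrightarrow> (\<forall>r\<in>R. \<rho> \<le> dist r s) \<longrightarrow> cmod (lead_coeff p) * \<rho> ^ degree p \<le> cmod (poly p s))"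
proof (induction "degree p" arbitrary: p)
  case 0
  then obtain c where "p = [:c:]" by (metis degree_eq_zeroE)
  then show ?case by (intro exI[of _ "{}"]) auto
next
  case (Suc n)
  then have "\<not> constant (poly p)" by (simp add: constant_degree)
  then obtain z where "poly p z = 0" using fundamental_theorem_of_algebra by blast
  then obtain p' where p: "p = [:-z, 1:] * p'" by (auto simp: poly_eq_0_iff_dvd elim: dvdE)
  have p'0: "p' \<noteq> 0" using Suc.hyps(2) p by auto
  then have deg: "degree p = Suc (degree p')" unfolding p by (subst degree_mult_eq) auto
  then obtain R where R: "finite R" "card R \<le> degree p'"
    "\<And>s \<rho>. \<lbrakk>0 \<le> \<rho>; \<forall>r\<in>R. \<rho> \<le> dist r s\<rbrakk> \<Longrightarrow> cmod (lead_coeff p') * \<rho> ^ degree p' \<le> cmod (poly p' s)"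
    using Suc.hyps(1)[of p'] Suc.hyps(2) by auto
  have lc: "lead_coeff p = lead_coeff p'" unfolding p by (simp only: lead_coeff_mult) simp
  show ?case
  proof (intro exI[of _ "insert z R"] conjI allI impI)
    show "finite (insert z R)" using R by simp
    show "card (insert z R) \<le> degree p" using R deg by (simp add: card_insert_if)
    fix s \<rho> assume \<rho>: "0 \<le> \<rho>" "\<forall>r\<in>insert z R. \<rho> \<le> dist r s"
    have "cmod (lead_coeff p) * \<rho> ^ degree p = \<rho> * (cmod (lead_coeff p') * \<rho> ^ degree p')"
      unfolding lc unfolding deg by simp
    also have "\<dots> \<le> cmod (s - z) * cmod (poly p' s)"
      using \<rho> R(3)[of \<rho> s] by (intro mult_mono) (auto simp: dist_norm norm_minus_commute)
    also have "\<dots> = cmod (poly p s)" unfolding p by (simp only: poly_mult norm_mult) simp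
    finally show "cmod (lead_coeff p) * \<rho> ^ degree p \<le> cmod (poly p s)" .
  qed
qed

text \<open>
  A form in \<open>f a * s ^ k\<close> is a polynomial in \<open>s\<close> whose leading coefficient is a form in \<open>f\<close>, hence not too small.  It is
  therefore small only near one of its roots, and the discs around the roots of all these polynomials are summable.
\<close>

lemma AE_diophantine_powers:
  assumes A: "finite A" and f: "diophantine A f"
  shows "AE s in lborel. diophantine (A \<times> {..d}) (\<lambda>(a, k). f a * s ^ k)"
proof -
  obtain \<kappa> :: nat where \<kappa>: "\<And>Q q. \<lbrakk>Q \<ge> 2; q \<in> A \<rightarrow>\<^sub>E gbox Q; \<exists>a\<in>A. q a \<noteq> 0\<rbrakk> \<Longrightarrow> 1 \<le> real Q ^ \<kappa> * cmod (\<Sum>a\<in>A. q a * f a)"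
    using f unfolding diophantine_def by blast
  let ?B = "A \<times> {..d}"
  define m where "m = card ?B"
  \<comment> \<open>For given Q there are at most (3 Q)^(2 m) coefficient families, each with at
    most \<open>d\<close> discs of area pi * Q^(-2 e). This \<open>e\<close> leaves a total of order
    Q^-2, which is summable.\<close>
  define e where "e = m + 1"
  define b where "b q k = (\<Sum>a\<in>A. q (a, k) * f a)" for q :: "'a \<times> nat \<Rightarrow> complex" and k
  define p where "p q = (\<Sum>k\<le>d. monom (b q k) k)" for q
  have coeff_p: "coeff (p q) k = (if k \<le> d then b q k else 0)" for q k
    by (simp add: p_def coeff_sum)
  have poly_p: "poly (p q) s = (\<Sum>x\<in>?B. q x * (case x of (a, k) \<Rightarrow> f a * s ^ k))" for q s
  proof -
    have "poly (p q) s = (\<Sum>k\<le>d. \<Sum>a\<in>A. q (a, k) * (f a * s ^ k))"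
      by (simp add: p_def b_def poly_sum poly_monom sum_distrib_right mult.assoc)
    also have "\<dots> = (\<Sum>a\<in>A. \<Sum>k\<le>d. q (a, k) * (f a * s ^ k))" by (rule sum.swap)
    also have "\<dots> = (\<Sum>x\<in>?B. q x * (case x of (a, k) \<Rightarrow> f a * s ^ k))"
      by (simp add: sum.cartesian_product split_beta')
    finally show ?thesis .
  qed
  have deg_p: "degree (p q) \<le> d" for q by (rule degree_le) (simp add: coeff_p)
  obtain R where R: "\<And>p :: complex poly. finite (R p)" "\<And>p :: complex poly. card (R p) \<le> degree p"
    "\<And>p s \<rho>. \<lbrakk>0 \<le> \<rho>; \<forall>r\<in>R p. \<rho> \<le> dist r s\<rbrakk> \<Longrightarrow> cmod (lead_coeff p) * \<rho> ^ degree p \<le> cmod (poly p s)"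
    using poly_lower_bound_away_from_roots by metis
  define \<Omega> where "\<Omega> Q = ?B \<rightarrow>\<^sub>E gbox Q" for Q
  define bad where "bad Q = (\<Union>q\<in>\<Omega> Q. \<Union>r\<in>R (p q). ball r ((1 / real Q) ^ e))" for Q
  have fin\<Omega>: "finite (\<Omega> Q)" for Q unfolding \<Omega>_def using A by (intro finite_PiE) auto
  have card\<Omega>: "card (\<Omega> Q) \<le> ((2 * Q + 1) ^ 2) ^ m" for Q
    unfolding \<Omega>_def m_def using A card_gbox_le[of Q] by (subst card_PiE) (auto intro!: power_mono simp del: mult_Suc)
  have good: "1 \<le> real Q ^ (\<kappa> + e * d) * cmod (poly (p q) s)"
    if Q: "Q \<ge> 2" and q: "q \<in> \<Omega> Q" and nz: "\<exists>x\<in>?B. q x \<noteq> 0" and s: "s \<notin> bad Q" for Q q s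
  proof -
    have b: "1 \<le> real Q ^ \<kappa> * cmod (b q k)" if k: "k \<le> d" and nz: "\<exists>a\<in>A. q (a, k) \<noteq> 0" for k
    proof -
      have "(\<lambda>a\<in>A. q (a, k)) \<in> A \<rightarrow>\<^sub>E gbox Q" using q k unfolding \<Omega>_def by (auto simp: PiE_iff)
      moreover have "\<exists>a\<in>A. (\<lambda>a\<in>A. q (a, k)) a \<noteq> 0" using nz by auto
      ultimately have "1 \<le> real Q ^ \<kappa> * cmod (\<Sum>a\<in>A. (\<lambda>a\<in>A. q (a, k)) a * f a)" using \<kappa> Q by blast
      then show ?thesis by (simp add: b_def cong: sum.cong)
    qed
    obtain a0 k0 where "a0 \<in> A" "k0 \<le> d" "q (a0, k0) \<noteq> 0" using nz by auto
    then have "b q k0 \<noteq> 0" using b[of k0] by force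
    then have "p q \<noteq> 0" using coeff_p[of q k0] \<open>k0 \<le> d\<close> by auto
    then have lc: "lead_coeff (p q) \<noteq> 0" by simp
    \<comment> \<open>The leading coefficient is a form in \<open>f\<close> with Gaussian integer
      coefficients that are not all 0, so the hypothesis on \<open>f\<close> bounds it from
      below.\<close>
    then have "b q (degree (p q)) \<noteq> 0" using coeff_p[of q "degree (p q)"] deg_p by simp
    then have "\<exists>a\<in>A. q (a, degree (p q)) \<noteq> 0" unfolding b_def by (rule contrapos_np) simp
    then have 1: "1 \<le> real Q ^ \<kappa> * cmod (lead_coeff (p q))"
      using b[of "degree (p q)"] coeff_p[of q "degree (p q)"] deg_p by simp
    have "\<forall>r\<in>R (p q). (1 / real Q) ^ e \<le> dist r s"
      using s q unfolding bad_def by (auto simp: not_less)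
    then have 2: "cmod (lead_coeff (p q)) * ((1 / real Q) ^ e) ^ degree (p q) \<le> cmod (poly (p q) s)"
      by (intro R) auto
    \<comment> \<open>The degree of \<open>p q\<close> varies with \<open>q\<close>; padding by Q^(e
      * (d - degree (p q))) makes the exponent uniform.\<close>
    have "1 * 1 \<le> (real Q ^ \<kappa> * cmod (lead_coeff (p q))) * (real Q ^ (e * (d - degree (p q))))"
      using 1 Q by (intro mult_mono) auto
    also have "\<dots> = real Q ^ (\<kappa> + e * d) * (cmod (lead_coeff (p q)) * ((1 / real Q) ^ e) ^ degree (p q))"
    proof -
      have "e * d = e * (d - degree (p q)) + e * degree (p q)"
        using deg_p[of q] by (simp flip: distrib_left)
      then show ?thesis using Q by (simp add: power_add power_mult[symmetric] power_divide)
    qed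
    also have "\<dots> \<le> real Q ^ (\<kappa> + e * d) * cmod (poly (p q) s)"
      using 2 by (intro mult_left_mono) auto
    finally show ?thesis by simp
  qed
  have bad_sets: "bad Q \<in> sets lborel" for Q unfolding bad_def by (auto intro!: borel_open)
  define C where "C = real d * pi * 9 ^ m"
  have meas: "emeasure lborel (bad Q) \<le> ennreal (C * (1 / real Q) ^ 2)" if Q: "Q \<ge> 1" for Q
  proof -
    have "emeasure lborel (bad Q) \<le> (\<Sum>q\<in>\<Omega> Q. emeasure lborel (\<Union>r\<in>R (p q). ball r ((1 / real Q) ^ e)))"
      unfolding bad_def by (intro emeasure_subadditive_finite fin\<Omega>) (auto intro!: borel_open)
    also have "\<dots> \<le> (\<Sum>q\<in>\<Omega> Q. ennreal (real d * (pi * ((1 / real Q) ^ e) ^ 2)))"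
    proof (intro sum_mono)
      fix q
      have "emeasure lborel (\<Union>r\<in>R (p q). ball r ((1 / real Q) ^ e)) \<le> (\<Sum>r\<in>R (p q). emeasure lborel (ball r ((1 / real Q) ^ e)))"
        by (intro emeasure_subadditive_finite R(1)) auto
      also have "\<dots> = (\<Sum>r\<in>R (p q). ennreal (pi * ((1 / real Q) ^ e) ^ 2))"
        by (intro sum.cong refl) (simp add: emeasure_ball unit_ball_vol_2 DIM_complex)
      also have "\<dots> = ennreal (real (card (R (p q))) * (pi * ((1 / real Q) ^ e) ^ 2))"
        by (simp add: ennreal_mult' ennreal_of_nat_eq_real_of_nat)
      also have "\<dots> \<le> ennreal (real d * (pi * ((1 / real Q) ^ e) ^ 2))"
        using R(2)[of "p q"] deg_p[of q] by (intro ennreal_leI mult_right_mono) auto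
      finally show "emeasure lborel (\<Union>r\<in>R (p q). ball r ((1 / real Q) ^ e)) \<le> ennreal (real d * (pi * ((1 / real Q) ^ e) ^ 2))" .
    qed
    also have "\<dots> = ennreal (real (card (\<Omega> Q)) * (real d * (pi * ((1 / real Q) ^ e) ^ 2)))"
      by (simp add: ennreal_mult' ennreal_of_nat_eq_real_of_nat)
    also have "\<dots> \<le> ennreal (C * (1 / real Q) ^ 2)"
    proof (rule ennreal_leI)
      have "real (card (\<Omega> Q)) \<le> real (((2 * Q + 1) ^ 2) ^ m)" using card\<Omega> by (simp only: of_nat_le_iff)
      also have "\<dots> \<le> ((3 * real Q) ^ 2) ^ m"
        unfolding of_nat_power using Q by (intro power_mono) auto
      also have "\<dots> = 9 ^ m * real Q ^ (2 * m)" by (simp add: power_mult_distrib power_mult)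
      finally have "real (card (\<Omega> Q)) * (real d * (pi * ((1 / real Q) ^ e) ^ 2)) \<le> 9 ^ m * real Q ^ (2 * m) * (real d * (pi * ((1 / real Q) ^ e) ^ 2))"
        by (intro mult_right_mono) auto
      also have "\<dots> = C * (1 / real Q) ^ 2"
        using Q by (simp add: C_def e_def power_add power_divide power_mult_distrib field_simps power_mult[symmetric])
      finally show "real (card (\<Omega> Q)) * (real d * (pi * ((1 / real Q) ^ e) ^ 2)) \<le> C * (1 / real Q) ^ 2" .
    qed
    finally show ?thesis .
  qed
  have "AE s in lborel. eventually (\<lambda>Q. s \<in> space lborel - bad (Suc Q)) sequentially"
  proof (rule borel_cantelli_AE1)
    have C0: "0 \<le> C" by (simp add: C_def)
    show fin: "emeasure lborel (bad (Suc Q)) < \<infinity>" for Q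
      using le_less_trans[OF meas[of "Suc Q"] ennreal_less_top] by simp
    have le: "norm (measure lborel (bad (Suc Q))) \<le> C * (1 / real (Suc Q)) ^ 2" for Q
    proof -
      have "measure lborel (bad (Suc Q)) \<le> C * (1 / real (Suc Q)) ^ 2"
        using meas[of "Suc Q"] C0 unfolding measure_def by (intro enn2real_leI) auto
      then show ?thesis by (simp only: real_norm_def abs_of_nonneg[OF measure_nonneg])
    qed
    have "summable (\<lambda>Q. C * (1 / real (Suc Q)) ^ 2)"
      using inverse_power_summable[of 2, where 'a = real]
      by (intro summable_mult) (subst summable_Suc_iff, simp add: power_divide inverse_eq_divide)
    then show "summable (\<lambda>Q. measure lborel (bad (Suc Q)))"
      by (rule summable_comparison_test') (rule le)
  qed (rule bad_sets)
  then show ?thesis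
  proof eventually_elim
    case (elim s)
    then obtain N where "\<And>Q. Q \<ge> N \<Longrightarrow> s \<notin> bad (Suc Q)" by (auto simp: eventually_sequentially)
    then have N: "s \<notin> bad Q" if "Q \<ge> Suc N" for Q using that by (cases Q) auto
    let ?Q1 = "Suc (Suc N)" and ?\<kappa> = "\<kappa> + e * d"
    show ?case unfolding diophantine_def
    \<comment> \<open>Below the Borel-Cantelli threshold a form is regarded as one of the larger
      size max Q ?Q1. Since Q \<ge> 2, this size is at most Q ^ ?Q1, whence the factor
      \<open>?Q1\<close> in the exponent.\<close>
    proof (intro exI[of _ "?\<kappa> * ?Q1"] allI impI ballI)
      fix Q :: nat and q assume Q: "2 \<le> Q" and q: "q \<in> ?B \<rightarrow>\<^sub>E gbox Q" and nz: "\<exists>x\<in>?B. q x \<noteq> 0"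
      have "q \<in> \<Omega> (max Q ?Q1)" using q gbox_mono[of _ Q "max Q ?Q1"] unfolding \<Omega>_def by (auto simp: PiE_iff)
      then have "1 \<le> real (max Q ?Q1) ^ ?\<kappa> * cmod (poly (p q) s)"
        using nz N[of "max Q ?Q1"] by (intro good) auto
      also have "\<dots> \<le> real Q ^ (?\<kappa> * ?Q1) * cmod (poly (p q) s)"
      proof (intro mult_right_mono)
        have "max Q ?Q1 \<le> Q ^ ?Q1"
        proof -
          have "?Q1 \<le> 2 ^ ?Q1" by (rule less_imp_le) (rule less_exp)
          also have "2 ^ ?Q1 \<le> Q ^ ?Q1" using Q by (intro power_mono) auto
          finally show ?thesis using Q self_le_power[of Q ?Q1] by simp
        qed
        then have "max Q ?Q1 ^ ?\<kappa> \<le> (Q ^ ?Q1) ^ ?\<kappa>" by (rule power_mono) simp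
        then have "real (max Q ?Q1 ^ ?\<kappa>) \<le> real ((Q ^ ?Q1) ^ ?\<kappa>)" by (simp only: of_nat_le_iff)
        then show "real (max Q ?Q1) ^ ?\<kappa> \<le> real Q ^ (?\<kappa> * ?Q1)"
          by (simp only: of_nat_power power_mult[symmetric] mult.commute)
      qed simp
      finally show "1 \<le> real Q ^ (?\<kappa> * ?Q1) * cmod (\<Sum>x\<in>?B. q x * (case x of (a, k) \<Rightarrow> f a * s ^ k))"
        by (simp only: poly_p)
    qed
  qed
qed

text \<open>Monomials in one more variable s are the old ones times powers of s. For almost every
  value of the old variables \<open>AE_diophantine_powers\<close> excludes a null set of s, and
  Fubini combines these null sets. The exponent \<kappa> is allowed to depend on the point.\<close>

lemma AE_diophantine_monomials:
  assumes "finite I"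
  shows "AE h in (\<Pi>\<^sub>M i\<in>I. (lborel :: complex measure)).
     diophantine (I \<rightarrow>\<^sub>E {..d}) (\<lambda>e. \<Prod>i\<in>I. h i ^ e i)"
  using assms
proof (induction I rule: finite_induct)
  case empty
  have "diophantine ({} \<rightarrow>\<^sub>E {..d}) (\<lambda>e. \<Prod>i\<in>{}. (h :: 'a \<Rightarrow> complex) i ^ e i)" for h
    unfolding diophantine_def
  proof (intro exI[of _ 0] allI impI ballI)
    fix Q :: nat and q :: "('a \<Rightarrow> nat) \<Rightarrow> complex"
    assume "q \<in> ({} \<rightarrow>\<^sub>E {..d}) \<rightarrow>\<^sub>E gbox Q" "\<exists>e\<in>{} \<rightarrow>\<^sub>E {..d}. q e \<noteq> 0"
    then show "1 \<le> real Q ^ 0 * cmod (\<Sum>e\<in>{} \<rightarrow>\<^sub>E {..d}. q e * (\<Prod>i\<in>{}. (h :: 'a \<Rightarrow> complex) i ^ e i))"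
      by (auto simp: PiE_iff intro: gbox_norm_ge)
  qed
  then show ?case by simp
next
  case (insert i I)
  interpret product_sigma_finite "\<lambda>_::'a. lborel :: complex measure" ..
  let ?M = "\<lambda>I. \<Pi>\<^sub>M i\<in>I. (lborel :: complex measure)"
  let ?P = "\<lambda>I h. diophantine (I \<rightarrow>\<^sub>E {..d}) (\<lambda>e. \<Prod>i\<in>I. (h i :: complex) ^ e i)"
  have fin: "finite ((insert i I \<rightarrow>\<^sub>E {..d}) \<rightarrow>\<^sub>E gbox Q)" for Q
    using insert by (intro finite_PiE) auto
  have "Measurable.pred (?M (insert i I)) (\<lambda>h. 1 \<le> real Q ^ \<kappa> *
      cmod (\<Sum>e\<in>insert i I \<rightarrow>\<^sub>E {..d}. q e * (\<Prod>j\<in>insert i I. h j ^ e j)))" for Q \<kappa> :: nat and q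
    by measurable
  \<comment> \<open>For each Q there are only finitely many forms, so the event arises from
    countably many measurable ones. Fubini is applied to its complement.\<close>
  then have [measurable]: "Measurable.pred (?M (insert i I)) (?P (insert i I))"
    unfolding diophantine_def
    by (intro pred_intros_countable(1,2) pred_intros_finite fin pred_intros_imp')
  let ?u = "\<lambda>h. if ?P (insert i I) h then 0 else (1 :: ennreal)"
  have "AE x in ?M I. AE s in lborel. ?P (insert i I) (x(i := s))"
    using insert.IH
  proof eventually_elim
    case (elim x)
    have "finite (I \<rightarrow>\<^sub>E {..d})" using insert by (intro finite_PiE) auto
    from AE_diophantine_powers[OF this elim, of d] show ?case
    proof eventually_elim
      case (elim s)
      show ?case
      proof (rule diophantine_reindex[OF _ elim])
        show "bij_betw (\<lambda>e. (restrict e I, e i)) (insert i I \<rightarrow>\<^sub>E {..d}) ((I \<rightarrow>\<^sub>E {..d}) \<times> {..d})"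
          by (rule bij_betw_byWitness[where f' = "\<lambda>(e, k). e(i := k)"])
             (use insert(2) in \<open>auto simp: fun_eq_iff PiE_iff extensional_def split: if_splits\<close>)
        fix e
        have "(\<Prod>j\<in>I. (x(i := s)) j ^ e j) = (\<Prod>j\<in>I. x j ^ restrict e I j)"
          using insert(2) by (intro prod.cong) auto
        then show "(\<Prod>j\<in>insert i I. (x(i := s)) j ^ e j) = (case (restrict e I, e i) of (a, k) \<Rightarrow> (\<Prod>j\<in>I. x j ^ a j) * s ^ k)"
          using insert(1,2) by simp
      qed
    qed
  qed
  then have "AE x in ?M I. (\<integral>\<^sup>+s. ?u (x(i := s)) \<partial>lborel) = 0"
  proof eventually_elim
    case (elim x)
    then have "(\<integral>\<^sup>+s. ?u (x(i := s)) \<partial>lborel) = (\<integral>\<^sup>+s. 0 \<partial>(lborel :: complex measure))"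
      by (intro nn_integral_cong_AE) auto
    then show ?case by simp
  qed
  then have "(\<integral>\<^sup>+x. (\<integral>\<^sup>+s. ?u (x(i := s)) \<partial>lborel) \<partial>?M I) = (\<integral>\<^sup>+x. 0 \<partial>?M I)"
    by (rule nn_integral_cong_AE)
  then have "(\<integral>\<^sup>+h. ?u h \<partial>?M (insert i I)) = 0"
    using product_nn_integral_insert[OF insert(1,2), of ?u] by simp
  then have "AE h in ?M (insert i I). ?u h = 0"
    by (subst (asm) nn_integral_0_iff_AE) measurable
  then show ?case by eventually_elim (simp split: if_splits)
qed

section \<open>Separating directions\<close>

definition grid :: "nat \<Rightarrow> complex set" where
  "grid g = (\<lambda>(a, b). Complex (real_of_int a / g) (real_of_int b / g)) ` ({0..<int g} \<times> {0..<int g})"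

lemma finite_grid: "finite (grid g)"
  by (simp add: grid_def)

lemma card_grid: "g > 0 \<Longrightarrow> card (grid g) = g ^ 2"
  unfolding grid_def by (subst card_image) (auto simp: inj_on_def power2_eq_square)

lemma norm_grid_le: "w \<in> grid g \<Longrightarrow> cmod w \<le> 2"
proof -
  assume "w \<in> grid g"
  then obtain a b where ab: "w = Complex (real_of_int a / g) (real_of_int b / g)" "0 \<le> a" "a < int g" "0 \<le> b" "b < int g"
    unfolding grid_def by auto
  then have "\<bar>Re w\<bar> \<le> 1" "\<bar>Im w\<bar> \<le> 1" by auto
  then show "cmod w \<le> 2" using cmod_le[of w] by linarith
qed

text \<open>A small value forces w to be closer than 1/g to the root -u/c, and in each coordinate at
  most two multiples of 1/g are that close.\<close>

lemma card_grid_near_root: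
  assumes g: "g > 0" and c: "\<beta> > 0" "\<beta> \<le> cmod c"
  shows "card {w \<in> grid g. cmod (u + w * c) < \<beta> / g} \<le> 4"
proof -
  define z where "z = - (u / c)"
  define S where "S t = {\<lfloor>t * g\<rfloor>, \<lfloor>t * g\<rfloor> + 1}" for t :: real
  let ?F = "\<lambda>(a, b). Complex (real_of_int a / g) (real_of_int b / g)"
  have near: "a \<in> S t" if "\<bar>real_of_int a / g - t\<bar> < 1 / g" for a t
  proof -
    have "\<bar>real_of_int a / g - t\<bar> * g < 1" using that g by (simp add: field_simps)
    then have "\<bar>real_of_int a - t * g\<bar> < 1" using g by (simp add: abs_mult_pos left_diff_distrib)
    then show ?thesis unfolding S_def by (simp add: abs_less_iff) linarith
  qed
  have "{w \<in> grid g. cmod (u + w * c) < \<beta> / g} \<subseteq> ?F ` (S (Re z) \<times> S (Im z))"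
  proof
    fix w assume w: "w \<in> {w \<in> grid g. cmod (u + w * c) < \<beta> / g}"
    then obtain a b where ab: "w = ?F (a, b)" unfolding grid_def by auto
    have c0: "c \<noteq> 0" using c by auto
    have "(w - z) * c = u + w * c" using c0 by (simp add: z_def algebra_simps)
    then have "cmod (w - z) * cmod c = cmod (u + w * c)" by (simp only: flip: norm_mult)
    also have "\<dots> < \<beta> / g" using w by simp
    also have "\<dots> \<le> 1 / g * cmod c" using c g by (simp add: divide_right_mono)
    finally have *: "cmod (w - z) < 1 / g" by (rule mult_right_less_imp_less) simp
    have "\<bar>real_of_int a / g - Re z\<bar> < 1 / g" "\<bar>real_of_int b / g - Im z\<bar> < 1 / g"
      using * abs_Re_le_cmod[of "w - z"] abs_Im_le_cmod[of "w - z"] by (auto simp: ab)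
    then have "(a, b) \<in> S (Re z) \<times> S (Im z)" using near by blast
    then show "w \<in> ?F ` (S (Re z) \<times> S (Im z))" using ab by blast
  qed
  then have "card {w \<in> grid g. cmod (u + w * c) < \<beta> / g} \<le> card (?F ` (S (Re z) \<times> S (Im z)))"
    by (intro card_mono) (auto simp: S_def)
  also have "\<dots> \<le> card (S (Re z) \<times> S (Im z))" by (rule card_image_le) (auto simp: S_def)
  also have "\<dots> = 4" by (simp add: S_def card_cartesian_product)
  finally show ?thesis .
qed

text \<open>
  The directions are chosen one after the other.  Each form that involves the new direction excludes at most 4 points
  of the grid, and the grid has more points than are excluded altogether.  The minimum distance \<open>\<beta> / g\<close> contains the
  Diophantine loss \<open>\<beta>\<close> only once, whatever the number \<open>L\<close> of directions.
\<close>

lemma exists_separating_directions: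
  fixes A :: "'r \<Rightarrow> 'a set" and f :: "'r \<Rightarrow> 'a \<Rightarrow> complex"
  assumes R: "finite R" and A: "\<And>r. r \<in> R \<Longrightarrow> finite (A r)" "\<And>r. r \<in> R \<Longrightarrow> card (A r) \<le> m"
    and \<beta>: "\<beta> > 0" and g: "g > 0"
    and sep: "\<And>r q. \<lbrakk>r \<in> R; \<And>a. a \<in> A r \<Longrightarrow> q a \<in> gbox Q; \<exists>a\<in>A r. q a \<noteq> 0\<rbrakk>
       \<Longrightarrow> \<beta> \<le> cmod (\<Sum>a\<in>A r. q a * f r a)"
    and "4 * card R * ((2 * Q + 1) ^ 2) ^ (m * L) < g ^ 2"
  shows "\<exists>v. (\<forall>l. cmod (v l) \<le> 2) \<and>
    (\<forall>r\<in>R. \<forall>q. (\<forall>l<L. \<forall>a\<in>A r. q l a \<in> gbox Q) \<longrightarrow> (\<exists>l<L. \<exists>a\<in>A r. q l a \<noteq> 0) \<longrightarrow>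
       \<beta> / g \<le> cmod (\<Sum>l<L. v l * (\<Sum>a\<in>A r. q l a * f r a)))"
  using assms(7)
proof (induction L)
  case 0
  show ?case by (rule exI[of _ "\<lambda>_. 0"]) auto
next
  case (Suc L)
  let ?B = "(2 * Q + 1) ^ 2"
  have "4 * card R * ?B ^ (m * L) \<le> 4 * card R * ?B ^ (m * Suc L)"
    by (intro mult_le_mono2 power_increasing) auto
  then obtain v where v2: "\<And>l. cmod (v l) \<le> 2"
    and v: "\<And>r q. \<lbrakk>r \<in> R; \<forall>l<L. \<forall>a\<in>A r. q l a \<in> gbox Q; \<exists>l<L. \<exists>a\<in>A r. q l a \<noteq> 0\<rbrakk> \<Longrightarrow>
       \<beta> / g \<le> cmod (\<Sum>l<L. v l * (\<Sum>a\<in>A r. q l a * f r a))"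
    using Suc by (meson le_less_trans)
  define c where "c r q = (\<Sum>a\<in>A r. q L a * f r a)" for r and q :: "nat \<Rightarrow> 'a \<Rightarrow> complex"
  define u where "u r q = (\<Sum>l<L. v l * (\<Sum>a\<in>A r. q l a * f r a))" for r and q :: "nat \<Rightarrow> 'a \<Rightarrow> complex"
  define \<Omega> where "\<Omega> r = ({..L} \<rightarrow>\<^sub>E (A r \<rightarrow>\<^sub>E gbox Q))" for r
  \<comment> \<open>The condition on \<open>c r q\<close> is built in so that the bound 4 holds for
    every \<open>q\<close>. Families whose last block vanishes do not involve the new direction and
    are left to the induction hypothesis.\<close>
  define bad where "bad r q = {w \<in> grid g. \<beta> \<le> cmod (c r q) \<and> cmod (u r q + w * c r q) < \<beta> / g}" for r q
  have fin\<Omega>: "finite (\<Omega> r)" if "r \<in> R" for r unfolding \<Omega>_def using A(1)[OF that] by (intro finite_PiE) auto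
  have card\<Omega>: "card (\<Omega> r) \<le> ?B ^ (m * Suc L)" if r: "r \<in> R" for r
  proof -
    have "card (\<Omega> r) = (card (gbox Q) ^ card (A r)) ^ Suc L"
      unfolding \<Omega>_def using A(1)[OF r] by (subst card_PiE) (simp_all add: card_PiE)
    also have "\<dots> \<le> (?B ^ card (A r)) ^ Suc L" by (intro power_mono card_gbox_le) auto
    also have "\<dots> \<le> (?B ^ m) ^ Suc L" using A(2)[OF r] by (intro power_mono power_increasing) auto
    finally show ?thesis by (simp only: power_mult)
  qed
  have bad4: "card (bad r q) \<le> 4" for r q
  proof (cases "\<beta> \<le> cmod (c r q)")
    case True
    then show ?thesis unfolding bad_def using card_grid_near_root[OF g \<beta> True] by simp
  qed (simp add: bad_def)
  have "card (\<Union>r\<in>R. \<Union>q\<in>\<Omega> r. bad r q) \<le> (\<Sum>r\<in>R. card (\<Union>q\<in>\<Omega> r. bad r q))"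
    by (rule card_UN_le[OF R])
  also have "\<dots> \<le> (\<Sum>r\<in>R. ?B ^ (m * Suc L) * 4)"
  proof (rule sum_mono)
    fix r assume r: "r \<in> R"
    have "card (\<Union>q\<in>\<Omega> r. bad r q) \<le> (\<Sum>q\<in>\<Omega> r. card (bad r q))" by (rule card_UN_le[OF fin\<Omega>[OF r]])
    also have "\<dots> \<le> (\<Sum>q\<in>\<Omega> r. 4)" by (intro sum_mono bad4)
    also have "\<dots> = card (\<Omega> r) * 4" by simp
    also have "\<dots> \<le> ?B ^ (m * Suc L) * 4" by (intro mult_right_mono card\<Omega> r) auto
    finally show "card (\<Union>q\<in>\<Omega> r. bad r q) \<le> ?B ^ (m * Suc L) * 4" .
  qed
  also have "\<dots> = 4 * card R * ?B ^ (m * Suc L)" by simp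
  also have "\<dots> < card (grid g)" using Suc.prems card_grid[OF g] by simp
  finally have "\<not> grid g \<subseteq> (\<Union>r\<in>R. \<Union>q\<in>\<Omega> r. bad r q)"
    using card_mono[of "\<Union>r\<in>R. \<Union>q\<in>\<Omega> r. bad r q" "grid g"] R fin\<Omega> finite_grid
    by (auto simp: bad_def not_le[symmetric])
  then obtain w where w: "w \<in> grid g" and wbad: "\<And>r q. r \<in> R \<Longrightarrow> q \<in> \<Omega> r \<Longrightarrow> w \<notin> bad r q" by blast
  show ?case
  proof (intro exI[of _ "v(L := w)"] conjI allI ballI impI)
    show "cmod ((v(L := w)) l) \<le> 2" for l using v2 norm_grid_le[OF w] by simp
    fix r q assume r: "r \<in> R" and q: "\<forall>l<Suc L. \<forall>a\<in>A r. q l a \<in> gbox Q" and nz: "\<exists>l<Suc L. \<exists>a\<in>A r. q l a \<noteq> 0"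
    have eq: "(\<Sum>l<Suc L. (v(L := w)) l * (\<Sum>a\<in>A r. q l a * f r a)) = u r q + w * c r q"
      by (simp add: u_def c_def)
    show "\<beta> / g \<le> cmod (\<Sum>l<Suc L. (v(L := w)) l * (\<Sum>a\<in>A r. q l a * f r a))"
    proof (cases "\<exists>a\<in>A r. q L a \<noteq> 0")
      case True
      define q' where "q' = (\<lambda>l\<in>{..L}. \<lambda>a\<in>A r. q l a)"
      have q': "q' \<in> \<Omega> r" using q unfolding \<Omega>_def q'_def by auto
      have uc: "u r q' = u r q" "c r q' = c r q" unfolding u_def c_def q'_def by (auto intro!: sum.cong)
      have "\<beta> \<le> cmod (c r q)" unfolding c_def using q True by (intro sep r) auto
      then have "\<beta> / g \<le> cmod (u r q + w * c r q)"
        using wbad[OF r q'] w unfolding bad_def uc by (auto simp: not_less)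
      then show ?thesis unfolding eq .
    next
      case False
      then have "c r q = 0" unfolding c_def by simp
      moreover have "\<exists>l<L. \<exists>a\<in>A r. q l a \<noteq> 0" using nz False by (metis less_Suc_eq)
      then have "\<beta> / g \<le> cmod (u r q)" unfolding u_def using q by (intro v r) auto
      ultimately show ?thesis unfolding eq by simp
    qed
  qed
qed

section \<open>Interference alignment\<close>

definition cross_index :: "nat \<Rightarrow> (nat \<Rightarrow> nat) \<Rightarrow> (nat \<times> nat \<times> nat) set" where
  "cross_index K J = {(j, k, i) \<in> coeff_index K J. i \<noteq> j}"

lemma finite_coeff_index [simp]: "finite (coeff_index K J)"
proof -
  have "coeff_index K J \<subseteq> (\<Union>j<K. {j} \<times> {..<J j} \<times> {..<K})" by (auto simp: coeff_index_def)
  then show ?thesis by (rule finite_subset) auto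
qed

text \<open>Exponents are functions on all coefficients, with 0 at the direct ones, so that
  multiplication by a direct coefficient stays within the same type and leaves a visible mark: its
  exponent becomes 1.\<close>

definition cross_exponents :: "nat \<Rightarrow> (nat \<Rightarrow> nat) \<Rightarrow> nat \<Rightarrow> (nat \<times> nat \<times> nat \<Rightarrow> nat) set" where
  "cross_exponents K J n = (\<Pi>\<^sub>E q\<in>coeff_index K J. if q \<in> cross_index K J then {..<n} else {0})"

lemma finite_cross_exponents [simp]: "finite (cross_exponents K J n)"
  unfolding cross_exponents_def by (intro finite_PiE) auto

lemma mem_cross_exponents:
  "e \<in> cross_exponents K J n \<longleftrightarrow> e \<in> extensional (coeff_index K J) \<and>
    (\<forall>p\<in>coeff_index K J. if p \<in> cross_index K J then e p < n else e p = 0)"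
  unfolding cross_exponents_def PiE_iff by (auto split: if_splits)

lemma card_cross_exponents: "card (cross_exponents K J n) = n ^ card (cross_index K J)"
proof -
  have "card (cross_exponents K J n) = (\<Prod>q\<in>coeff_index K J. if q \<in> cross_index K J then n else 1)"
    unfolding cross_exponents_def by (subst card_PiE) (auto intro!: prod.cong)
  also have "\<dots> = n ^ card (coeff_index K J \<inter> cross_index K J)"
    by (subst prod.If_cases) (auto simp: Int_def)
  also have "coeff_index K J \<inter> cross_index K J = cross_index K J" by (auto simp: cross_index_def)
  finally show ?thesis .
qed

text \<open>The transmitted symbols; coordinates start at 0 so that there are exactly Q^2 of them
  and differences fall into \<open>gbox Q\<close>.\<close>

definition gsquare :: "nat \<Rightarrow> complex set" where
  "gsquare Q = (\<lambda>(a, b). Complex (real a) (real b)) ` ({..<Q} \<times> {..<Q})"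

lemma finite_gsquare [simp]: "finite (gsquare Q)"
  by (simp add: gsquare_def)

lemma card_gsquare: "card (gsquare Q) = Q ^ 2"
  unfolding gsquare_def by (subst card_image) (auto simp: inj_on_def power2_eq_square)

lemma gsquare_diff: "z \<in> gsquare Q \<Longrightarrow> w \<in> gsquare Q \<Longrightarrow> z - w \<in> gbox Q"
  unfolding gsquare_def mem_gbox by (auto simp: abs_le_iff)

lemma gsquare_norm_le: "z \<in> gsquare Q \<Longrightarrow> cmod z \<le> 2 * Q"
  unfolding gsquare_def by (intro gbox_norm_le) (auto simp: mem_gbox)

text \<open>
  All transmitters use the directions \<open>v l * mono e\<close>, where \<open>mono e\<close> has exponents below \<open>n\<close>.  A cross coefficient maps these
  monomials to monomials with exponents at most \<open>n\<close>, so that all interference at a receiver stays in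
  \<open>L * (n + 1) ^ \<Gamma>\<close> dimensions, while the desired symbols are marked by the direct coefficient of that receiver.
\<close>

lemma aligned_constellation:
  fixes h :: channel and K n :: nat and J :: "nat \<Rightarrow> nat"
  defines "I \<equiv> coeff_index K J" and "\<Gamma> \<equiv> card (cross_index K J)"
  assumes K: "K \<ge> 2" and n: "n \<ge> 1"
    and dioph: "diophantine (I \<rightarrow>\<^sub>E {..n}) (\<lambda>e. \<Prod>p\<in>I. h p ^ e p)"
  shows "\<exists>\<kappa>. \<forall>L\<ge>1. \<exists>c>0. \<forall>Q\<ge>1. \<forall>P>0. \<exists>(A :: (nat \<Rightarrow> (nat \<times> nat \<times> nat \<Rightarrow> nat) \<Rightarrow> complex) set) x.
    finite A \<and> card A = Q ^ (2 * (L * n ^ \<Gamma>)) \<and> (\<forall>a\<in>A. (cmod (x a))\<^sup>2 \<le> P) \<and>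
    (\<forall>j k a b. j < K \<longrightarrow> k < J j \<longrightarrow> (\<forall>i<K. a i \<in> A) \<longrightarrow> (\<forall>i<K. b i \<in> A) \<longrightarrow> a j \<noteq> b j \<longrightarrow>
       sqrt P / (c * real Q ^ (\<kappa> + L * (n ^ \<Gamma> + (n + 1) ^ \<Gamma>) + 1))
         \<le> cmod ((\<Sum>i<K. h (j, k, i) * x (a i)) - (\<Sum>i<K. h (j, k, i) * x (b i))))"
proof -
  define mono where "mono e = (\<Prod>p\<in>I. h p ^ e p)" for e
  let ?T = "cross_exponents K J n" and ?T' = "cross_exponents K J (n + 1)"
  define M where "M = n ^ \<Gamma>"
  define m where "m = M + (n + 1) ^ \<Gamma>"
  have fI: "finite I" by (simp add: I_def)
  have cT: "card ?T = M" and cT': "card ?T' = (n + 1) ^ \<Gamma>" by (simp_all add: card_cross_exponents M_def \<Gamma>_def)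
  have M1: "M \<ge> 1" using n by (simp add: M_def)
  have m1: "m \<ge> 1" using M1 by (simp add: m_def)
  have "diophantine (I \<rightarrow>\<^sub>E {..n}) mono" using dioph by (simp add: mono_def[abs_def])
  then obtain \<kappa> :: nat where \<kappa>': "\<forall>Q\<ge>2. \<forall>q\<in>(I \<rightarrow>\<^sub>E {..n}) \<rightarrow>\<^sub>E gbox Q. (\<exists>e\<in>I \<rightarrow>\<^sub>E {..n}. q e \<noteq> 0)
      \<longrightarrow> 1 \<le> real Q ^ \<kappa> * cmod (\<Sum>e\<in>I \<rightarrow>\<^sub>E {..n}. q e * mono e)"
    unfolding diophantine_def by (elim exE)
  have \<kappa>: "1 \<le> real Q ^ \<kappa> * cmod (\<Sum>e\<in>I \<rightarrow>\<^sub>E {..n}. q e * mono e)"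
    if "Q \<ge> 2" "q \<in> (I \<rightarrow>\<^sub>E {..n}) \<rightarrow>\<^sub>E gbox Q" "\<exists>e\<in>I \<rightarrow>\<^sub>E {..n}. q e \<noteq> 0" for Q q
    using that by (intro \<kappa>'[rule_format])
  \<comment> \<open>multiplication of a monomial by \<open>h p\<close>\<close>
  define s where "s p e = e(p := Suc (e p))" for p and e :: "nat \<times> nat \<times> nat \<Rightarrow> nat"
  have mono_s: "mono (s p e) = h p * mono e" if "p \<in> I" for p e
  proof -
    have "(\<Prod>x\<in>I - {p}. h x ^ s p e x) = (\<Prod>x\<in>I - {p}. h x ^ e x)"
      by (intro prod.cong) (auto simp: s_def)
    moreover have "s p e p = Suc (e p)" by (simp add: s_def)
    ultimately show ?thesis unfolding mono_def prod.remove[OF fI that] by simp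
  qed
  \<comment> \<open>All pairs of a receiver and a state: the same directions have to separate the
    symbols at each of them.\<close>
  define R where "R = Sigma {..<K} (\<lambda>j. {..<J j})"
  have fR: "finite R" by (auto simp: R_def)
  \<comment> \<open>The monomials received at \<open>r\<close>. Images coming from different
    transmitters may coincide; this is the alignment, and it keeps the cardinality below
    \<open>m\<close>.\<close>
  define A where "A r = (\<lambda>(i, e). s (fst r, snd r, i) e) ` ({..<K} \<times> ?T)" for r
  have fA: "finite (A r)" for r unfolding A_def by auto
  have idx: "(j, k, i) \<in> I" if "(j, k) \<in> R" "i < K" for j k i
    using that by (auto simp: R_def I_def coeff_index_def)
  have T0: "e (j, k, j) = 0" if "e \<in> ?T" "(j, k) \<in> R" for e j k
  proof -
    have "(j, k, j) \<in> I" using that by (auto simp: R_def I_def coeff_index_def)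
    moreover have "(j, k, j) \<notin> cross_index K J" by (simp add: cross_index_def)
    ultimately show ?thesis using that by (auto simp: mem_cross_exponents I_def)
  qed
  have sT': "s p e \<in> ?T'" if e: "e \<in> ?T" and p: "p \<in> cross_index K J" for p e
  proof -
    have "p \<in> coeff_index K J" using p by (auto simp: cross_index_def)
    then show ?thesis using e p by (force simp: mem_cross_exponents s_def extensional_def)
  qed
  \<comment> \<open>A cross exponent rises from at most n - 1 to at most n, a direct one from 0 to
    1; as n \<ge> 1, both stay in the family covered by \<open>dioph\<close>.\<close>
  have sE: "s p e \<in> I \<rightarrow>\<^sub>E {..n}" if e: "e \<in> ?T" and p: "p \<in> I" for p e
  proof -
    have "e q < n" if "q \<in> I" for q using e that n by (auto simp: mem_cross_exponents I_def split: if_splits)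
    moreover have "e \<in> extensional I" using e by (simp add: mem_cross_exponents I_def)
    ultimately show ?thesis using p by (auto simp: PiE_iff s_def extensional_def less_imp_le Suc_le_eq)
  qed
  have AE: "A r \<subseteq> I \<rightarrow>\<^sub>E {..n}" if "r \<in> R" for r
    unfolding A_def using that idx by (cases r) (auto intro!: sE)
  have cA: "card (A r) \<le> m" if r: "r \<in> R" for r
  proof -
    have "A r \<subseteq> s (fst r, snd r, fst r) ` ?T \<union> ?T'"
    proof
      fix y assume "y \<in> A r"
      then obtain i e where ie: "i < K" "e \<in> ?T" "y = s (fst r, snd r, i) e" unfolding A_def by auto
      show "y \<in> s (fst r, snd r, fst r) ` ?T \<union> ?T'"
      proof (cases "i = fst r")
        case False
        then have "(fst r, snd r, i) \<in> cross_index K J" using r ie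
          by (auto simp: R_def cross_index_def coeff_index_def)
        then show ?thesis using sT' ie by auto
      qed (use ie in auto)
    qed
    then have "card (A r) \<le> card (s (fst r, snd r, fst r) ` ?T \<union> ?T')" by (intro card_mono) auto
    also have "\<dots> \<le> card (s (fst r, snd r, fst r) ` ?T) + card ?T'" by (rule card_Un_le)
    also have "\<dots> \<le> m" unfolding m_def cT'[symmetric] cT[symmetric] by (intro add_mono card_image_le) auto
    finally show ?thesis .
  qed
  define H where "H = 1 + (\<Sum>e\<in>?T. cmod (mono e))"
  have H: "cmod (mono e) \<le> H" if "e \<in> ?T" for e
    using that member_le_sum[of e ?T "\<lambda>e. cmod (mono e)"] by (simp add: H_def)
  have H0: "H > 0" unfolding H_def by (intro add_pos_nonneg sum_nonneg) auto
  show ?thesis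
  proof (intro exI[of _ \<kappa>] allI impI)
    fix L :: nat assume L: "L \<ge> 1"
    let ?S = "\<kappa> + L * (n ^ \<Gamma> + (n + 1) ^ \<Gamma>) + 1"
    define c1 where "c1 = 3 * (real (card R) + 1) * 3 ^ (m * L) * (real K * real M) ^ (\<kappa> + m * L)"
    define c where "c = c1 * (4 * L * M * H)"
    have c1: "c1 > 0" unfolding c1_def using K M1 by (intro mult_pos_pos) auto
    have LMH: "4 * L * M * H > 0" using H0 L M1 by simp
    show "\<exists>c>0. \<forall>Q\<ge>1. \<forall>P>0. \<exists>(A :: (nat \<Rightarrow> (nat \<times> nat \<times> nat \<Rightarrow> nat) \<Rightarrow> complex) set) x.
      finite A \<and> card A = Q ^ (2 * (L * n ^ \<Gamma>)) \<and> (\<forall>a\<in>A. (cmod (x a))\<^sup>2 \<le> P) \<and>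
      (\<forall>j k a b. j < K \<longrightarrow> k < J j \<longrightarrow> (\<forall>i<K. a i \<in> A) \<longrightarrow> (\<forall>i<K. b i \<in> A) \<longrightarrow> a j \<noteq> b j \<longrightarrow>
       sqrt P / (c * real Q ^ ?S)
         \<le> cmod ((\<Sum>i<K. h (j, k, i) * x (a i)) - (\<Sum>i<K. h (j, k, i) * x (b i))))"
    proof (intro exI[of _ c] conjI allI impI)
      show "0 < c" using mult_pos_pos[OF c1 LMH] by (simp add: c_def)
      fix Q :: nat and P :: real assume Q: "Q \<ge> 1" and P: "P > 0"
      \<comment> \<open>At most K * M symbol differences from \<open>gbox Q\<close> are added up on
        one received monomial.\<close>
      define Q' where "Q' = K * M * Q"
      have Q': "Q' \<ge> 2"
      proof -
        have "2 * 1 * 1 \<le> K * M * Q" using K M1 Q by (intro mult_le_mono) auto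
        then show ?thesis by (simp add: Q'_def)
      qed
      \<comment> \<open>Its square is 9 * (card R + 1)^2 * (2 * Q' + 1)^(2 * m * L), more than the
        number of grid points that can be excluded.\<close>
      define g where "g = 3 * (card R + 1) * (2 * Q' + 1) ^ (m * L)"
      define \<beta> where "\<beta> = 1 / real Q' ^ \<kappa>"
      have \<beta>0: "\<beta> > 0" using Q' by (simp add: \<beta>_def)
      have g0: "g > 0" by (simp add: g_def)
      have sep: "\<beta> \<le> cmod (\<Sum>e\<in>A r. q e * mono e)"
        if r: "r \<in> R" and q: "\<And>e. e \<in> A r \<Longrightarrow> q e \<in> gbox Q'" and nz: "\<exists>e\<in>A r. q e \<noteq> 0" for r q
      proof -
        let ?E = "I \<rightarrow>\<^sub>E {..n}"
        \<comment> \<open>\<open>dioph\<close> speaks of the full family of monomials, so the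
          coefficients are extended by 0.\<close>
        let ?q = "\<lambda>e\<in>?E. if e \<in> A r then q e else 0"
        have fE: "finite ?E" using fI by (intro finite_PiE) auto
        have "?q \<in> ?E \<rightarrow>\<^sub>E gbox Q'" using q by auto
        moreover have "\<exists>e\<in>?E. ?q e \<noteq> 0" using nz AE[OF r] by auto
        ultimately have "1 \<le> real Q' ^ \<kappa> * cmod (\<Sum>e\<in>?E. ?q e * mono e)" by (intro \<kappa> Q')
        also have "(\<Sum>e\<in>?E. ?q e * mono e) = (\<Sum>e\<in>A r. ?q e * mono e)"
          using AE[OF r] fE by (intro sum.mono_neutral_right) auto
        also have "\<dots> = (\<Sum>e\<in>A r. q e * mono e)" using AE[OF r] by (intro sum.cong) auto
        finally show ?thesis using Q' by (simp add: \<beta>_def field_simps)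
      qed
      have small: "4 * card R * ((2 * Q' + 1) ^ 2) ^ (m * L) < g ^ 2"
      proof -
        have "4 * card R < 9 * (card R + 1) ^ 2" by (simp add: power2_eq_square)
        then have "4 * card R * ((2 * Q' + 1) ^ 2) ^ (m * L) < 9 * (card R + 1) ^ 2 * ((2 * Q' + 1) ^ 2) ^ (m * L)"
          by (intro mult_strict_right_mono) auto
        also have "\<dots> = g ^ 2"
          unfolding g_def by (simp only: power_mult_distrib power_mult[symmetric] mult.commute) simp
        finally show ?thesis .
      qed
      have "\<exists>v. (\<forall>l. cmod (v l) \<le> 2) \<and>
        (\<forall>r\<in>R. \<forall>q. (\<forall>l<L. \<forall>e\<in>A r. q l e \<in> gbox Q') \<longrightarrow> (\<exists>l<L. \<exists>e\<in>A r. q l e \<noteq> 0) \<longrightarrow>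
          \<beta> / g \<le> cmod (\<Sum>l<L. v l * (\<Sum>e\<in>A r. q l e * mono e)))"
        by (rule exists_separating_directions[where f = "\<lambda>_. mono", OF fR fA cA \<beta>0 g0 _ small]) (auto intro: sep)
      then obtain v where v2': "\<forall>l. cmod (v l) \<le> 2"
        and v': "\<forall>r\<in>R. \<forall>q. (\<forall>l<L. \<forall>e\<in>A r. q l e \<in> gbox Q') \<longrightarrow> (\<exists>l<L. \<exists>e\<in>A r. q l e \<noteq> 0) \<longrightarrow>
          \<beta> / g \<le> cmod (\<Sum>l<L. v l * (\<Sum>e\<in>A r. q l e * mono e))"
        by (elim exE conjE)
      note v2 = v2'[rule_format]
      have v: "\<beta> / g \<le> cmod (\<Sum>l<L. v l * (\<Sum>e\<in>A r. q l e * mono e))"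
        if "r \<in> R" "\<forall>l<L. \<forall>e\<in>A r. q l e \<in> gbox Q'" "\<exists>l<L. \<exists>e\<in>A r. q l e \<noteq> 0" for r q
        using that by (intro v'[rule_format]) simp_all
      have \<eta>: "1 / (c1 * real Q ^ (\<kappa> + m * L)) \<le> \<beta> / g"
      proof -
        have "real Q' ^ \<kappa> * real g \<le> real Q' ^ \<kappa> * (3 * (real (card R) + 1) * (3 * real Q') ^ (m * L))"
        proof (rule mult_left_mono)
          have "(2 * real Q' + 1) ^ (m * L) \<le> (3 * real Q') ^ (m * L)" using Q' by (intro power_mono) auto
          then have "3 * (real (card R) + 1) * (2 * real Q' + 1) ^ (m * L) \<le> 3 * (real (card R) + 1) * (3 * real Q') ^ (m * L)"
            by (rule mult_left_mono) auto
          then show "real g \<le> 3 * (real (card R) + 1) * (3 * real Q') ^ (m * L)"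
            by (simp add: g_def add_ac)
        qed simp
        also have "\<dots> = 3 * (real (card R) + 1) * 3 ^ (m * L) * real Q' ^ (\<kappa> + m * L)"
          by (simp add: power_add power_mult_distrib)
        also have "\<dots> = c1 * real Q ^ (\<kappa> + m * L)"
          by (simp add: c1_def Q'_def power_mult_distrib)
        finally have "1 / (c1 * real Q ^ (\<kappa> + m * L)) \<le> 1 / (real Q' ^ \<kappa> * real g)"
          using Q' g0 by (intro divide_left_mono mult_pos_pos c1) (use Q c1 in auto)
        then show ?thesis by (simp add: \<beta>_def)
      qed
      define \<Lambda> where "\<Lambda> = ({..<L} \<rightarrow>\<^sub>E (?T \<rightarrow>\<^sub>E gsquare Q))"
      \<comment> \<open>The unscaled sum is at most 4 * L * M * H * Q: directions have modulus at
        most 2, symbols at most 2 * Q, monomials at most \<open>H\<close>. Thus every single symbol,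
        and not only the average, obeys the power constraint.\<close>
      define \<mu> where "\<mu> = sqrt P / (4 * L * M * H * Q)"
      have \<mu>0: "\<mu> > 0" unfolding \<mu>_def using P Q LMH by (intro divide_pos_pos mult_pos_pos[OF LMH]) auto
      define x where "x a = of_real \<mu> * (\<Sum>l<L. v l * (\<Sum>e\<in>?T. a l e * mono e))" for a :: "nat \<Rightarrow> (nat \<times> nat \<times> nat \<Rightarrow> nat) \<Rightarrow> complex"
      have aT: "a l e \<in> gsquare Q" if "a \<in> \<Lambda>" "l < L" "e \<in> ?T" for a l e
        using that unfolding \<Lambda>_def by auto
      have fin\<Lambda>: "finite \<Lambda>" unfolding \<Lambda>_def by (intro finite_PiE) auto
      have card\<Lambda>: "card \<Lambda> = Q ^ (2 * (L * n ^ \<Gamma>))"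
        unfolding \<Lambda>_def by (simp add: card_PiE card_gsquare cT M_def power_mult[symmetric] mult_ac)
      have pow: "(cmod (x a))\<^sup>2 \<le> P" if a: "a \<in> \<Lambda>" for a
      proof -
        have inner: "cmod (\<Sum>e\<in>?T. a l e * mono e) \<le> M * (2 * Q * H)" if l: "l < L" for l
        proof -
          have "cmod (\<Sum>e\<in>?T. a l e * mono e) \<le> (\<Sum>e\<in>?T. cmod (a l e * mono e))" by (rule norm_sum)
          also have "\<dots> \<le> (\<Sum>e\<in>?T. 2 * Q * H)"
            unfolding norm_mult using H0 by (intro sum_mono mult_mono H gsquare_norm_le aT[OF a l]) auto
          finally show ?thesis by (simp add: cT)
        qed
        have "cmod (\<Sum>l<L. v l * (\<Sum>e\<in>?T. a l e * mono e)) \<le> (\<Sum>l<L. cmod (v l * (\<Sum>e\<in>?T. a l e * mono e)))" by (rule norm_sum)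
        also have "\<dots> \<le> (\<Sum>l<L. 2 * (M * (2 * Q * H)))"
          unfolding norm_mult by (intro sum_mono mult_mono v2 inner) auto
        also have "\<dots> = 4 * L * M * H * Q" by simp
        finally have "cmod (x a) \<le> \<mu> * (4 * L * M * H * Q)"
          unfolding x_def norm_mult using \<mu>0 by (simp add: mult_left_mono)
        also have "\<dots> = sqrt P" using H0 L M1 Q by (simp add: \<mu>_def)
        finally have "(cmod (x a))\<^sup>2 \<le> (sqrt P)\<^sup>2" by (rule power_mono) simp
        then show ?thesis using P by simp
      qed
      have dist: "sqrt P / (c * real Q ^ ?S) \<le> cmod ((\<Sum>i<K. h (j, k, i) * x (a i)) - (\<Sum>i<K. h (j, k, i) * x (b i)))"
        if jk: "j < K" "k < J j" and a: "\<forall>i<K. a i \<in> \<Lambda>" and b: "\<forall>i<K. b i \<in> \<Lambda>" and ab: "a j \<noteq> b j" for j k a b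
      proof -
        have r: "(j, k) \<in> R" using jk by (auto simp: R_def)
        define d where "d l i e = a i l e - b i l e" for l i e
        have d: "d l i e \<in> gbox Q" if "l < L" "i < K" "e \<in> ?T" for l i e
          unfolding d_def using that a b by (intro gsquare_diff aT) auto
        let ?s = "\<lambda>(i, e). s (j, k, i) e"
        have Ar: "A (j, k) = ?s ` ({..<K} \<times> ?T)" by (simp add: A_def)
        \<comment> \<open>Aligned symbols share a received monomial, so its coefficient is the sum
          over the fibre.\<close>
        define q where "q l y = (\<Sum>(i, e)\<in>{w \<in> {..<K} \<times> ?T. ?s w = y}. d l i e)" for l y
        have qbox: "q l y \<in> gbox Q'" if l: "l < L" for l y
        proof -
          have "card {w \<in> {..<K} \<times> ?T. ?s w = y} \<le> card ({..<K} \<times> ?T)" by (intro card_mono) auto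
          then have "card {w \<in> {..<K} \<times> ?T. ?s w = y} * Q \<le> Q'" unfolding Q'_def by (simp add: cT)
          moreover have "q l y \<in> gbox (card {w \<in> {..<K} \<times> ?T. ?s w = y} * Q)"
            unfolding q_def using d l by (intro gbox_sum) auto
          ultimately show ?thesis by (rule gbox_mono[rotated])
        qed
        have "\<exists>l<L. \<exists>e\<in>?T. a j l e \<noteq> b j l e"
        proof (rule ccontr)
          assume "\<not> ?thesis"
          then have eq: "a j l e = b j l e" if "l < L" "e \<in> ?T" for l e using that by auto
          have aj: "a j \<in> \<Lambda>" "b j \<in> \<Lambda>" using a b jk by auto
          have "a j l = b j l" if l: "l < L" for l
            using aj l eq unfolding \<Lambda>_def by (intro PiE_ext[of "a j l" ?T _ "b j l"]) (auto simp: PiE_iff)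
          then have "a j = b j" using aj unfolding \<Lambda>_def by (intro PiE_ext[of "a j" "{..<L}" _ "b j"]) auto
          then show False using ab by simp
        qed
        then obtain l0 e0 where le: "l0 < L" "e0 \<in> ?T" "a j l0 e0 \<noteq> b j l0 e0" by blast
        \<comment> \<open>The direct coefficient has exponent 1 only in the images of the desired symbols, so these do not overlap.\<close>
        have fibre: "{w \<in> {..<K} \<times> ?T. ?s w = s (j, k, j) e0} = {(j, e0)}"
        proof (intro set_eqI iffI)
          fix w assume w: "w \<in> {w \<in> {..<K} \<times> ?T. ?s w = s (j, k, j) e0}"
          then obtain i e where ie: "w = (i, e)" "i < K" "e \<in> ?T" "s (j, k, i) e = s (j, k, j) e0" by auto
          have "s (j, k, i) e (j, k, j) = 1" using ie(4) T0[OF le(2) r] by (simp add: s_def)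
          then have i: "i = j" using T0[OF ie(3) r] by (auto simp: s_def split: if_splits)
          have "e y = e0 y" for y
            using fun_cong[OF ie(4), of y] unfolding i by (simp add: s_def split: if_splits)
          then show "w \<in> {(j, e0)}" using ie i by auto
        qed (use jk le in auto)
        have "q l0 (s (j, k, j) e0) = d l0 j e0" unfolding q_def fibre by simp
        then have qnz: "q l0 (s (j, k, j) e0) \<noteq> 0" using le by (simp add: d_def)
        have yA: "s (j, k, j) e0 \<in> A (j, k)" unfolding Ar using jk le by force
        have "\<beta> / g \<le> cmod (\<Sum>l<L. v l * (\<Sum>y\<in>A (j, k). q l y * mono y))"
          using r qbox qnz yA le(1) by (intro v) auto
        moreover have "(\<Sum>i<K. h (j, k, i) * x (a i)) - (\<Sum>i<K. h (j, k, i) * x (b i))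
           = of_real \<mu> * (\<Sum>l<L. v l * (\<Sum>y\<in>A (j, k). q l y * mono y))"
        proof -
          have "(\<Sum>y\<in>A (j, k). q l y * mono y) = (\<Sum>(i, e)\<in>{..<K} \<times> ?T. d l i e * (h (j, k, i) * mono e))" for l
          proof -
            have "(\<Sum>(i, e)\<in>{..<K} \<times> ?T. d l i e * (h (j, k, i) * mono e))
              = (\<Sum>w\<in>{..<K} \<times> ?T. (case w of (i, e) \<Rightarrow> d l i e) * mono (?s w))"
              using idx[OF r] by (intro sum.cong) (auto simp: mono_s)
            also have "\<dots> = (\<Sum>y\<in>?s ` ({..<K} \<times> ?T). \<Sum>w\<in>{w \<in> {..<K} \<times> ?T. ?s w = y}. (case w of (i, e) \<Rightarrow> d l i e) * mono (?s w))"
              by (rule sum.image_gen) simp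
            also have "\<dots> = (\<Sum>y\<in>A (j, k). q l y * mono y)"
              unfolding Ar q_def by (intro sum.cong refl) (simp add: sum_distrib_right)
            finally show ?thesis ..
          qed
          then have "(\<Sum>l<L. v l * (\<Sum>y\<in>A (j, k). q l y * mono y)) = (\<Sum>l<L. v l * (\<Sum>i<K. \<Sum>e\<in>?T. d l i e * (h (j, k, i) * mono e)))"
            by (simp add: sum.cartesian_product)
          also have "\<dots> = (\<Sum>l<L. \<Sum>i<K. h (j, k, i) * (v l * (\<Sum>e\<in>?T. d l i e * mono e)))"
            by (simp add: sum_distrib_left mult_ac)
          also have "\<dots> = (\<Sum>i<K. h (j, k, i) * (\<Sum>l<L. v l * (\<Sum>e\<in>?T. d l i e * mono e)))"
            by (subst sum.swap) (simp add: sum_distrib_left)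
          also have "\<dots> = (\<Sum>i<K. h (j, k, i) * (\<Sum>l<L. v l * (\<Sum>e\<in>?T. a i l e * mono e))) - (\<Sum>i<K. h (j, k, i) * (\<Sum>l<L. v l * (\<Sum>e\<in>?T. b i l e * mono e)))"
            by (simp add: d_def left_diff_distrib right_diff_distrib sum_subtractf)
          finally show ?thesis
            by (simp add: x_def sum_distrib_left right_diff_distrib mult_ac)
        qed
        ultimately have "\<mu> * (\<beta> / g) \<le> cmod ((\<Sum>i<K. h (j, k, i) * x (a i)) - (\<Sum>i<K. h (j, k, i) * x (b i)))"
          using \<mu>0 by (simp add: norm_mult mult_left_mono del: times_divide_eq_right)
        moreover have "sqrt P / (c * real Q ^ ?S) \<le> \<mu> * (\<beta> / g)"
        proof -
          have "sqrt P / (c * real Q ^ ?S) = \<mu> * (1 / (c1 * real Q ^ (\<kappa> + m * L)))"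
            by (simp add: \<mu>_def c_def m_def M_def mult_ac)
          also have "\<dots> \<le> \<mu> * (\<beta> / g)" using \<mu>0 \<eta> by (intro mult_left_mono) auto
          finally show ?thesis .
        qed
        ultimately show ?thesis by linarith
      qed
      show "\<exists>(A :: (nat \<Rightarrow> (nat \<times> nat \<times> nat \<Rightarrow> nat) \<Rightarrow> complex) set) x.
        finite A \<and> card A = Q ^ (2 * (L * n ^ \<Gamma>)) \<and> (\<forall>a\<in>A. (cmod (x a))\<^sup>2 \<le> P) \<and>
        (\<forall>j k a b. j < K \<longrightarrow> k < J j \<longrightarrow> (\<forall>i<K. a i \<in> A) \<longrightarrow> (\<forall>i<K. b i \<in> A) \<longrightarrow> a j \<noteq> b j \<longrightarrow>
         sqrt P / (c * real Q ^ ?S)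
           \<le> cmod ((\<Sum>i<K. h (j, k, i) * x (a i)) - (\<Sum>i<K. h (j, k, i) * x (b i))))"
        using fin\<Lambda> card\<Lambda> pow dist by (intro exI[of _ \<Lambda>] exI[of _ x]) blast
    qed
  qed
qed

text \<open>Q is the largest integer for which the distance guaranteed by
  \<open>aligned_constellation\<close> is still 2 * D, where D is fixed by \<delta>. All constants
  then enter the rate only through the additive \<open>C\<close>.\<close>

lemma symmetric_rate_achievable:
  fixes h :: channel and K n :: nat and J :: "nat \<Rightarrow> nat"
  defines "M \<equiv> n ^ card (cross_index K J)" and "m \<equiv> n ^ card (cross_index K J) + (n + 1) ^ card (cross_index K J)"
  assumes K: "K \<ge> 2" and n: "n \<ge> 1"
    and dioph: "diophantine (coeff_index K J \<rightarrow>\<^sub>E {..n}) (\<lambda>e. \<Prod>p\<in>coeff_index K J. h p ^ e p)"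
  shows "\<exists>\<kappa>::nat. \<forall>L\<ge>1. \<forall>\<delta>>0. \<delta> < 1/3 \<longrightarrow> (\<exists>C. \<forall>\<^sub>F P in at_top. \<exists>R. achievable K J h P (\<lambda>_. R) \<and>
     (1 - 3 * \<delta>) * (real (L * M) / real (\<kappa> + L * m + 1)) * log 2 P - C \<le> R)"
proof -
  obtain \<kappa> where \<kappa>: "\<forall>L\<ge>1. \<exists>c>0. \<forall>Q\<ge>1. \<forall>P>0. \<exists>(A :: (nat \<Rightarrow> (nat \<times> nat \<times> nat \<Rightarrow> nat) \<Rightarrow> complex) set) x.
    finite A \<and> card A = Q ^ (2 * (L * M)) \<and> (\<forall>a\<in>A. (cmod (x a))\<^sup>2 \<le> P) \<and>
    (\<forall>j k a b. j < K \<longrightarrow> k < J j \<longrightarrow> (\<forall>i<K. a i \<in> A) \<longrightarrow> (\<forall>i<K. b i \<in> A) \<longrightarrow> a j \<noteq> b j \<longrightarrow>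
       sqrt P / (c * real Q ^ (\<kappa> + L * m + 1))
         \<le> cmod ((\<Sum>i<K. h (j, k, i) * x (a i)) - (\<Sum>i<K. h (j, k, i) * x (b i))))"
    using aligned_constellation[OF K n dioph] unfolding M_def m_def by (elim exE)
  show ?thesis
  proof (intro exI[of _ \<kappa>] allI impI)
    fix L :: nat and \<delta> :: real assume L: "1 \<le> L" and \<delta>: "0 < \<delta>" "\<delta> < 1/3"
    define S where "S = \<kappa> + L * m + 1"
    have S0: "S > 0" by (simp add: S_def)
    have M0: "M > 0" using n by (simp add: M_def)
    \<comment> \<open>Solves 2 * (4 / D^2) powr \<delta> = 1/2, as required by
      \<open>achievable_of_modulation\<close>.\<close>
    define D where "D = 2 * 4 powr (1 / (2 * \<delta>))"
    have D0: "D > 0" by (simp add: D_def)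
    have D2: "D\<^sup>2 = 4 * 4 powr (1 / \<delta>)"
      by (simp add: D_def power_mult_distrib power2_eq_square powr_add[symmetric] field_simps)
    have D4: "4 \<le> D\<^sup>2" unfolding D2 using ge_one_powr_ge_zero[of 4 "1 / \<delta>"] \<delta> by simp
    have "4 / D\<^sup>2 = 4 powr (- (1 / \<delta>))" unfolding D2 by (simp add: powr_minus field_simps)
    then have "(4 / D\<^sup>2) powr \<delta> = 4 powr (- 1)" using \<delta> by (simp only: powr_powr) simp
    then have Dp: "2 * (4 / D\<^sup>2) powr \<delta> \<le> 1 / 2" by (simp add: powr_minus)
    obtain c where c: "c > 0" and con: "\<forall>Q\<ge>1. \<forall>P>0. \<exists>(A :: (nat \<Rightarrow> (nat \<times> nat \<times> nat \<Rightarrow> nat) \<Rightarrow> complex) set) x.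
      finite A \<and> card A = Q ^ (2 * (L * M)) \<and> (\<forall>a\<in>A. (cmod (x a))\<^sup>2 \<le> P) \<and>
      (\<forall>j k a b. j < K \<longrightarrow> k < J j \<longrightarrow> (\<forall>i<K. a i \<in> A) \<longrightarrow> (\<forall>i<K. b i \<in> A) \<longrightarrow> a j \<noteq> b j \<longrightarrow>
         sqrt P / (c * real Q ^ S)
           \<le> cmod ((\<Sum>i<K. h (j, k, i) * x (a i)) - (\<Sum>i<K. h (j, k, i) * x (b i))))"
      using \<kappa>[rule_format, OF L] unfolding S_def by (elim exE conjE)
    define c2 where "c2 = 2 * D * c"
    have c2: "c2 > 0" using D0 c by (simp add: c2_def)
    define C0 where "C0 = 2 * real (L * M) * (log 2 c2 / S + 1)"
    define C where "C = (1 - 3 * \<delta>) * C0 + 1"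
    define r where "r = (1 - 3 * \<delta>) * (real (L * M) / S)"
    have r0: "r > 0" using \<delta> L M0 S0 by (simp add: r_def)
    have "filterlim (log 2) at_top at_top" by real_asymp
    \<comment> \<open>This makes the lower bound for the rate nonnegative, which
      \<open>achievable\<close> demands of \<open>R\<close>.\<close>
    then have "\<forall>\<^sub>F P in at_top. C / r \<le> log 2 P" by (simp add: filterlim_at_top)
    moreover have "\<forall>\<^sub>F P in at_top. max 1 (c2\<^sup>2) \<le> P" by (rule eventually_ge_at_top)
    ultimately have "\<forall>\<^sub>F P in at_top. \<exists>R. achievable K J h P (\<lambda>_. R) \<and> r * log 2 P - C \<le> R"
    proof eventually_elim
      case (elim P)
      have P0: "P > 0" using elim by simp
      define y where "y = (sqrt P / c2) powr (1 / S)"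
      define Q where "Q = nat \<lfloor>y\<rfloor>"
      have "c2 \<le> sqrt P" using elim(2) c2 by (intro real_le_rsqrt) simp
      then have b1: "1 \<le> sqrt P / c2" using c2 by (simp add: field_simps)
      then have y1: "1 \<le> y" unfolding y_def by (intro ge_one_powr_ge_zero) auto
      have Q1: "Q \<ge> 1" using y1 unfolding Q_def by (simp add: le_nat_iff)
      \<comment> \<open>As y \<ge> 1, rounding down loses at most a factor 2, that is one bit in log
        Q.\<close>
      have Qy: "real Q \<le> y" "y \<le> 2 * real Q"
      proof -
        have "real Q = of_int \<lfloor>y\<rfloor>" unfolding Q_def using y1 by simp
        then show "real Q \<le> y" and "y \<le> 2 * real Q" using Q1 by linarith+
      qed
      have "real Q ^ S \<le> y ^ S" using Qy by (intro power_mono) auto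
      also have "y ^ S = y powr S" using y1 by (subst powr_realpow) auto
      also have "\<dots> = sqrt P / c2"
        unfolding y_def powr_powr using b1 S0 P0 c2 by simp
      finally have QS: "real Q ^ S \<le> sqrt P / c2" .
      have dmin: "2 * D \<le> sqrt P / (c * real Q ^ S)"
      proof -
        have "2 * D * (c * real Q ^ S) = c2 * real Q ^ S" by (simp add: c2_def)
        also have "\<dots> \<le> c2 * (sqrt P / c2)" using QS c2 by (intro mult_left_mono) auto
        also have "\<dots> = sqrt P" using c2 by simp
        finally show ?thesis using c Q1 by (subst pos_le_divide_eq) auto
      qed
      obtain A and x :: "(nat \<Rightarrow> (nat \<times> nat \<times> nat \<Rightarrow> nat) \<Rightarrow> complex) \<Rightarrow> complex"
        where A: "finite A" "card A = Q ^ (2 * (L * M))" "\<forall>a\<in>A. (cmod (x a))\<^sup>2 \<le> P"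
        and sep: "\<forall>j k a b. j < K \<longrightarrow> k < J j \<longrightarrow> (\<forall>i<K. a i \<in> A) \<longrightarrow> (\<forall>i<K. b i \<in> A) \<longrightarrow> a j \<noteq> b j \<longrightarrow>
         sqrt P / (c * real Q ^ S)
           \<le> cmod ((\<Sum>i<K. h (j, k, i) * x (a i)) - (\<Sum>i<K. h (j, k, i) * x (b i)))"
        using con[rule_format, OF Q1 P0] by (elim exE conjE)
      have A0: "A \<noteq> {}" using A(2) Q1 by auto
      have "log 2 y = (1 / S) * (log 2 P / 2 - log 2 c2)"
      proof -
        have "log 2 (sqrt P) = log 2 P / 2" using P0 by (simp add: log_def ln_sqrt)
        then have "log 2 (sqrt P / c2) = log 2 P / 2 - log 2 c2" using P0 c2 by (simp add: log_divide)
        then show ?thesis unfolding y_def using b1 by (subst log_powr) auto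
      qed
      moreover have "log 2 y \<le> log 2 (2 * real Q)" using Qy y1 by simp
      moreover have "log 2 (2 * real Q) = 1 + log 2 Q" using Q1 by (simp add: log_mult)
      ultimately have lQ: "(1 / S) * (log 2 P / 2 - log 2 c2) - 1 \<le> log 2 Q" by simp
      have "(real (L * M) / S) * log 2 P - C0 = 2 * real (L * M) * ((1 / S) * (log 2 P / 2 - log 2 c2) - 1)"
        by (simp add: C0_def algebra_simps add_divide_distrib diff_divide_distrib)
      also have "\<dots> \<le> 2 * real (L * M) * log 2 Q" using lQ by (intro mult_left_mono) auto
      also have "\<dots> = log 2 (card A)" using Q1 by (simp add: A(2) log_nat_power)
      finally have lA: "(real (L * M) / S) * log 2 P - C0 \<le> log 2 (card A)" .
      define R where "R = (1 - 3 * \<delta>) * log 2 (card A) - 1"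
      have "(1 - 3 * \<delta>) * ((real (L * M) / S) * log 2 P - C0) \<le> (1 - 3 * \<delta>) * log 2 (card A)"
        using lA \<delta> by (intro mult_left_mono) auto
      then have Rge: "r * log 2 P - C \<le> R"
        by (simp add: R_def C_def r_def right_diff_distrib mult.assoc)
      moreover have "0 \<le> r * log 2 P - C" using elim(1) r0 by (simp add: field_simps)
      ultimately have "0 \<le> R" by linarith
      then have "achievable K J h P (\<lambda>_. R)"
      proof (intro achievable_of_modulation[OF A(1) A0 \<delta>(1) D0 D4 Dp])
        show "(cmod (x a))\<^sup>2 \<le> P" if "a \<in> A" for a using A(3) that by blast
        show "2 * D \<le> cmod ((\<Sum>i<K. h (j, k, i) * x (a i)) - (\<Sum>i<K. h (j, k, i) * x (b i)))"
          if "j < K" "k < J j" "\<And>i. i < K \<Longrightarrow> a i \<in> A" "\<And>i. i < K \<Longrightarrow> b i \<in> A" "a j \<noteq> b j" for j k a b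
          using that by (intro order_trans[OF dmin] sep[rule_format]) auto
      qed (simp_all add: R_def)
      then show ?case using Rge by blast
    qed
    then show "\<exists>C. \<forall>\<^sub>F P in at_top. \<exists>R. achievable K J h P (\<lambda>_. R) \<and>
      (1 - 3 * \<delta>) * (real (L * M) / real (\<kappa> + L * m + 1)) * log 2 P - C \<le> R"
      unfolding r_def S_def by blast
  qed
qed

text \<open>
  The rate per user is about \<open>L * M / (\<kappa> + L * m + 1)\<close> times \<open>log 2 P\<close>.  Since \<open>\<kappa>\<close> depends on \<open>n\<close> but not on \<open>L\<close>, one lets
  first \<open>L\<close> and then \<open>n\<close> grow.
\<close>

lemma sum_capacity_lower_bound:
  fixes h :: channel and K :: nat and J :: "nat \<Rightarrow> nat" and t :: real
  assumes K: "K \<ge> 2"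
    and dioph: "\<And>n. diophantine (coeff_index K J \<rightarrow>\<^sub>E {..n}) (\<lambda>e. \<Prod>p\<in>coeff_index K J. h p ^ e p)"
    and t: "t < real K / 2"
  shows "\<forall>\<^sub>F P in at_top. ereal t < sum_capacity K J h P / ereal (log 2 P)"
proof -
  define \<Gamma> where "\<Gamma> = card (cross_index K J)"
  have "(\<lambda>n. real K * (real n ^ \<Gamma> / (real n ^ \<Gamma> + (real n + 1) ^ \<Gamma>))) \<longlonglongrightarrow> real K / 2"
  proof -
    have "(\<lambda>n. 1 + 1 / real n) \<longlonglongrightarrow> 1" by real_asymp
    from tendsto_power[OF this, of \<Gamma>]
    have "(\<lambda>n. real K * (1 / (1 + (1 + 1 / real n) ^ \<Gamma>))) \<longlonglongrightarrow> real K * (1 / (1 + 1 ^ \<Gamma>))"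
      by (intro tendsto_mult tendsto_divide tendsto_add tendsto_const) auto
    moreover have "\<forall>\<^sub>F n in sequentially. real K * (1 / (1 + (1 + 1 / real n) ^ \<Gamma>)) = real K * (real n ^ \<Gamma> / (real n ^ \<Gamma> + (real n + 1) ^ \<Gamma>))"
      using eventually_gt_at_top[of 0]
    proof eventually_elim
      case (elim n)
      have "(real n + 1) ^ \<Gamma> = real n ^ \<Gamma> * (1 + 1 / real n) ^ \<Gamma>"
        using elim by (simp add: field_simps flip: power_mult_distrib)
      then have "real n ^ \<Gamma> + (real n + 1) ^ \<Gamma> = real n ^ \<Gamma> * (1 + (1 + 1 / real n) ^ \<Gamma>)"
        by (simp add: algebra_simps)
      then show ?case using elim by simp
    qed
    ultimately show ?thesis by (simp add: filterlim_cong)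
  qed
  then have "\<forall>\<^sub>F n in sequentially. t < real K * (real n ^ \<Gamma> / (real n ^ \<Gamma> + (real n + 1) ^ \<Gamma>))"
    using t by (rule order_tendstoD)
  then have "\<forall>\<^sub>F n in sequentially. t < real K * (real n ^ \<Gamma> / (real n ^ \<Gamma> + (real n + 1) ^ \<Gamma>)) \<and> n \<ge> 1"
    using eventually_ge_at_top by (rule eventually_conj)
  then obtain n where n: "t < real K * (real n ^ \<Gamma> / (real n ^ \<Gamma> + (real n + 1) ^ \<Gamma>))" "n \<ge> 1"
    by (auto simp: eventually_sequentially)
  define M where "M = n ^ \<Gamma>"
  define m where "m = n ^ \<Gamma> + (n + 1) ^ \<Gamma>"
  have tn: "t < real K * (real M / real m)" using n(1) by (simp add: M_def m_def add_ac)
  have m0: "m > 0" using n by (simp add: m_def)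
  obtain \<kappa> :: nat where \<kappa>: "\<forall>L\<ge>1. \<forall>\<delta>>0. \<delta> < 1/3 \<longrightarrow> (\<exists>C. \<forall>\<^sub>F P in at_top. \<exists>R. achievable K J h P (\<lambda>_. R) \<and>
     (1 - 3 * \<delta>) * (real (L * M) / real (\<kappa> + L * m + 1)) * log 2 P - C \<le> R)"
    using symmetric_rate_achievable[OF K n(2) dioph] unfolding M_def m_def \<Gamma>_def by (elim exE)
  have "(\<lambda>L. real K * (real M / ((real \<kappa> + 1) / real L + real m))) \<longlonglongrightarrow> real K * (real M / (0 + real m))"
    using m0 by (intro tendsto_intros) (auto intro: lim_const_over_n)
  then have "\<forall>\<^sub>F L in sequentially. t < real K * (real M / ((real \<kappa> + 1) / real L + real m))"
    using tn by (intro order_tendstoD) auto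
  then have "\<forall>\<^sub>F L in sequentially. t < real K * (real M / ((real \<kappa> + 1) / real L + real m)) \<and> L \<ge> 1"
    using eventually_ge_at_top by (rule eventually_conj)
  then obtain L where L: "t < real K * (real M / ((real \<kappa> + 1) / real L + real m))" "L \<ge> 1"
    by (auto simp: eventually_sequentially)
  define \<rho> where "\<rho> = real (L * M) / real (\<kappa> + L * m + 1)"
  have "real M / ((real \<kappa> + 1) / real L + real m) = \<rho>"
    using L(2) by (simp add: \<rho>_def field_simps)
  then have tL: "t < real K * \<rho>" using L(1) by simp
  \<comment> \<open>The loss 3 * \<delta> of the outer code is made negligible last, with n and L
    already fixed.\<close>
  have "((\<lambda>\<delta>. real K * ((1 - 3 * \<delta>) * \<rho>)) \<longlongrightarrow> real K * ((1 - 3 * 0) * \<rho>)) (at_right 0)"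
    by (intro tendsto_intros)
  then have "\<forall>\<^sub>F \<delta> in at_right 0. t < real K * ((1 - 3 * \<delta>) * \<rho>)"
    using tL by (intro order_tendstoD) auto
  moreover have "\<forall>\<^sub>F \<delta> in at_right (0::real). \<delta> \<in> {0<..<1/3}"
    by (rule eventually_at_right_real) simp
  ultimately have "\<forall>\<^sub>F \<delta> in at_right 0. t < real K * ((1 - 3 * \<delta>) * \<rho>) \<and> \<delta> \<in> {0<..<1/3}"
    by (rule eventually_conj)
  then obtain \<delta> where \<delta>: "t < real K * ((1 - 3 * \<delta>) * \<rho>)" "0 < \<delta>" "\<delta> < 1/3"
    using eventually_happens'[OF trivial_limit_at_right_real] by fastforce
  define r where "r = (1 - 3 * \<delta>) * \<rho>"
  obtain C where C: "\<forall>\<^sub>F P in at_top. \<exists>R. achievable K J h P (\<lambda>_. R) \<and> r * log 2 P - C \<le> R"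
    using \<kappa>[rule_format, OF L(2) \<delta>(2,3)] unfolding r_def \<rho>_def by (elim exE)
  have lim: "filterlim (log 2) at_top at_top" by real_asymp
  have "\<forall>\<^sub>F P in at_top. max 1 (K * C / (K * r - t) + 1) \<le> log 2 P"
    using lim by (simp only: filterlim_at_top)
  with C show ?thesis
  proof eventually_elim
    case (elim P)
    then obtain R where R: "achievable K J h P (\<lambda>_. R)" "r * log 2 P - C \<le> R" by blast
    have lP: "log 2 P > 0" using elim(2) by simp
    have d0: "K * r - t > 0" using \<delta>(1) by (simp add: r_def)
    have "K * C / (K * r - t) < log 2 P" using elim(2) by simp
    then have "K * C < log 2 P * (K * r - t)" using d0 by (simp add: field_simps)
    then have "t * log 2 P < K * (r * log 2 P - C)" by (simp add: algebra_simps)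
    also have "\<dots> \<le> K * R" using R(2) by (intro mult_left_mono) auto
    finally have "t < K * R / log 2 P" using lP by (simp add: field_simps)
    then have "ereal t < ereal (K * R) / ereal (log 2 P)" using lP by simp
    also have "ereal (K * R) \<le> sum_capacity K J h P"
      unfolding sum_capacity_def using R(1) by (intro SUP_upper2[of "\<lambda>_. R"]) auto
    then have "ereal (K * R) / ereal (log 2 P) \<le> sum_capacity K J h P / ereal (log 2 P)"
      using lP by (intro ereal_divide_right_mono) auto
    finally show ?case .
  qed
qed

section \<open>Auxiliary measures for the converse\<close>

text \<open>Passes from the degradation of single samples to that of whole blocks.\<close>

lemma distr_PiM_maps:
  assumes I: "finite I" and M: "\<And>i. prob_space (M i)" and M': "\<And>i. prob_space (M' i)"
    and f: "\<And>i. f i \<in> measurable (M i) (M' i)" and eq: "\<And>i. distr (M i) (M' i) (f i) = M' i"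
  shows "distr (PiM I M) (PiM I M') (\<lambda>\<omega>. \<lambda>i\<in>I. f i (\<omega> i)) = PiM I M'"
proof -
  interpret M: product_prob_space M using M by (rule product_prob_spaceI)
  interpret M': product_prob_space M' using M' by (rule product_prob_spaceI)
  have meas: "(\<lambda>\<omega>. \<lambda>i\<in>I. f i (\<omega> i)) \<in> measurable (PiM I M) (PiM I M')"
  proof (rule measurable_restrict)
    fix i assume "i \<in> I"
    then show "(\<lambda>\<omega>. f i (\<omega> i)) \<in> measurable (PiM I M) (M' i)"
      by (intro measurable_compose[where N = "M i" and f = "\<lambda>\<omega>. \<omega> i" and g = "f i"] measurable_component_singleton f)
  qed
  show ?thesis
  proof (rule M'.PiM_eqI[OF I])
    fix A assume A: "\<And>i. i \<in> I \<Longrightarrow> A i \<in> sets (M' i)"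
    have "emeasure (distr (PiM I M) (PiM I M') (\<lambda>\<omega>. \<lambda>i\<in>I. f i (\<omega> i))) (Pi\<^sub>E I A)
       = emeasure (PiM I M) ((\<lambda>\<omega>. \<lambda>i\<in>I. f i (\<omega> i)) -` Pi\<^sub>E I A \<inter> space (PiM I M))"
      using A by (intro emeasure_distr meas sets_PiM_I_finite I) auto
    also have "(\<lambda>\<omega>. \<lambda>i\<in>I. f i (\<omega> i)) -` Pi\<^sub>E I A \<inter> space (PiM I M) = (\<Pi>\<^sub>E i\<in>I. f i -` A i \<inter> space (M i))"
      by (auto simp: space_PiM PiE_iff)
    also have "emeasure (PiM I M) \<dots> = (\<Prod>i\<in>I. emeasure (M i) (f i -` A i \<inter> space (M i)))"
      using A by (intro M.emeasure_PiM I measurable_sets[OF f]) auto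
    also have "\<dots> = (\<Prod>i\<in>I. emeasure (distr (M i) (M' i) (f i)) (A i))"
      using A by (intro prod.cong emeasure_distr[symmetric] f) auto
    also have "\<dots> = (\<Prod>i\<in>I. emeasure (M' i) (A i))" by (simp only: eq)
    finally show "emeasure (distr (PiM I M) (PiM I M') (\<lambda>\<omega>. \<lambda>i\<in>I. f i (\<omega> i))) (Pi\<^sub>E I A) = (\<Prod>i\<in>I. emeasure (M' i) (A i))" .
  qed simp
qed

lemma PiM_density:
  assumes I: "finite I" and N: "\<And>i. sigma_finite_measure (N i)" and M: "\<And>i. sigma_finite_measure (density (N i) (f i))"
    and f[measurable]: "\<And>i. f i \<in> borel_measurable (N i)"
  shows "PiM I (\<lambda>i. density (N i) (f i)) = density (PiM I N) (\<lambda>\<omega>. \<Prod>i\<in>I. f i (\<omega> i))"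
proof -
  interpret N: product_sigma_finite N using N by (rule product_sigma_finite.intro)
  interpret M: product_sigma_finite "\<lambda>i. density (N i) (f i)" using M by (rule product_sigma_finite.intro)
  have meas[measurable]: "(\<lambda>\<omega>. \<Prod>i\<in>I. f i (\<omega> i)) \<in> borel_measurable (PiM I N)"
  proof (rule borel_measurable_prod_ennreal)
    fix i assume "i \<in> I"
    then show "(\<lambda>\<omega>. f i (\<omega> i)) \<in> borel_measurable (PiM I N)"
      by (intro measurable_compose[where N = "N i" and f = "\<lambda>\<omega>. \<omega> i" and g = "f i"] measurable_component_singleton f)
  qed
  have "density (PiM I N) (\<lambda>\<omega>. \<Prod>i\<in>I. f i (\<omega> i)) = PiM I (\<lambda>i. density (N i) (f i))"
  proof (rule M.PiM_eqI[OF I])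
    show "sets (density (PiM I N) (\<lambda>\<omega>. \<Prod>i\<in>I. f i (\<omega> i))) = sets (PiM I (\<lambda>i. density (N i) (f i)))"
      by (simp, intro sets_PiM_cong) auto
    fix A assume "\<And>i. i \<in> I \<Longrightarrow> A i \<in> sets (density (N i) (f i))"
    then have A: "\<And>i. i \<in> I \<Longrightarrow> A i \<in> sets (N i)" by simp
    have "emeasure (density (PiM I N) (\<lambda>\<omega>. \<Prod>i\<in>I. f i (\<omega> i))) (Pi\<^sub>E I A)
       = (\<integral>\<^sup>+\<omega>. (\<Prod>i\<in>I. f i (\<omega> i)) * indicator (Pi\<^sub>E I A) \<omega> \<partial>PiM I N)"
      using A by (intro emeasure_density meas sets_PiM_I_finite I) auto
    also have "\<dots> = (\<integral>\<^sup>+\<omega>. (\<Prod>i\<in>I. f i (\<omega> i) * indicator (A i) (\<omega> i)) \<partial>PiM I N)"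
    proof (intro nn_integral_cong)
      fix \<omega> assume \<omega>: "\<omega> \<in> space (PiM I N)"
      have "indicator (Pi\<^sub>E I A) \<omega> = (\<Prod>i\<in>I. indicator (A i) (\<omega> i) :: ennreal)"
      proof (cases "\<forall>i\<in>I. \<omega> i \<in> A i")
        case True
        then show ?thesis using \<omega> by (simp add: space_PiM PiE_iff)
      next
        case False
        then have "\<exists>i\<in>I. indicator (A i) (\<omega> i) = (0 :: ennreal)" by (auto simp: indicator_eq_0_iff)
        then have "(\<Prod>i\<in>I. indicator (A i) (\<omega> i) :: ennreal) = 0" by (rule prod_zero[OF I])
        then show ?thesis using False by (auto simp: indicator_def PiE_iff)
      qed
      then show "(\<Prod>i\<in>I. f i (\<omega> i)) * indicator (Pi\<^sub>E I A) \<omega> = (\<Prod>i\<in>I. f i (\<omega> i) * indicator (A i) (\<omega> i))"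
        by (simp add: prod.distrib)
    qed
    also have "\<dots> = (\<Prod>i\<in>I. \<integral>\<^sup>+x. f i x * indicator (A i) x \<partial>N i)"
      using A by (intro N.product_nn_integral_prod I) auto
    also have "\<dots> = (\<Prod>i\<in>I. emeasure (density (N i) (f i)) (A i))"
      using A by (intro prod.cong emeasure_density[symmetric] f) auto
    finally show "emeasure (density (PiM I N) (\<lambda>\<omega>. \<Prod>i\<in>I. f i (\<omega> i))) (Pi\<^sub>E I A) = (\<Prod>i\<in>I. emeasure (density (N i) (f i)) (A i))" .
  qed
  then show ?thesis ..
qed

text \<open>
  The law of \<open>(y, m, m')\<close>: an observation \<open>y\<close> of \<open>c\<close> in noise of variance \<open>v\<close>, and two independent noise samples
  with which \<open>y\<close> is degraded to the outputs of the two receivers.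
\<close>

definition triple_law :: "complex \<Rightarrow> real \<Rightarrow> (complex \<times> complex \<times> complex) measure" where
  "triple_law c v = gauss c v \<Otimes>\<^sub>M (complex_noise \<Otimes>\<^sub>M complex_noise)"

lemma sets_triple_law [measurable_cong, simp]: "sets (triple_law c v) = sets (borel \<Otimes>\<^sub>M (borel \<Otimes>\<^sub>M borel))"
  unfolding triple_law_def by (intro sets_pair_measure_cong) simp_all

lemma space_triple_law [simp]: "space (triple_law c v) = UNIV"
  by (simp add: triple_law_def space_pair_measure)

lemma prob_space_triple_law: "v > 0 \<Longrightarrow> prob_space (triple_law c v)"
  unfolding triple_law_def
  by (intro prob_space_pair prob_space_gauss prob_space_complex_noise)

lemma nn_integral_gauss:
  assumes \<sigma>: "\<sigma> > 0" and [measurable]: "g \<in> borel_measurable borel"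
  shows "(\<integral>\<^sup>+y. g y \<partial>gauss c (\<sigma>\<^sup>2)) = (\<integral>\<^sup>+x. g (c + \<sigma> *\<^sub>R x) \<partial>complex_noise)"
  unfolding distr_complex_noise_affine[OF \<sigma>, symmetric] by (subst nn_integral_distr) auto

lemma distr_complex_noise_pair_snd: "distr (complex_noise \<Otimes>\<^sub>M complex_noise) complex_noise snd = complex_noise"
proof (rule measure_eqI)
  interpret N: prob_space complex_noise by (rule prob_space_complex_noise)
  fix A assume A: "A \<in> sets (distr (complex_noise \<Otimes>\<^sub>M complex_noise) complex_noise snd)"
  have "snd -` A \<inter> space (complex_noise \<Otimes>\<^sub>M complex_noise) = UNIV \<times> A"
    by (auto simp: space_pair_measure)
  then have "emeasure (distr (complex_noise \<Otimes>\<^sub>M complex_noise) complex_noise snd) A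
      = emeasure (complex_noise \<Otimes>\<^sub>M complex_noise) (UNIV \<times> A)"
    using A by (subst emeasure_distr) simp_all
  also have "\<dots> = emeasure complex_noise UNIV * emeasure complex_noise A"
    using A by (intro N.emeasure_pair_measure_Times) simp_all
  finally show "emeasure (distr (complex_noise \<Otimes>\<^sub>M complex_noise) complex_noise snd) A = emeasure complex_noise A"
    using N.emeasure_space_1 by simp
qed simp

text \<open>The term \<open>a * (y - c)\<close> has variance (cmod a * \<sigma>)^2, and a spare
  sample supplies the missing \<open>b\<^sup>2\<close>. The parameter \<pi> selects the spare
  sample, so that both receivers are treated at once.\<close>

lemma distr_triple_law:
  assumes \<sigma>: "\<sigma> > 0" and b: "b > 0" and ab: "(cmod a * \<sigma>)\<^sup>2 + b\<^sup>2 = 1"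
    and \<pi>[measurable]: "\<pi> \<in> borel_measurable (borel \<Otimes>\<^sub>M borel)"
    and \<pi>_law: "distr (complex_noise \<Otimes>\<^sub>M complex_noise) complex_noise \<pi> = complex_noise"
  shows "distr (triple_law c (\<sigma>\<^sup>2)) complex_noise (\<lambda>\<omega>. a * (fst \<omega> - c) + b *\<^sub>R \<pi> (snd \<omega>)) = complex_noise" (is "?D = _")
proof (rule measure_eqI)
  interpret N: prob_space complex_noise by (rule prob_space_complex_noise)
  interpret NN: prob_space "complex_noise \<Otimes>\<^sub>M complex_noise"
    by (intro prob_space_pair prob_space_complex_noise)
  have 1: "(cmod (a * of_real \<sigma>))\<^sup>2 + b\<^sup>2 = 1" using ab \<sigma> by (simp add: norm_mult)
  let ?C = "distr (complex_noise \<Otimes>\<^sub>M complex_noise) borel (\<lambda>(x, y). a * of_real \<sigma> * x + b *\<^sub>R y)"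
  fix A assume "A \<in> sets ?D"
  then have [measurable]: "A \<in> sets borel" by simp
  have "emeasure ?D A = (\<integral>\<^sup>+y. indicator A y \<partial>?D)" by (rule nn_integral_indicator[symmetric]) simp
  also have "\<dots> = (\<integral>\<^sup>+\<omega>. indicator A (a * (fst \<omega> - c) + b *\<^sub>R \<pi> (snd \<omega>)) \<partial>triple_law c (\<sigma>\<^sup>2))"
    unfolding triple_law_def by (subst nn_integral_distr) auto
  also have "\<dots> = (\<integral>\<^sup>+y. (\<integral>\<^sup>+p. indicator A (a * (y - c) + b *\<^sub>R \<pi> p) \<partial>(complex_noise \<Otimes>\<^sub>M complex_noise)) \<partial>gauss c (\<sigma>\<^sup>2))"
    unfolding triple_law_def by (subst NN.nn_integral_fst[symmetric]) auto
  also have "\<dots> = (\<integral>\<^sup>+y. (\<integral>\<^sup>+m. indicator A (a * (y - c) + b *\<^sub>R m) \<partial>distr (complex_noise \<Otimes>\<^sub>M complex_noise) complex_noise \<pi>) \<partial>gauss c (\<sigma>\<^sup>2))"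
    by (intro nn_integral_cong, subst nn_integral_distr) auto
  also have "\<dots> = (\<integral>\<^sup>+y. (\<integral>\<^sup>+m. indicator A (a * (y - c) + b *\<^sub>R m) \<partial>complex_noise) \<partial>gauss c (\<sigma>\<^sup>2))"
    by (simp only: \<pi>_law)
  also have "\<dots> = (\<integral>\<^sup>+x. (\<integral>\<^sup>+m. indicator A (a * (c + \<sigma> *\<^sub>R x - c) + b *\<^sub>R m) \<partial>complex_noise) \<partial>complex_noise)"
    by (rule nn_integral_gauss[OF \<sigma>]) measurable
  also have "\<dots> = (\<integral>\<^sup>+x. (\<integral>\<^sup>+m. indicator A (a * of_real \<sigma> * x + b *\<^sub>R m) \<partial>complex_noise) \<partial>complex_noise)"
    by (simp add: scaleR_conv_of_real mult.assoc)
  also have "\<dots> = (\<integral>\<^sup>+p. indicator A (a * of_real \<sigma> * fst p + b *\<^sub>R snd p) \<partial>(complex_noise \<Otimes>\<^sub>M complex_noise))"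
    by (subst N.nn_integral_fst[symmetric]) auto
  also have "\<dots> = (\<integral>\<^sup>+y. indicator A y \<partial>?C)" by (subst nn_integral_distr) (auto simp: split_beta')
  also have "\<dots> = emeasure ?C A" by (rule nn_integral_indicator) simp
  also have "\<dots> = emeasure complex_noise A" unfolding complex_noise_combine[OF 1 b] ..
  finally show "emeasure ?D A = emeasure complex_noise A" .
qed simp

text \<open>The likelihood ratio of \<open>gauss c v\<close> to \<open>gauss 0 s\<close>.\<close>

definition gauss_ratio :: "complex \<Rightarrow> real \<Rightarrow> real \<Rightarrow> complex \<Rightarrow> real" where
  "gauss_ratio c v s y = s / v * exp ((cmod y)\<^sup>2 / s - (cmod (y - c))\<^sup>2 / v)"

lemma borel_measurable_gauss_ratio [measurable]: "gauss_ratio c v s \<in> borel_measurable borel"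
  unfolding gauss_ratio_def by measurable

lemma gauss_eq_density:
  assumes "s > 0" "v > 0"
  shows "gauss c v = density (gauss 0 s) (\<lambda>y. ennreal (gauss_ratio c v s y))"
proof -
  have "density (gauss 0 s) (\<lambda>y. ennreal (gauss_ratio c v s y))
    = density lborel (\<lambda>y. ennreal (exp (- (cmod (y - 0))\<^sup>2 / s) / (pi * s)) * ennreal (gauss_ratio c v s y))"
    unfolding gauss_def by (rule density_density_eq) measurable
  also have "(\<lambda>y. ennreal (exp (- (cmod (y - 0))\<^sup>2 / s) / (pi * s)) * ennreal (gauss_ratio c v s y))
    = (\<lambda>y. ennreal (exp (- (cmod (y - c))\<^sup>2 / v) / (pi * v)))"
  proof
    fix y
    have "exp (- (cmod (y - 0))\<^sup>2 / s) * exp ((cmod y)\<^sup>2 / s - (cmod (y - c))\<^sup>2 / v) = exp (- (cmod (y - c))\<^sup>2 / v)"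
      unfolding exp_add[symmetric] by (simp add: algebra_simps)
    then have "exp (- (cmod (y - 0))\<^sup>2 / s) / (pi * s) * gauss_ratio c v s y = exp (- (cmod (y - c))\<^sup>2 / v) / (pi * v)"
      using assms unfolding gauss_ratio_def by (simp add: field_simps)
    then show "ennreal (exp (- (cmod (y - 0))\<^sup>2 / s) / (pi * s)) * ennreal (gauss_ratio c v s y) = ennreal (exp (- (cmod (y - c))\<^sup>2 / v) / (pi * v))"
      using assms by (subst ennreal_mult[symmetric]) (auto simp: gauss_ratio_def)
  qed
  finally show ?thesis by (simp add: gauss_def)
qed

lemma triple_law_eq_density:
  assumes "s > 0" "v > 0"
  shows "triple_law c v = density (triple_law 0 s) (\<lambda>\<omega>. ennreal (gauss_ratio c v s (fst \<omega>)))"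
proof -
  interpret NN: prob_space "complex_noise \<Otimes>\<^sub>M complex_noise"
    by (intro prob_space_pair prob_space_complex_noise)
  let ?NN = "complex_noise \<Otimes>\<^sub>M complex_noise"
  have "triple_law c v = density (gauss 0 s) (\<lambda>y. ennreal (gauss_ratio c v s y)) \<Otimes>\<^sub>M density ?NN (\<lambda>_. 1)"
    unfolding triple_law_def by (simp add: gauss_eq_density[OF assms, symmetric] density_1)
  also have "\<dots> = density (gauss 0 s \<Otimes>\<^sub>M ?NN) (\<lambda>(x, y). ennreal (gauss_ratio c v s x) * 1)"
  proof (rule pair_measure_density)
    show "sigma_finite_measure ?NN" ..
    show "sigma_finite_measure (density ?NN (\<lambda>_. 1))" unfolding density_1 ..
  qed measurable
  finally show ?thesis by (simp add: triple_law_def split_beta')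
qed

definition block_law :: "nat \<Rightarrow> (nat \<Rightarrow> complex) \<Rightarrow> real \<Rightarrow> (nat \<Rightarrow> complex \<times> complex \<times> complex) measure" where
  "block_law n c v = (\<Pi>\<^sub>M t\<in>{..<n}. triple_law (c t) v)"

lemma sets_block_law [measurable_cong, simp]: "sets (block_law n c v) = sets (\<Pi>\<^sub>M t\<in>{..<n}. borel \<Otimes>\<^sub>M (borel \<Otimes>\<^sub>M borel))"
  unfolding block_law_def by (intro sets_PiM_cong) auto

lemma prob_space_block_law: "v > 0 \<Longrightarrow> prob_space (block_law n c v)"
  unfolding block_law_def by (intro prob_space_PiM prob_space_triple_law)

text \<open>
  A change of measure to a law that does not depend on the codeword \<open>c\<close>; it replaces the volume comparison of a
  sphere packing argument.
\<close>

lemma emeasure_block_law_le: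
  assumes s: "s > 0" and v: "v > 0" and E[measurable]: "E \<in> sets (\<Pi>\<^sub>M t\<in>{..<n}. borel \<Otimes>\<^sub>M (borel \<Otimes>\<^sub>M borel))"
    and small: "\<And>\<omega>. \<omega> \<in> E \<Longrightarrow> (\<Sum>t<n. (cmod (fst (\<omega> t)))\<^sup>2) \<le> r * real n * s"
  shows "emeasure (block_law n c v) E \<le> ennreal ((s / v * exp r) ^ n) * emeasure (block_law n (\<lambda>_. 0) s) E"
proof -
  let ?f = "\<lambda>t \<omega>. ennreal (gauss_ratio (c t) v s (fst \<omega>))"
  have "block_law n c v = (\<Pi>\<^sub>M t\<in>{..<n}. density (triple_law 0 s) (?f t))"
    unfolding block_law_def by (simp add: triple_law_eq_density[OF s v])
  also have "\<dots> = density (\<Pi>\<^sub>M t\<in>{..<n}. triple_law 0 s) (\<lambda>\<omega>. \<Prod>t<n. ?f t (\<omega> t))"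
  proof (rule PiM_density)
    show "sigma_finite_measure (triple_law 0 s)"
      using prob_space_triple_law[OF s] by (rule prob_space_imp_sigma_finite)
    show "sigma_finite_measure (density (triple_law 0 s) (?f t))" for t
      unfolding triple_law_eq_density[OF s v, symmetric]
      using prob_space_triple_law[OF v] by (rule prob_space_imp_sigma_finite)
  qed (simp, measurable)
  finally have eq: "block_law n c v = density (block_law n (\<lambda>_. 0) s) (\<lambda>\<omega>. \<Prod>t<n. ?f t (\<omega> t))"
    by (simp add: block_law_def)
  have "emeasure (block_law n c v) E = (\<integral>\<^sup>+\<omega>. (\<Prod>t<n. ?f t (\<omega> t)) * indicator E \<omega> \<partial>block_law n (\<lambda>_. 0) s)"
    unfolding eq by (subst emeasure_density) (simp_all add: E, measurable)
  also have "\<dots> \<le> (\<integral>\<^sup>+\<omega>. ennreal ((s / v * exp r) ^ n) * indicator E \<omega> \<partial>block_law n (\<lambda>_. 0) s)"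
  proof (intro nn_integral_mono)
    fix \<omega>
    show "(\<Prod>t<n. ?f t (\<omega> t)) * indicator E \<omega> \<le> ennreal ((s / v * exp r) ^ n) * indicator E \<omega>"
    proof (cases "\<omega> \<in> E")
      case True
      have "(\<Prod>t<n. ?f t (\<omega> t)) = ennreal (\<Prod>t<n. gauss_ratio (c t) v s (fst (\<omega> t)))"
        using s v by (intro prod_ennreal) (auto simp: gauss_ratio_def)
      also have "\<dots> \<le> ennreal ((s / v * exp r) ^ n)"
      proof (rule ennreal_leI)
        \<comment> \<open>Dropping the negative term of the exponent removes \<open>c\<close>; what
          remains depends only on the received energy.\<close>
        have "(\<Prod>t<n. gauss_ratio (c t) v s (fst (\<omega> t))) \<le> (\<Prod>t<n. s / v * exp ((cmod (fst (\<omega> t)))\<^sup>2 / s))"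
          using s v by (intro prod_mono) (auto simp: gauss_ratio_def intro!: mult_left_mono divide_right_mono)
        also have "\<dots> = (s / v) ^ n * exp ((\<Sum>t<n. (cmod (fst (\<omega> t)))\<^sup>2) / s)"
          unfolding prod.distrib by (simp add: exp_sum sum_divide_distrib)
        also have "\<dots> \<le> (s / v) ^ n * exp (n * r)"
          using s v small[OF True] by (intro mult_left_mono) (auto simp: field_simps)
        also have "\<dots> = (s / v * exp r) ^ n" by (simp only: power_mult_distrib exp_of_nat_mult)
        finally show "(\<Prod>t<n. gauss_ratio (c t) v s (fst (\<omega> t))) \<le> (s / v * exp r) ^ n" .
      qed
      finally show ?thesis using True by simp
    qed simp
  qed
  also have "\<dots> = ennreal ((s / v * exp r) ^ n) * emeasure (block_law n (\<lambda>_. 0) s) E"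
    by (subst nn_integral_cmult_indicator) (simp_all add: E)
  finally show ?thesis .
qed

lemma gauss_second_moment:
  assumes \<sigma>: "\<sigma> > 0"
  shows "(\<integral>\<^sup>+y. ennreal ((cmod y)\<^sup>2) \<partial>gauss c (\<sigma>\<^sup>2)) \<le> ennreal (2 * (cmod c)\<^sup>2 + 8 * \<sigma>\<^sup>2)"
proof -
  interpret N: prob_space complex_noise by (rule prob_space_complex_noise)
  have "(\<integral>\<^sup>+y. ennreal ((cmod y)\<^sup>2) \<partial>gauss c (\<sigma>\<^sup>2)) = (\<integral>\<^sup>+x. ennreal ((cmod (c + \<sigma> *\<^sub>R x))\<^sup>2) \<partial>complex_noise)"
    by (rule nn_integral_gauss[OF \<sigma>]) measurable
  also have "\<dots> \<le> (\<integral>\<^sup>+x. ennreal (2 * (cmod c)\<^sup>2) + ennreal (2 * \<sigma>\<^sup>2) * ennreal ((cmod x)\<^sup>2) \<partial>complex_noise)"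
  proof (intro nn_integral_mono)
    fix x
    have "(cmod (c + \<sigma> *\<^sub>R x))\<^sup>2 \<le> (cmod c + \<sigma> * cmod x)\<^sup>2"
      using norm_triangle_ineq[of c "\<sigma> *\<^sub>R x"] \<sigma> by (intro power_mono) auto
    also have "\<dots> \<le> 2 * (cmod c)\<^sup>2 + 2 * \<sigma>\<^sup>2 * (cmod x)\<^sup>2"
      using sum_squares_bound[of "cmod c" "\<sigma> * cmod x"] by (simp add: power2_sum power_mult_distrib algebra_simps)
    finally have "ennreal ((cmod (c + \<sigma> *\<^sub>R x))\<^sup>2) \<le> ennreal (2 * (cmod c)\<^sup>2 + 2 * \<sigma>\<^sup>2 * (cmod x)\<^sup>2)" by (rule ennreal_leI)
    also have "\<dots> = ennreal (2 * (cmod c)\<^sup>2) + ennreal (2 * \<sigma>\<^sup>2) * ennreal ((cmod x)\<^sup>2)"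
      by (subst ennreal_plus, simp, simp, subst ennreal_mult) auto
    finally show "ennreal ((cmod (c + \<sigma> *\<^sub>R x))\<^sup>2) \<le> ennreal (2 * (cmod c)\<^sup>2) + ennreal (2 * \<sigma>\<^sup>2) * ennreal ((cmod x)\<^sup>2)" .
  qed
  also have "\<dots> = ennreal (2 * (cmod c)\<^sup>2) + ennreal (2 * \<sigma>\<^sup>2) * (\<integral>\<^sup>+x. ennreal ((cmod x)\<^sup>2) \<partial>complex_noise)"
    using N.emeasure_space_1 by (subst nn_integral_add) (auto simp: nn_integral_cmult)
  also have "\<dots> \<le> ennreal (2 * (cmod c)\<^sup>2) + ennreal (2 * \<sigma>\<^sup>2) * ennreal 4"
    using complex_noise_second_moment by (intro add_left_mono mult_left_mono) auto
  also have "\<dots> = ennreal (2 * (cmod c)\<^sup>2 + 8 * \<sigma>\<^sup>2)"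
    by (subst ennreal_mult[symmetric], simp, simp, subst ennreal_plus[symmetric]) (auto simp: algebra_simps)
  finally show ?thesis .
qed

text \<open>Markov's inequality. It controls the outputs of large energy, about which
  \<open>emeasure_block_law_le\<close> says nothing.\<close>

lemma block_law_energy_tail:
  assumes \<sigma>: "\<sigma> > 0" and r: "r > 0"
  shows "measure (block_law n c (\<sigma>\<^sup>2)) {\<omega> \<in> space (block_law n c (\<sigma>\<^sup>2)). r < (\<Sum>t<n. (cmod (fst (\<omega> t)))\<^sup>2)}
    \<le> (2 * (\<Sum>t<n. (cmod (c t))\<^sup>2) + 8 * \<sigma>\<^sup>2 * real n) / r"
proof -
  let ?B = "block_law n c (\<sigma>\<^sup>2)"
  interpret B: prob_space ?B using \<sigma> by (intro prob_space_block_law) simp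
  interpret NN: prob_space "complex_noise \<Otimes>\<^sub>M complex_noise"
    by (intro prob_space_pair prob_space_complex_noise)
  let ?S = "{\<omega> \<in> space ?B. r < (\<Sum>t<n. (cmod (fst (\<omega> t)))\<^sup>2)}"
  have one: "(\<integral>\<^sup>+\<omega>. ennreal ((cmod (fst (\<omega> t)))\<^sup>2) \<partial>?B) \<le> ennreal (2 * (cmod (c t))\<^sup>2 + 8 * \<sigma>\<^sup>2)" if t: "t < n" for t
  proof -
    have "(\<integral>\<^sup>+\<omega>. ennreal ((cmod (fst (\<omega> t)))\<^sup>2) \<partial>?B) = (\<integral>\<^sup>+p. ennreal ((cmod (fst p))\<^sup>2) \<partial>distr ?B (triple_law (c t) (\<sigma>\<^sup>2)) (\<lambda>\<omega>. \<omega> t))"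
      using t by (subst nn_integral_distr) (auto simp: block_law_def)
    also have "distr ?B (triple_law (c t) (\<sigma>\<^sup>2)) (\<lambda>\<omega>. \<omega> t) = triple_law (c t) (\<sigma>\<^sup>2)"
      unfolding block_law_def using t \<sigma> by (intro distr_PiM_component prob_space_triple_law) auto
    also have "(\<integral>\<^sup>+p. ennreal ((cmod (fst p))\<^sup>2) \<partial>triple_law (c t) (\<sigma>\<^sup>2)) = (\<integral>\<^sup>+y. \<integral>\<^sup>+p. ennreal ((cmod y)\<^sup>2) \<partial>(complex_noise \<Otimes>\<^sub>M complex_noise) \<partial>gauss (c t) (\<sigma>\<^sup>2))"
      unfolding triple_law_def by (subst NN.nn_integral_fst[symmetric]) auto
    also have "\<dots> = (\<integral>\<^sup>+y. ennreal ((cmod y)\<^sup>2) \<partial>gauss (c t) (\<sigma>\<^sup>2))"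
      using NN.emeasure_space_1 by simp
    also have "\<dots> \<le> ennreal (2 * (cmod (c t))\<^sup>2 + 8 * \<sigma>\<^sup>2)" by (rule gauss_second_moment[OF \<sigma>])
    finally show ?thesis .
  qed
  have comp [measurable]: "(\<lambda>\<omega>. ennreal ((cmod (fst (\<omega> t)))\<^sup>2)) \<in> borel_measurable ?B" if "t \<in> {..<n}" for t
    using that by measurable
  have S: "?S \<in> sets ?B" by measurable
  have "ennreal (r * measure ?B ?S) = ennreal r * emeasure ?B ?S"
    using r by (simp add: B.emeasure_eq_measure ennreal_mult')
  also have "\<dots> = (\<integral>\<^sup>+\<omega>. ennreal r * indicator ?S \<omega> \<partial>?B)" using S by (rule nn_integral_cmult_indicator[symmetric])
  also have "\<dots> \<le> (\<integral>\<^sup>+\<omega>. (\<Sum>t<n. ennreal ((cmod (fst (\<omega> t)))\<^sup>2)) \<partial>?B)"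
    by (intro nn_integral_mono) (auto simp: indicator_def sum_ennreal intro!: ennreal_leI)
  also have "\<dots> = (\<Sum>t<n. \<integral>\<^sup>+\<omega>. ennreal ((cmod (fst (\<omega> t)))\<^sup>2) \<partial>?B)" by (intro nn_integral_sum) auto
  also have "\<dots> \<le> (\<Sum>t<n. ennreal (2 * (cmod (c t))\<^sup>2 + 8 * \<sigma>\<^sup>2))" using one by (intro sum_mono) auto
  also have "\<dots> = ennreal (\<Sum>t<n. 2 * (cmod (c t))\<^sup>2 + 8 * \<sigma>\<^sup>2)" by (intro sum_ennreal) auto
  finally have "r * measure ?B ?S \<le> (\<Sum>t<n. 2 * (cmod (c t))\<^sup>2 + 8 * \<sigma>\<^sup>2)"
    by (subst (asm) ennreal_le_iff) (auto intro!: sum_nonneg)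
  also have "\<dots> = 2 * (\<Sum>t<n. (cmod (c t))\<^sup>2) + 8 * \<sigma>\<^sup>2 * real n"
    by (simp add: sum.distrib sum_distrib_left)
  finally show ?thesis using r by (simp add: field_simps)
qed

section \<open>The two-user outer bound\<close>

lemma sum_PiE_component:
  fixes f :: "'b \<Rightarrow> real"
  assumes I: "finite I" "i \<in> I" and A: "\<And>l. l \<in> I \<Longrightarrow> finite (A l)"
  shows "(\<Sum>w\<in>Pi\<^sub>E I A. f (w i)) = (\<Prod>l\<in>I - {i}. real (card (A l))) * (\<Sum>a\<in>A i. f a)"
proof -
  define g where "g l a = (if l = i then f a else 1)" for l a
  have "(\<Sum>w\<in>Pi\<^sub>E I A. f (w i)) = (\<Sum>w\<in>Pi\<^sub>E I A. \<Prod>l\<in>I. g l (w l))"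
  proof (intro sum.cong refl)
    fix w
    have "(\<Prod>l\<in>I. g l (w l)) = g i (w i) * (\<Prod>l\<in>I - {i}. g l (w l))" by (rule prod.remove[OF I])
    also have "(\<Prod>l\<in>I - {i}. g l (w l)) = 1" by (intro prod.neutral) (auto simp: g_def)
    finally show "f (w i) = (\<Prod>l\<in>I. g l (w l))" by (simp add: g_def)
  qed
  also have "\<dots> = (\<Prod>l\<in>I. \<Sum>a\<in>A l. g l a)" using I A by (intro prod_sum_PiE[symmetric])
  also have "\<dots> = (\<Sum>a\<in>A i. g i a) * (\<Prod>l\<in>I - {i}. \<Sum>a\<in>A l. g l a)" by (rule prod.remove[OF I])
  also have "(\<Prod>l\<in>I - {i}. \<Sum>a\<in>A l. g l a) = (\<Prod>l\<in>I - {i}. real (card (A l)))"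
    by (intro prod.cong) (auto simp: g_def)
  finally show ?thesis by (simp add: g_def)
qed

lemma finite_message_tuples: "finite (message_tuples K c)"
  unfolding message_tuples_def by (intro finite_PiE) auto

lemma card_message_tuples: "card (message_tuples K c) = (\<Prod>l<K. msgs c l)"
  unfolding message_tuples_def by (subst card_PiE) auto

lemma sum_codeword_energy:
  assumes i: "i < K" and n: "n > 0" and P: "avg_power n c i \<le> P" and M: "msgs c i > 0"
  shows "(\<Sum>w\<in>message_tuples K c. \<Sum>t<n. (cmod (enc c i (w i) t))\<^sup>2) \<le> real (card (message_tuples K c)) * (real n * P)"
proof -
  let ?p = "\<lambda>v. \<Sum>t<n. (cmod (enc c i v t))\<^sup>2"
  have avg: "avg_power n c i = (\<Sum>v<msgs c i. ?p v) / (real n * real (msgs c i))"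
    by (simp add: avg_power_def sum_divide_distrib)
  have sum: "(\<Sum>v<msgs c i. ?p v) \<le> real (msgs c i) * (real n * P)"
    using P n M unfolding avg by (simp add: field_simps)
  have "(\<Sum>w\<in>message_tuples K c. ?p (w i)) = (\<Prod>l\<in>{..<K} - {i}. real (card {..<msgs c l})) * (\<Sum>v\<in>{..<msgs c i}. ?p v)"
    unfolding message_tuples_def using i by (intro sum_PiE_component) auto
  also have "\<dots> \<le> (\<Prod>l\<in>{..<K} - {i}. real (card {..<msgs c l})) * (real (msgs c i) * (real n * P))"
    using sum by (intro mult_left_mono prod_nonneg) auto
  also have "\<dots> = (\<Prod>l<K. real (msgs c l)) * (real n * P)"
    using i prod.remove[of "{..<K}" i "\<lambda>l. real (msgs c l)"] by (simp add: mult_ac)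
  finally show ?thesis by (simp add: card_message_tuples)
qed

text \<open>
  From one observation \<open>y = h\<^sub>i\<^sub>i x\<^sub>i + h\<^sub>i\<^sub>j x\<^sub>j + \<sigma> n\<close> with a small enough noise level \<open>\<sigma>\<close> both messages can be decoded: adding
  independent noise gives the output of receiver \<open>i\<close>; once \<open>x\<^sub>i\<close> is known, \<open>\<alpha> (y - h\<^sub>i\<^sub>i x\<^sub>i) + h\<^sub>j\<^sub>i x\<^sub>i\<close> with
  \<open>\<alpha> = h\<^sub>j\<^sub>j / h\<^sub>i\<^sub>j\<close> gives, again after adding noise, the output of receiver \<open>j\<close>.  The pairs of codewords thus form
  a packing in a single complex dimension per channel use.
\<close>

lemma pair_rate_bound:
  fixes h :: channel and K :: nat and J :: "nat \<Rightarrow> nat"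
  assumes i: "i < K" and j: "j < K" and ij: "i \<noteq> j" and J: "J i \<ge> 1" "J j \<ge> 1"
    and nz: "h (i, 0, j) \<noteq> 0"
  shows "\<exists>B>0. \<forall>P\<ge>1. \<forall>R. achievable K J h P R \<longrightarrow> R i + R j \<le> log 2 (B * P)"
proof -
  define \<alpha> where "\<alpha> = h (j, 0, j) / h (i, 0, j)"
  \<comment> \<open>Small enough that \<sigma> and cmod \<alpha> * \<sigma> are at most 1/2; both
    receivers are then noisier than the observation, and the missing variances
    \<open>s1\<^sup>2\<close>, \<open>s2\<^sup>2\<close> are positive.\<close>
  define \<sigma> where "\<sigma> = 1 / (2 * (1 + cmod \<alpha>))"
  define s1 where "s1 = sqrt (1 - \<sigma>\<^sup>2)"
  define s2 where "s2 = sqrt (1 - (cmod \<alpha> * \<sigma>)\<^sup>2)"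
  \<comment> \<open>One factor 2 comes from splitting the square of the two-user signal, the other
    from \<open>gauss_second_moment\<close>.\<close>
  define a where "a = 4 * ((cmod (h (i, 0, i)))\<^sup>2 + (cmod (h (i, 0, j)))\<^sup>2)"
  have \<alpha>1: "1 + cmod \<alpha> > 0" using norm_ge_zero[of \<alpha>] by linarith
  have \<sigma>: "\<sigma> > 0" "\<sigma> \<le> 1/2" "cmod \<alpha> * \<sigma> \<le> 1/2" using \<alpha>1 by (auto simp: \<sigma>_def field_simps)
  have sq: "x\<^sup>2 < 1" if "0 \<le> x" "x \<le> 1/2" for x :: real
    using that by (simp add: power_less_one_iff)
  have s1: "s1 > 0" "(cmod 1 * \<sigma>)\<^sup>2 + s1\<^sup>2 = 1" using sq[of \<sigma>] \<sigma> by (auto simp: s1_def)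
  have s2: "s2 > 0" "(cmod \<alpha> * \<sigma>)\<^sup>2 + s2\<^sup>2 = 1" using sq[of "cmod \<alpha> * \<sigma>"] \<sigma> by (auto simp: s2_def)
  have a0: "a \<ge> 0" by (simp add: a_def)
  define B where "B = 2 * (a + 8 * \<sigma>\<^sup>2) / \<sigma>\<^sup>2 * exp 4"
  have B0: "B > 0" using a0 \<sigma> by (simp add: B_def add_nonneg_pos)
  have "R i + R j \<le> log 2 (B * P)" if P: "P \<ge> 1" and ach: "achievable K J h P R" for P R
  proof -
    \<comment> \<open>An upper bound for the mean received energy per symbol, averaged over the
      messages. It serves as the variance of the reference law, and the threshold 4 * n * s in
      \<open>T\<close> is then exceeded with average probability at most 1/4.\<close>
    define s where "s = a * P + 8 * \<sigma>\<^sup>2"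
    have s0: "s > 0" using a0 P \<sigma> by (simp add: s_def add_nonneg_pos)
    \<comment> \<open>One code of one block length is enough: errors 1/8 at the two receivers and
      1/4 for excess energy leave average probability at least 1/2.\<close>
    have "\<forall>\<^sub>F n in sequentially. \<exists>c. valid_code K J P n R c \<and> (\<forall>j<K. \<forall>k<J j. error_prob K h n c j k \<le> 1/8)"
      using ach unfolding achievable_def by (elim conjE allE[of _ "1/8"]) simp
    then have "\<forall>\<^sub>F n in sequentially. (\<exists>c. valid_code K J P n R c \<and> (\<forall>j<K. \<forall>k<J j. error_prob K h n c j k \<le> 1/8)) \<and> n \<ge> 1"
      using eventually_ge_at_top by (rule eventually_conj)
    then obtain n c where n: "n \<ge> 1" and c: "valid_code K J P n R c"
      and err: "\<And>j k. j < K \<Longrightarrow> k < J j \<Longrightarrow> error_prob K h n c j k \<le> 1/8"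
      by (auto simp: eventually_sequentially)
    have Mpos: "msgs c l > 0" if "l < K" for l
    proof -
      have "2 powr (real n * R l) \<le> real (msgs c l)" using c that by (auto simp: valid_code_def)
      moreover have "0 < 2 powr (real n * R l)" by simp
      ultimately show ?thesis by linarith
    qed
    let ?W = "message_tuples K c"
    let ?O = "\<Pi>\<^sub>E l\<in>{..<K} - {i, j}. {..<msgs c l}"
    have W: "finite ?W" by (rule finite_message_tuples)
    have split: "{..<K} - {i} - {j} = {..<K} - {i, j}" by auto
    have cW: "card ?W = msgs c i * (msgs c j * card ?O)"
    proof -
      have "card ?W = msgs c i * (\<Prod>l\<in>{..<K} - {i}. msgs c l)"
        unfolding card_message_tuples using i by (intro prod.remove) auto
      also have "(\<Prod>l\<in>{..<K} - {i}. msgs c l) = msgs c j * (\<Prod>l\<in>{..<K} - {i} - {j}. msgs c l)"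
        using j ij by (intro prod.remove) auto
      finally show ?thesis unfolding split by (simp add: card_PiE)
    qed
    have O0: "card ?O > 0" using Mpos by (auto simp: card_PiE intro!: prod_pos)
    have W0: "card ?W > 0" using Mpos by (auto simp: card_message_tuples intro!: prod_pos)
    define x where "x l w t = enc c l (w l) t" for l and w :: "nat \<Rightarrow> nat" and t
    \<comment> \<open>The observation leaves out the signals of the other users.
      \<open>recv1\<close> and \<open>recv2\<close> restore them, which is possible because
      \<open>multiplicity\<close> compares tuples with the same other messages.\<close>
    define cw where "cw w t = h (i, 0, i) * x i w t + h (i, 0, j) * x j w t" for w t
    \<comment> \<open>The noise that receiver \<open>i\<close> would have seen; the factor 1 brings
      it into the form of \<open>distr_triple_law\<close>. \<open>Z2\<close> plays the same part for
      receiver \<open>j\<close>.\<close>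
    define Z1 where "Z1 w \<omega> = (\<lambda>t\<in>{..<n}. 1 * (fst (\<omega> t) - cw w t) + s1 *\<^sub>R fst (snd (\<omega> t)))"
      for w and \<omega> :: "nat \<Rightarrow> complex \<times> complex \<times> complex"
    define Z2 where "Z2 w \<omega> = (\<lambda>t\<in>{..<n}. \<alpha> * (fst (\<omega> t) - cw w t) + s2 *\<^sub>R snd (snd (\<omega> t)))"
      for w and \<omega> :: "nat \<Rightarrow> complex \<times> complex \<times> complex"
    define \<Omega> where "\<Omega> w = block_law n (cw w) (\<sigma>\<^sup>2)" for w
    define \<Omega>0 where "\<Omega>0 = block_law n (\<lambda>_. 0) s"
    let ?S = "\<Pi>\<^sub>M t\<in>{..<n}. (borel :: complex measure) \<Otimes>\<^sub>M ((borel :: complex measure) \<Otimes>\<^sub>M (borel :: complex measure))"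
    have sets\<Omega> [measurable_cong, simp]: "sets (\<Omega> w) = sets ?S" "sets \<Omega>0 = sets ?S" for w
      by (simp_all add: \<Omega>_def \<Omega>0_def)
    have space\<Omega>: "space (\<Omega> w) = space ?S" "space \<Omega>0 = space ?S" for w
      by (rule sets_eq_imp_space_eq, simp)+
    have prob\<Omega>: "prob_space (\<Omega> w)" for w unfolding \<Omega>_def using \<sigma> by (intro prob_space_block_law) simp
    interpret \<Omega>0: prob_space \<Omega>0 unfolding \<Omega>0_def using s0 by (intro prob_space_block_law)
    have Z1_meas: "Z1 w \<in> measurable (\<Omega> w) (block_noise n)" for w
      unfolding Z1_def by measurable
    have Z2_meas: "Z2 w \<in> measurable (\<Omega> w) (block_noise n)" for w
      unfolding Z2_def by measurable
    have Z1_law: "distr (\<Omega> w) (block_noise n) (Z1 w) = block_noise n" for w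
      unfolding \<Omega>_def block_law_def block_noise_def Z1_def using \<sigma>(1)
      by (intro distr_PiM_maps[where f = "\<lambda>t \<omega>. 1 * (fst \<omega> - cw w t) + s1 *\<^sub>R fst (snd \<omega>)"]
            distr_triple_law[where \<pi> = fst] prob_space_triple_law prob_space_complex_noise s1 finite_lessThan
            prob_space.distr_pair_fst) (simp, measurable)
    have Z2_law: "distr (\<Omega> w) (block_noise n) (Z2 w) = block_noise n" for w
      unfolding \<Omega>_def block_law_def block_noise_def Z2_def using \<sigma>(1)
      by (intro distr_PiM_maps[where f = "\<lambda>t \<omega>. \<alpha> * (fst \<omega> - cw w t) + s2 *\<^sub>R snd (snd \<omega>)"]
            distr_triple_law[where \<pi> = snd] prob_space_triple_law prob_space_complex_noise s2 finite_lessThan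
            distr_complex_noise_pair_snd) (simp, measurable)
    have dec [measurable]: "dec c i 0 \<in> measurable (\<Pi>\<^sub>M t\<in>{..<n}. borel) (count_space UNIV)"
      "dec c j 0 \<in> measurable (\<Pi>\<^sub>M t\<in>{..<n}. borel) (count_space UNIV)"
      using c i j J unfolding valid_code_def by (simp_all add: Suc_le_eq)
    have rec [measurable]: "received K h n c l 0 w \<in> measurable (block_noise n) (\<Pi>\<^sub>M t\<in>{..<n}. borel)" for l w
      unfolding received_def[abs_def] by measurable
    define e where "e l w = measure (block_noise n) {z \<in> space (block_noise n). dec c l 0 (received K h n c l 0 w z) \<noteq> w l}" for l w
    have sum_e: "(\<Sum>w\<in>?W. e l w) \<le> real (card ?W) / 8" if "l < K" "J l \<ge> 1" for l
      using err[of l 0] that W0 by (simp add: error_prob_def e_def field_simps)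
    define F1 where "F1 w = {\<omega> \<in> space ?S. dec c i 0 (received K h n c i 0 w (Z1 w \<omega>)) \<noteq> w i}" for w
    define F2 where "F2 w = {\<omega> \<in> space ?S. dec c j 0 (received K h n c j 0 w (Z2 w \<omega>)) \<noteq> w j}" for w
    define T where "T = {\<omega> \<in> space ?S. 4 * real n * s < (\<Sum>t<n. (cmod (fst (\<omega> t)))\<^sup>2)}"
    define E where "E w = space ?S - (F1 w \<union> F2 w \<union> T)" for w
    have pre: "{z \<in> space (block_noise n). dec c l 0 (received K h n c l 0 w z) \<noteq> w l} \<in> sets (block_noise n)"
      if "l \<in> {i, j}" for l w
      using that by (elim insertE emptyE) (simp_all only:, measurable)
    have F1: "F1 w \<in> sets ?S" "measure (\<Omega> w) (F1 w) = e i w" for w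
    proof -
      have eq: "F1 w = Z1 w -` {z \<in> space (block_noise n). dec c i 0 (received K h n c i 0 w z) \<noteq> w i} \<inter> space (\<Omega> w)"
        using measurable_space[OF Z1_meas] by (auto simp: F1_def space\<Omega>)
      show "F1 w \<in> sets ?S" using measurable_sets[OF Z1_meas pre, of i w] unfolding eq by simp
      show "measure (\<Omega> w) (F1 w) = e i w"
        unfolding e_def eq by (subst measure_distr[OF Z1_meas pre, symmetric]) (simp_all add: Z1_law)
    qed
    have F2: "F2 w \<in> sets ?S" "measure (\<Omega> w) (F2 w) = e j w" for w
    proof -
      have eq: "F2 w = Z2 w -` {z \<in> space (block_noise n). dec c j 0 (received K h n c j 0 w z) \<noteq> w j} \<inter> space (\<Omega> w)"
        using measurable_space[OF Z2_meas] by (auto simp: F2_def space\<Omega>)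
      show "F2 w \<in> sets ?S" using measurable_sets[OF Z2_meas pre, of j w] unfolding eq by simp
      show "measure (\<Omega> w) (F2 w) = e j w"
        unfolding e_def eq by (subst measure_distr[OF Z2_meas pre, symmetric]) (simp_all add: Z2_law)
    qed
    have T: "T \<in> sets ?S" unfolding T_def by measurable
    have Tle: "measure (\<Omega> w) T \<le> (2 * (\<Sum>t<n. (cmod (cw w t))\<^sup>2) + 8 * \<sigma>\<^sup>2 * real n) / (4 * real n * s)" for w
      using block_law_energy_tail[OF \<sigma>(1), of "4 * real n * s" n "cw w"] n s0
      by (simp add: T_def \<Omega>_def[symmetric] space\<Omega>)
    have E: "E w \<in> sets ?S" for w unfolding E_def using F1 F2 T by (intro sets.Diff sets.Un sets.top)
    have lower: "1 - e i w - e j w - measure (\<Omega> w) T \<le> measure (\<Omega> w) (E w)" for w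
    proof -
      interpret prob_space "\<Omega> w" by (rule prob\<Omega>)
      have "1 = measure (\<Omega> w) (E w \<union> (F1 w \<union> F2 w \<union> T))"
        using prob_space F1 F2 T sets.sets_into_space[of _ ?S] unfolding space\<Omega> E_def
        by (simp add: Un_absorb2 Un_Diff_cancel2)
      also have "\<dots> \<le> measure (\<Omega> w) (E w) + (measure (\<Omega> w) (F1 w) + measure (\<Omega> w) (F2 w) + measure (\<Omega> w) T)"
        using E F1 F2 T by (intro order_trans[OF measure_Un_le] add_mono order_refl) (auto intro!: sets.Un)
      finally show ?thesis by (simp add: F1 F2)
    qed
    define G where "G = s / \<sigma>\<^sup>2 * exp 4"
    have G0: "G > 0" using s0 \<sigma> by (simp add: G_def)
    have upper: "ennreal (measure (\<Omega> w) (E w)) \<le> ennreal (G ^ n) * emeasure \<Omega>0 (E w)" for w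
    proof -
      interpret prob_space "\<Omega> w" by (rule prob\<Omega>)
      have "emeasure (\<Omega> w) (E w) \<le> ennreal ((s / \<sigma>\<^sup>2 * exp 4) ^ n) * emeasure \<Omega>0 (E w)"
        unfolding \<Omega>_def \<Omega>0_def using s0 \<sigma> E
        by (intro emeasure_block_law_le) (auto simp: E_def T_def)
      then show ?thesis by (simp add: emeasure_eq_measure G_def)
    qed
    have recv1: "received K h n c i 0 w (Z1 w \<omega>) =
      (\<lambda>t\<in>{..<n}. (\<Sum>l\<in>{..<K} - {i, j}. h (i, 0, l) * x l w t) + fst (\<omega> t) + s1 *\<^sub>R fst (snd (\<omega> t)))" for w \<omega>
    proof -
      have "(\<Sum>l<K. h (i, 0, l) * x l w t) = cw w t + (\<Sum>l\<in>{..<K} - {i, j}. h (i, 0, l) * x l w t)" for t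
      proof -
        have "(\<Sum>l<K. h (i, 0, l) * x l w t) = h (i, 0, i) * x i w t + (\<Sum>l\<in>{..<K} - {i}. h (i, 0, l) * x l w t)"
          using i by (intro sum.remove) auto
        also have "(\<Sum>l\<in>{..<K} - {i}. h (i, 0, l) * x l w t) = h (i, 0, j) * x j w t + (\<Sum>l\<in>{..<K} - {i} - {j}. h (i, 0, l) * x l w t)"
          using j ij by (intro sum.remove) auto
        finally show ?thesis unfolding split by (simp add: cw_def)
      qed
      then show ?thesis by (auto simp: received_def Z1_def x_def fun_eq_iff)
    qed
    have recv2: "received K h n c j 0 w (Z2 w \<omega>) =
      (\<lambda>t\<in>{..<n}. (\<Sum>l\<in>{..<K} - {i, j}. h (j, 0, l) * x l w t) + (h (j, 0, i) - \<alpha> * h (i, 0, i)) * x i w t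
         + \<alpha> * fst (\<omega> t) + s2 *\<^sub>R snd (snd (\<omega> t)))" for w \<omega>
    proof -
      have "(\<Sum>l<K. h (j, 0, l) * x l w t) - \<alpha> * cw w t
        = (\<Sum>l\<in>{..<K} - {i, j}. h (j, 0, l) * x l w t) + (h (j, 0, i) - \<alpha> * h (i, 0, i)) * x i w t" for t
      proof -
        have "(\<Sum>l<K. h (j, 0, l) * x l w t) = h (j, 0, i) * x i w t + (\<Sum>l\<in>{..<K} - {i}. h (j, 0, l) * x l w t)"
          using i by (intro sum.remove) auto
        also have "(\<Sum>l\<in>{..<K} - {i}. h (j, 0, l) * x l w t) = h (j, 0, j) * x j w t + (\<Sum>l\<in>{..<K} - {i} - {j}. h (j, 0, l) * x l w t)"
          using j ij by (intro sum.remove) auto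
        finally have "(\<Sum>l<K. h (j, 0, l) * x l w t) = h (j, 0, i) * x i w t + (h (j, 0, j) * x j w t + (\<Sum>l\<in>{..<K} - {i, j}. h (j, 0, l) * x l w t))"
          unfolding split .
        \<comment> \<open>\<alpha> turns the coefficient of user \<open>j\<close> at receiver
          \<open>i\<close> into the one at receiver \<open>j\<close>, so only a multiple of the
          already decoded \<open>x i\<close> has to be corrected.\<close>
        moreover have "\<alpha> * cw w t = \<alpha> * h (i, 0, i) * x i w t + h (j, 0, j) * x j w t"
          using nz by (simp add: cw_def \<alpha>_def algebra_simps)
        ultimately show ?thesis by (simp add: algebra_simps)
      qed
      then show ?thesis
        by (auto simp: received_def Z2_def x_def fun_eq_iff algebra_simps)
    qed
    \<comment> \<open>Given the other messages, \<open>y\<close> and the added noise, \<open>recv1\<close> determines \<open>w i\<close>, and then \<open>recv2\<close> determines \<open>w j\<close>.\<close>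
    have multiplicity: "card {w \<in> ?W. \<omega> \<in> E w} \<le> card ?O" for \<omega>
    proof (rule card_inj_on_le)
      let ?\<rho> = "\<lambda>w :: nat \<Rightarrow> nat. restrict w ({..<K} - {i, j})"
      show "?\<rho> ` {w \<in> ?W. \<omega> \<in> E w} \<subseteq> ?O"
      proof (rule image_subsetI)
        fix w assume "w \<in> {w \<in> ?W. \<omega> \<in> E w}"
        then have "w \<in> (\<Pi>\<^sub>E l\<in>{..<K}. {..<msgs c l})" by (simp add: message_tuples_def)
        then have "w l \<in> {..<msgs c l}" if "l < K" for l by (rule PiE_mem) (simp add: that)
        then show "?\<rho> w \<in> ?O" by (simp add: restrict_PiE_iff)
      qed
      show "finite ?O" by (intro finite_PiE) auto
      show "inj_on ?\<rho> {w \<in> ?W. \<omega> \<in> E w}"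
      proof (rule inj_onI)
        fix w w' assume w: "w \<in> {w \<in> ?W. \<omega> \<in> E w}" and w': "w' \<in> {w \<in> ?W. \<omega> \<in> E w}" and eq: "?\<rho> w = ?\<rho> w'"
        have others: "w l = w' l" if "l \<in> {..<K} - {i, j}" for l using fun_cong[OF eq, of l] that by simp
        then have xo: "x l w t = x l w' t" if "l \<in> {..<K} - {i, j}" for l t using that by (simp add: x_def)
        have W: "w \<in> ?W" "w' \<in> ?W" and mem: "\<omega> \<in> E w" "\<omega> \<in> E w'" using w w' by simp_all
        have "received K h n c i 0 w (Z1 w \<omega>) = received K h n c i 0 w' (Z1 w' \<omega>)"
          unfolding recv1 using xo by (intro restrict_ext arg_cong2[where f = "(+)"] sum.cong) auto
        then have wi: "w i = w' i" using mem unfolding E_def F1_def by simp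
        have "received K h n c j 0 w (Z2 w \<omega>) = received K h n c j 0 w' (Z2 w' \<omega>)"
          unfolding recv2 using xo wi by (intro restrict_ext arg_cong2[where f = "(+)"] sum.cong) (auto simp: x_def)
        then have wj: "w j = w' j" using mem unfolding E_def F2_def by simp
        show "w = w'"
        proof (rule PiE_ext)
          show "w \<in> (\<Pi>\<^sub>E l\<in>{..<K}. {..<msgs c l})" "w' \<in> (\<Pi>\<^sub>E l\<in>{..<K}. {..<msgs c l})"
            using W by (simp_all add: message_tuples_def)
          show "w l = w' l" if "l \<in> {..<K}" for l using that others[of l] wi wj by auto
        qed
      qed
    qed
    \<comment> \<open>The measure \<open>\<Omega>0\<close> is the same for all messages and each of
      its points lies in at most \<open>card ?O\<close> of the sets \<open>E w\<close>, so their
      total mass is at most that number.\<close>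
    have packing: "(\<Sum>w\<in>?W. emeasure \<Omega>0 (E w)) \<le> ennreal (real (card ?O))"
    proof -
      have "(\<Sum>w\<in>?W. emeasure \<Omega>0 (E w)) = (\<Sum>w\<in>?W. \<integral>\<^sup>+\<omega>. indicator (E w) \<omega> \<partial>\<Omega>0)"
        using E by (intro sum.cong nn_integral_indicator[symmetric]) auto
      also have "\<dots> = (\<integral>\<^sup>+\<omega>. (\<Sum>w\<in>?W. indicator (E w) \<omega>) \<partial>\<Omega>0)"
        using E by (intro nn_integral_sum[symmetric]) auto
      also have "\<dots> \<le> (\<integral>\<^sup>+\<omega>. ennreal (real (card ?O)) \<partial>\<Omega>0)"
      proof (intro nn_integral_mono)
        fix \<omega>
        have "(\<Sum>w\<in>?W. indicator (E w) \<omega>) = (\<Sum>w\<in>{w \<in> ?W. \<omega> \<in> E w}. 1 :: ennreal)"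
          using W by (intro sum.mono_neutral_cong_right) (auto simp: indicator_def)
        also have "\<dots> = ennreal (real (card {w \<in> ?W. \<omega> \<in> E w}))"
          by (simp add: ennreal_of_nat_eq_real_of_nat)
        also have "\<dots> \<le> ennreal (real (card ?O))" using multiplicity by (intro ennreal_leI) simp
        finally show "(\<Sum>w\<in>?W. indicator (E w) \<omega>) \<le> ennreal (real (card ?O))" .
      qed
      also have "\<dots> = ennreal (real (card ?O))" using \<Omega>0.emeasure_space_1 by simp
      finally show ?thesis .
    qed
    have "ennreal (\<Sum>w\<in>?W. measure (\<Omega> w) (E w)) = (\<Sum>w\<in>?W. ennreal (measure (\<Omega> w) (E w)))"
      by (rule sum_ennreal[symmetric]) simp
    also have "\<dots> \<le> (\<Sum>w\<in>?W. ennreal (G ^ n) * emeasure \<Omega>0 (E w))" by (intro sum_mono upper)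
    also have "\<dots> = ennreal (G ^ n) * (\<Sum>w\<in>?W. emeasure \<Omega>0 (E w))" by (rule sum_distrib_left[symmetric])
    also have "\<dots> \<le> ennreal (G ^ n) * ennreal (real (card ?O))" using packing by (intro mult_left_mono) auto
    also have "\<dots> = ennreal (G ^ n * real (card ?O))" using G0 by (subst ennreal_mult) auto
    finally have up: "(\<Sum>w\<in>?W. measure (\<Omega> w) (E w)) \<le> G ^ n * real (card ?O)"
      using G0 by (subst (asm) ennreal_le_iff) auto
    have sum_T: "(\<Sum>w\<in>?W. measure (\<Omega> w) T) \<le> real (card ?W) / 4"
    proof -
      have pw: "avg_power n c l \<le> P" if "l < K" for l using c that by (auto simp: valid_code_def)
      have energy: "(\<Sum>w\<in>?W. \<Sum>t<n. (cmod (x l w t))\<^sup>2) \<le> real (card ?W) * (real n * P)" if "l < K" for l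
        unfolding x_def using that n by (intro sum_codeword_energy pw Mpos) auto
      have cwle: "(cmod (cw w t))\<^sup>2 \<le> 2 * (cmod (h (i, 0, i)))\<^sup>2 * (cmod (x i w t))\<^sup>2 + 2 * (cmod (h (i, 0, j)))\<^sup>2 * (cmod (x j w t))\<^sup>2" for w t
      proof -
        let ?u = "cmod (h (i, 0, i)) * cmod (x i w t)" and ?v = "cmod (h (i, 0, j)) * cmod (x j w t)"
        have "(cmod (cw w t))\<^sup>2 \<le> (?u + ?v)\<^sup>2"
          unfolding cw_def using norm_triangle_ineq[of "h (i, 0, i) * x i w t" "h (i, 0, j) * x j w t"]
          by (intro power_mono) (auto simp: norm_mult)
        also have "\<dots> \<le> 2 * ?u\<^sup>2 + 2 * ?v\<^sup>2" using sum_squares_bound[of ?u ?v] by (simp add: power2_sum)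
        finally show ?thesis by (simp add: power_mult_distrib)
      qed
      have "(\<Sum>w\<in>?W. \<Sum>t<n. (cmod (cw w t))\<^sup>2)
        \<le> (\<Sum>w\<in>?W. \<Sum>t<n. 2 * (cmod (h (i, 0, i)))\<^sup>2 * (cmod (x i w t))\<^sup>2 + 2 * (cmod (h (i, 0, j)))\<^sup>2 * (cmod (x j w t))\<^sup>2)"
        by (intro sum_mono cwle)
      also have "\<dots> = 2 * (cmod (h (i, 0, i)))\<^sup>2 * (\<Sum>w\<in>?W. \<Sum>t<n. (cmod (x i w t))\<^sup>2) + 2 * (cmod (h (i, 0, j)))\<^sup>2 * (\<Sum>w\<in>?W. \<Sum>t<n. (cmod (x j w t))\<^sup>2)"
        by (simp add: sum.distrib sum_distrib_left)
      also have "\<dots> \<le> 2 * (cmod (h (i, 0, i)))\<^sup>2 * (real (card ?W) * (real n * P)) + 2 * (cmod (h (i, 0, j)))\<^sup>2 * (real (card ?W) * (real n * P))"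
        using energy i j by (intro add_mono mult_left_mono) auto
      also have "\<dots> = real (card ?W) * real n * (a * P) / 2" by (simp add: a_def algebra_simps)
      finally have cwsum: "2 * (\<Sum>w\<in>?W. \<Sum>t<n. (cmod (cw w t))\<^sup>2) \<le> real (card ?W) * real n * (a * P)" by simp
      have "(\<Sum>w\<in>?W. measure (\<Omega> w) T) \<le> (\<Sum>w\<in>?W. (2 * (\<Sum>t<n. (cmod (cw w t))\<^sup>2) + 8 * \<sigma>\<^sup>2 * real n) / (4 * real n * s))"
        by (intro sum_mono Tle)
      also have "\<dots> = (2 * (\<Sum>w\<in>?W. \<Sum>t<n. (cmod (cw w t))\<^sup>2) + real (card ?W) * (8 * \<sigma>\<^sup>2 * real n)) / (4 * real n * s)"
        by (simp add: sum_divide_distrib[symmetric] sum.distrib sum_distrib_left)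
      also have "\<dots> \<le> (real (card ?W) * real n * (a * P) + real (card ?W) * (8 * \<sigma>\<^sup>2 * real n)) / (4 * real n * s)"
        using cwsum n s0 by (intro divide_right_mono add_right_mono) auto
      also have "\<dots> = real (card ?W) * real n * s / (4 * real n * s)" by (simp add: s_def algebra_simps)
      also have "\<dots> = real (card ?W) / 4" using n s0 by simp
      finally show ?thesis .
    qed
    have "real (card ?W) - real (card ?W) / 8 - real (card ?W) / 8 - real (card ?W) / 4
       \<le> real (card ?W) - (\<Sum>w\<in>?W. e i w) - (\<Sum>w\<in>?W. e j w) - (\<Sum>w\<in>?W. measure (\<Omega> w) T)"
      using sum_e[OF i J(1)] sum_e[OF j J(2)] sum_T by linarith
    also have "\<dots> = (\<Sum>w\<in>?W. 1 - e i w - e j w - measure (\<Omega> w) T)" by (simp add: sum_subtractf)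
    also have "\<dots> \<le> (\<Sum>w\<in>?W. measure (\<Omega> w) (E w))" by (intro sum_mono lower)
    also have "\<dots> \<le> G ^ n * real (card ?O)" by (rule up)
    finally have "real (card ?W) \<le> 2 * G ^ n * real (card ?O)" by simp
    then have "real (msgs c i) * real (msgs c j) * real (card ?O) \<le> 2 * G ^ n * real (card ?O)"
      unfolding cW by (simp add: mult_ac)
    then have MM: "real (msgs c i) * real (msgs c j) \<le> 2 * G ^ n"
      using O0 by (subst (asm) mult_le_cancel_right) auto
    have "2 powr (real n * (R i + R j)) = 2 powr (real n * R i) * 2 powr (real n * R j)"
      by (simp add: powr_add[symmetric] distrib_left)
    also have "\<dots> \<le> real (msgs c i) * real (msgs c j)"
      using c i j unfolding valid_code_def by (intro mult_mono) auto
    also have "\<dots> \<le> 2 * G ^ n" by (rule MM)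
    \<comment> \<open>As n \<ge> 1, the constant 2 can be moved into the base, which explains the
      factor 2 in \<open>B\<close>.\<close>
    also have "\<dots> \<le> 2 ^ n * G ^ n" using n G0 self_le_power[of "2::real" n] by (intro mult_right_mono) auto
    also have "\<dots> = (2 * G) ^ n" by (simp add: power_mult_distrib)
    also have "\<dots> \<le> (B * P) ^ n"
    proof (rule power_mono)
      have "s \<le> (a + 8 * \<sigma>\<^sup>2) * P" using P \<sigma> by (simp add: s_def distrib_right mult_left_mono[of 1 P "8 * \<sigma>\<^sup>2", simplified])
      then have "2 * (s / \<sigma>\<^sup>2 * exp 4) \<le> 2 * ((a + 8 * \<sigma>\<^sup>2) * P / \<sigma>\<^sup>2 * exp 4)"
        using \<sigma> by (intro mult_left_mono mult_right_mono divide_right_mono) auto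
      then show "2 * G \<le> B * P"
        unfolding G_def B_def by (simp only: mult_ac times_divide_eq_left times_divide_eq_right)
    qed (use G0 in auto)
    also have "\<dots> = 2 powr (real n * log 2 (B * P))"
    proof -
      have BP: "B * P > 0" using B0 P by simp
      have "2 powr (real n * log 2 (B * P)) = (2 powr (log 2 (B * P))) powr (real n)" by (simp add: powr_powr mult.commute)
      also have "\<dots> = (B * P) ^ n" using BP by (simp add: powr_realpow)
      finally show ?thesis ..
    qed
    finally have "real n * (R i + R j) \<le> real n * log 2 (B * P)" by simp
    then show ?thesis using n by (subst (asm) mult_le_cancel_left) auto
  qed
  then show ?thesis using B0 by blast
qed

section \<open>The converse for K users, and the limit\<close>

lemma sum_capacity_upper_bound:
  fixes h :: channel and K :: nat and J :: "nat \<Rightarrow> nat" and t :: real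
  assumes K: "K \<ge> 2" and J: "\<And>j. j < K \<Longrightarrow> J j \<ge> 1"
    and nz: "\<And>i j. i < K \<Longrightarrow> j < K \<Longrightarrow> h (i, 0, j) \<noteq> 0"
    and t: "real K / 2 < t"
  shows "\<forall>\<^sub>F P in at_top. sum_capacity K J h P / ereal (log 2 P) < ereal t"
proof -
  \<comment> \<open>Each user occurs once as \<open>i\<close> and once as \<open>nx i\<close>, so
    the K pair bounds count every rate twice. For K = 2 the cycle passes the same pair in both
    orders.\<close>
  define nx where "nx i = (if Suc i = K then 0 else Suc i)" for i
  have nx: "nx i < K" "i \<noteq> nx i" if "i < K" for i using that K by (auto simp: nx_def)
  have "\<forall>i. i < K \<longrightarrow> (\<exists>B>0. \<forall>P\<ge>1. \<forall>R. achievable K J h P R \<longrightarrow> R i + R (nx i) \<le> log 2 (B * P))"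
    using nx J nz by (intro allI impI pair_rate_bound) auto
  then obtain B where B: "\<And>i. i < K \<Longrightarrow> B i > 0"
    "\<And>i P R. \<lbrakk>i < K; P \<ge> 1; achievable K J h P R\<rbrakk> \<Longrightarrow> R i + R (nx i) \<le> log 2 (B i * P)"
    by metis
  define C where "C = (\<Sum>i<K. log 2 (B i))"
  have sum_nx: "(\<Sum>i<K. f (nx i)) = (\<Sum>i<K. f i)" for f :: "nat \<Rightarrow> real"
  proof -
    obtain K' where K': "K = Suc K'" using K by (cases K) auto
    have "(\<Sum>i<K. f (nx i)) = (\<Sum>i<K'. f (Suc i)) + f 0" by (simp add: K' nx_def)
    also have "\<dots> = (\<Sum>i<K. f i)" unfolding K' by (subst sum.lessThan_Suc_shift) simp
    finally show ?thesis .
  qed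
  have bound: "2 * (\<Sum>i<K. R i) \<le> K * log 2 P + C" if "P \<ge> 1" "achievable K J h P R" for P R
  proof -
    have "2 * (\<Sum>i<K. R i) = (\<Sum>i<K. R i + R (nx i))" by (simp add: sum.distrib sum_nx)
    also have "\<dots> \<le> (\<Sum>i<K. log 2 (B i) + log 2 P)"
    proof (rule sum_mono)
      fix i assume "i \<in> {..<K}"
      then have i: "i < K" by simp
      have "log 2 (B i * P) = log 2 (B i) + log 2 P" using B(1)[OF i] that(1) by (simp add: log_mult)
      then show "R i + R (nx i) \<le> log 2 (B i) + log 2 P" using B(2)[OF i that] by simp
    qed
    also have "\<dots> = K * log 2 P + C" by (simp add: sum.distrib C_def)
    finally show ?thesis .
  qed
  have lim: "filterlim (log 2) at_top at_top" by real_asymp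
  have d0: "2 * t - K > 0" using t by simp
  \<comment> \<open>The maximum keeps log P positive whatever the sign of \<open>C\<close>, and the
    summand 1 makes the bound strict.\<close>
  have "\<forall>\<^sub>F P in at_top. max 1 (C / (2 * t - K) + 1) \<le> log 2 P" using lim by (simp only: filterlim_at_top)
  with eventually_ge_at_top[of 1] show ?thesis
  proof eventually_elim
    case (elim P)
    have lP: "log 2 P > 0" using elim(2) by simp
    have "C / (2 * t - K) < log 2 P" using elim(2) by simp
    then have "C < log 2 P * (2 * t - K)" using d0 by (simp add: field_simps)
    then have lt: "((K * log 2 P + C) / 2) / log 2 P < t" using lP by (simp add: field_simps)
    have "sum_capacity K J h P \<le> ereal ((K * log 2 P + C) / 2)"
      unfolding sum_capacity_def
    proof (rule SUP_least)
      fix R assume "R \<in> {R. achievable K J h P R}"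
      then show "ereal (\<Sum>i<K. R i) \<le> ereal ((K * log 2 P + C) / 2)" using bound[OF elim(1), of R] by simp
    qed
    then have "sum_capacity K J h P / ereal (log 2 P) \<le> ereal ((K * log 2 P + C) / 2) / ereal (log 2 P)"
      using lP by (intro ereal_divide_right_mono) auto
    also have "\<dots> = ereal (((K * log 2 P + C) / 2) / log 2 P)" using lP by simp
    also have "\<dots> < ereal t" using lt by simp
    finally show ?case .
  qed
qed

text \<open>The form with coefficient 1 at \<open>a\<close> and 0 elsewhere is admissible. In this
  way the almost sure event of the achievability part also provides the nonzero coefficients by
  which the converse divides.\<close>

lemma diophantine_imp_nonzero:
  assumes f: "diophantine A f" and A: "finite A" and a: "a \<in> A"
  shows "f a \<noteq> 0"
proof -
  obtain \<kappa> :: nat where "\<forall>Q\<ge>2. \<forall>q\<in>A \<rightarrow>\<^sub>E gbox Q.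
     (\<exists>a\<in>A. q a \<noteq> 0) \<longrightarrow> 1 \<le> real Q ^ \<kappa> * cmod (\<Sum>a\<in>A. q a * f a)"
    using f unfolding diophantine_def by (elim exE)
  then have \<kappa>: "\<forall>q\<in>A \<rightarrow>\<^sub>E gbox 2. (\<exists>a\<in>A. q a \<noteq> 0) \<longrightarrow> 1 \<le> real 2 ^ \<kappa> * cmod (\<Sum>a\<in>A. q a * f a)"
    by (elim allE[of _ 2]) simp
  define q where "q = (\<lambda>b\<in>A. if b = a then 1 else 0 :: complex)"
  have "q \<in> A \<rightarrow>\<^sub>E gbox 2" by (auto simp: q_def mem_gbox)
  moreover have "\<exists>a\<in>A. q a \<noteq> 0" using a by (auto simp: q_def)
  ultimately have "1 \<le> real 2 ^ \<kappa> * cmod (\<Sum>b\<in>A. q b * f b)" using \<kappa> by blast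
  also have "(\<Sum>b\<in>A. q b * f b) = (\<Sum>b\<in>A. if b = a then f b else 0)"
    by (intro sum.cong) (auto simp: q_def)
  also have "\<dots> = f a" using A a by simp
  finally show ?thesis by auto
qed

theorem mainTheorem7:
  fixes K :: nat and J :: "nat \<Rightarrow> nat" and D :: "channel measure"
  assumes "K \<ge> 2"
    and "\<And>j. j < K \<Longrightarrow> J j \<ge> 1"
    and "continuous_channel_law K J D"
  shows "AE h in D. has_degrees_of_freedom K J h (real K / 2)"
proof -
  let ?I = "coeff_index K J"
  let ?good = "\<lambda>h n. diophantine (?I \<rightarrow>\<^sub>E {..n}) (\<lambda>e. \<Prod>p\<in>?I. h p ^ e p)"
  \<comment> \<open>One null set for all n: the degree is chosen only after the channel, according
    to how close to K/2 the target is.\<close>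
  have good: "AE h in (\<Pi>\<^sub>M p\<in>?I. (lborel :: complex measure)). \<forall>n. ?good h n"
    unfolding AE_all_countable by (intro allI AE_diophantine_monomials) simp
  have sets_D: "sets D = sets (\<Pi>\<^sub>M p\<in>?I. (lborel :: complex measure))"
    using assms(3) unfolding continuous_channel_law_def by (simp cong: sets_PiM_cong)
  have "absolutely_continuous (\<Pi>\<^sub>M p\<in>?I. (lborel :: complex measure)) D"
    using assms(3) unfolding continuous_channel_law_def by simp
  \<comment> \<open>Here the continuity of the channel law enters: Lebesgue null sets of
    coefficients are null for \<open>D\<close>.\<close>
  from absolutely_continuous_AE[OF sets_D this good] have "AE h in D. \<forall>n. ?good h n" .
  then show ?thesis
  proof eventually_elim
    case (elim h)
    have nz: "h (i, 0, j) \<noteq> 0" if "i < K" "j < K" for i j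
    proof -
      \<comment> \<open>The monomial that consists of this single coefficient; its exponents are at
        most 1, hence the case n = 1 below.\<close>
      let ?e = "\<lambda>p\<in>?I. if p = (i, 0, j) then 1 else 0 :: nat"
      have p: "(i, 0, j) \<in> ?I" using that assms(2)[of i] by (auto simp: coeff_index_def)
      have "(\<Prod>p\<in>?I. h p ^ ?e p) \<noteq> 0"
        by (rule diophantine_imp_nonzero[OF elim[rule_format, of 1]]) (auto intro: finite_PiE)
      also have "(\<Prod>p\<in>?I. h p ^ ?e p) = (\<Prod>p\<in>?I. if p = (i, 0, j) then h p else 1)"
        by (intro prod.cong) auto
      also have "\<dots> = h (i, 0, j)" using p by simp
      finally show ?thesis .
    qed
    show ?case unfolding has_degrees_of_freedom_def
    proof (rule order_tendstoI)
      fix u assume "u < ereal (real K / 2)"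
      then obtain t where t: "u < ereal t" "t < real K / 2" using ereal_dense2 by force
      show "\<forall>\<^sub>F P in at_top. u < sum_capacity K J h P / ereal (log 2 P)"
        using sum_capacity_lower_bound[OF assms(1) elim[rule_format] t(2)]
        by eventually_elim (use t(1) in order)
    next
      fix u assume "ereal (real K / 2) < u"
      then obtain t where t: "ereal t < u" "real K / 2 < t" using ereal_dense2 by force
      show "\<forall>\<^sub>F P in at_top. sum_capacity K J h P / ereal (log 2 P) < u"
      proof -
        have "\<forall>\<^sub>F P in at_top. sum_capacity K J h P / ereal (log 2 P) < ereal t"
          by (rule sum_capacity_upper_bound) (use assms nz t in simp_all)
        then show ?thesis by eventually_elim (use t(1) in order)
      qed
    qed
  qed
qed

end
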